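(* Let $x=(x_1,\dots,x_n)$ and $m$ a nonnegative integer. Then \[ \sum_{\substack{\lambda\\ \lambda_1\le 2m}}h^{(2m)}_\lambda(t_2,t_3;t)P_\lambda(x;t)=(x_1\cdots x_n)^mP^{(BC_n)}_{m^n}(x;t,t_2,t_3). \]
   Context: $(a;t)_k=\prod_{j=0}^{k-1}(1-at^j)$. $P_\lambda(x;t)$ is the Hall–Littlewood polynomial $\frac{1}{v_\lambda(t)}\sum_{w\in S_n}w\big(x^\lambda\prod_{i<j}\frac{x_i-tx_j}{x_i-x_j}\big)$, $v_\lambda(t)=\prod_{i\ge0}(t;t)_{m_i(\lambda)}/(1-t)^{m_i(\lambda)}$, $m_i(\lambda)$ the multiplicity of $i$, $m_0(\lambda)=n-\ell(\lambda)$ (zero if $\ell(\lambda)>n$). Rogers–Szegő: $H_k(z;q)=\sum_{j=0}^kz^j\frac{(q;q)_k}{(q;q)_j(q;q)_{k-j}}$, and $h^{(M)}_\lambda(a,b;q)=\prod_{i\text{ odd},\,1\le i\le M-1}(-a)^{m_i(\lambda)}H_{m_i(\lambda)}(b/a;q)\prod_{i\text{ even},\,1\le i\le M-1}H_{m_i(\lambda)}(ab;q)$. For a partition $\lambda$ with $\ell(\lambda)\le n$, \[P^{(BC_n)}_\lambda(x;t,t_2,t_3)=\frac{1}{(t_2t_3;t)_{n-\ell(\lambda)}v_\lambda(t)}\sum_{w\in W}w\Big(x^{-\lambda}\prod_{i=1}^n\frac{(1-t_2x_i)(1-t_3x_i)}{1-x_i^2}\prod_{i<j}\frac{(tx_i-x_j)(1-tx_ix_j)}{(x_i-x_j)(1-x_ix_j)}\Big),\]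 $W$ the hyperoctahedral group acting by permutations and inversions of the $x_i$. *)

theory Defs
  imports
    Complex_Main
    "HOL-Combinatorics.Permutations"
    "HOL-Library.More_List"
    "HOL-Library.Groups_Big_Fun"
begin

text \<open>
  Identities between rational functions in \<open>x\<^sub>1, \<dots>, x\<^sub>n, t, t\<^sub>2, t\<^sub>3\<close> are expressed by evaluation at
  points of an arbitrary field of characteristic 0 at which no denominator vanishes; taking the
  field to be a field of rational functions recovers the formal identity. The variables
  \<open>x\<^sub>1, \<dots>, x\<^sub>n\<close> are the values \<open>x 0, \<dots>, x (n - 1)\<close> of a function on the natural numbers.
\<close>

definition qpoch :: "'a::field \<Rightarrow> 'a \<Rightarrow> nat \<Rightarrow> 'a" where
  "qpoch a t k = (\<Prod>j<k. 1 - a * t ^ j)"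

text \<open>Partitions are lists of their nonzero parts, so that \<open>\<ell>(\<lambda>)\<close> is the length of the list.\<close>

definition is_partition :: "nat list \<Rightarrow> bool" where
  "is_partition la \<longleftrightarrow> sorted_wrt (\<ge>) la \<and> 0 \<notin> set la"

text \<open>\<open>part la i\<close> is \<open>\<lambda>\<^sub>i\<^sub>+\<^sub>1\<close>; in particular \<open>\<lambda>\<^sub>1 = part la 0\<close>.\<close>

definition part :: "nat list \<Rightarrow> nat \<Rightarrow> nat" where
  "part la i = nth_default 0 la i"

text \<open>Here \<open>n\<close> is the number of variables, which enters through \<open>m\<^sub>0(\<lambda>) = n - \<ell>(\<lambda>)\<close>.\<close>

definition part_mult :: "nat \<Rightarrow> nat list \<Rightarrow> nat \<Rightarrow> nat" where
  "part_mult n la i = (if i = 0 then n - length la else count_list la i)"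

definition rect_partition :: "nat \<Rightarrow> nat \<Rightarrow> nat list" where
  "rect_partition m n = (if m = 0 then [] else replicate n m)"

text \<open>All factors of \<open>v\<^sub>\<lambda>(t)\<close> with \<open>i > \<lambda>\<^sub>1\<close> are 1.\<close>

definition vfac :: "nat \<Rightarrow> nat list \<Rightarrow> 'a::field \<Rightarrow> 'a" where
  "vfac n la t = (\<Prod>i\<le>part la 0. qpoch t t (part_mult n la i) / (1 - t) ^ part_mult n la i)"

definition HL_summand :: "nat \<Rightarrow> nat list \<Rightarrow> 'a::field \<Rightarrow> (nat \<Rightarrow> 'a) \<Rightarrow> 'a" where
  "HL_summand n la t x =
     (\<Prod>i<n. x i ^ part la i) * (\<Prod>j<n. \<Prod>i<j. (x i - t * x j) / (x i - x j))"

definition HL_P :: "nat \<Rightarrow> nat list \<Rightarrow> (nat \<Rightarrow> 'a::field) \<Rightarrow> 'a \<Rightarrow> 'a" where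
  "HL_P n la x t =
     (if length la > n then 0
      else 1 / vfac n la t * (\<Sum>p | p permutes {..<n}. HL_summand n la t (x \<circ> p)))"

definition rogers_szego :: "nat \<Rightarrow> 'a::field \<Rightarrow> 'a \<Rightarrow> 'a" where
  "rogers_szego k z q = (\<Sum>j\<le>k. z ^ j * (qpoch q q k / (qpoch q q j * qpoch q q (k - j))))"

text \<open>Only parts \<open>i \<ge> 1\<close> contribute, so the number of variables is irrelevant here.\<close>

definition h_fun :: "nat \<Rightarrow> nat list \<Rightarrow> 'a::field \<Rightarrow> 'a \<Rightarrow> 'a \<Rightarrow> 'a" where
  "h_fun M la a b q =
     (\<Prod>i | i \<in> {1..<M} \<and> odd i. (- a) ^ count_list la i * rogers_szego (count_list la i) (b / a) q) *
     (\<Prod>i | i \<in> {1..<M} \<and> even i. rogers_szego (count_list la i) (a * b) q)"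

text \<open>
  An element of the hyperoctahedral group is encoded as a pair \<open>(p, S)\<close> of a permutation and a set
  of variables to be inverted; it maps \<open>x\<^sub>i\<close> to \<open>x\<^bsub>p(i)\<^esub>\<close>, or to its inverse if \<open>p(i) \<in> S\<close>.
\<close>

definition hyperoct :: "nat \<Rightarrow> ((nat \<Rightarrow> nat) \<times> nat set) set" where
  "hyperoct n = {p. p permutes {..<n}} \<times> Pow {..<n}"

definition hyperoct_act :: "(nat \<Rightarrow> nat) \<times> nat set \<Rightarrow> (nat \<Rightarrow> 'a::field) \<Rightarrow> nat \<Rightarrow> 'a" where
  "hyperoct_act w x i =
     (if fst w i \<in> snd w then inverse (x (fst w i)) else x (fst w i))"

definition BC_summand :: "nat \<Rightarrow> nat list \<Rightarrow> 'a::field \<Rightarrow> 'a \<Rightarrow> 'a \<Rightarrow> (nat \<Rightarrow> 'a) \<Rightarrow> 'a" where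
  "BC_summand n la t t2 t3 x =
     (\<Prod>i<n. inverse (x i) ^ part la i) *
     (\<Prod>i<n. (1 - t2 * x i) * (1 - t3 * x i) / (1 - (x i)\<^sup>2)) *
     (\<Prod>j<n. \<Prod>i<j. (t * x i - x j) * (1 - t * x i * x j) / ((x i - x j) * (1 - x i * x j)))"

definition BC_P :: "nat \<Rightarrow> nat list \<Rightarrow> (nat \<Rightarrow> 'a::field) \<Rightarrow> 'a \<Rightarrow> 'a \<Rightarrow> 'a \<Rightarrow> 'a" where
  "BC_P n la x t t2 t3 =
     1 / (qpoch (t2 * t3) t (n - length la) * vfac n la t) *
     (\<Sum>w\<in>hyperoct n. BC_summand n la t t2 t3 (hyperoct_act w x))"

text \<open>
  Since \<open>P\<^sub>\<lambda>\<close> vanishes for \<open>\<ell>(\<lambda>) > n\<close>, a sum over all partitions with bounded parts has finite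
  support, so that \<^const>\<open>Sum_any\<close> is the intended sum.
\<close>

lemma finite_bounded_partitions:
  "finite {la. is_partition la \<and> part la 0 \<le> M \<and> length la \<le> n}"
proof (rule finite_subset)
  show "{la. is_partition la \<and> part la 0 \<le> M \<and> length la \<le> n}
      \<subseteq> {la. set la \<subseteq> {..M} \<and> length la \<le> n}"
  proof safe
    fix la k
    assume "is_partition la" "part la 0 \<le> M" "k \<in> set la"
    then show "k \<le> M"
      by (cases la) (auto simp: is_partition_def part_def)
  qed
  show "finite {la. set la \<subseteq> {..M} \<and> length la \<le> n}"
    by (rule finite_lists_length_le) simp
qed

lemma Sum_any_HL_P:
  "Sum_any (\<lambda>la. if is_partition la \<and> part la 0 \<le> M then c la * HL_P n la x t else 0)
   = (\<Sum>la | is_partition la \<and> part la 0 \<le> M \<and> length la \<le> n. c la * HL_P n la x t)"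
proof -
  let ?f = "\<lambda>la. if is_partition la \<and> part la 0 \<le> M then c la * HL_P n la x t else 0"
  let ?A = "{la. is_partition la \<and> part la 0 \<le> M \<and> length la \<le> n}"
  have "Sum_any ?f = sum ?f ?A"
    by (rule Sum_any.expand_superset)
      (auto simp: finite_bounded_partitions HL_P_def split: if_splits)
  also have "\<dots> = (\<Sum>la\<in>?A. c la * HL_P n la x t)"
    by (rule sum.cong) auto
  finally show ?thesis .
qed

end

theory Submission
  imports
    Defs
    "HOL-Library.Function_Algebras"
    "HOL-Library.FuncSet"
    "HOL-Computational_Algebra.Polynomial"
    "HOL-Combinatorics.Multiset_Permutations"
begin

text \<open>
  Functions \<open>F\<close> of a set \<open>A\<close> of variables form an associative algebra under
  \<open>(F \<star> G)(A) = \<Sum>K \<subseteq> A. F(K) G(A - K) \<Prod>i \<in> A - K, j \<in> K. (x\<^sub>i - t x\<^sub>j) / (x\<^sub>i - x\<^sub>j)\<close>,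
  on which multiplication by \<open>\<Prod>i \<in> A. w(x\<^sub>i)\<close> (a twist) is an automorphism. Write \<open>E(w)\<close> for the
  function \<open>A \<mapsto> \<Prod>i \<in> A. w(x\<^sub>i)\<close>.

  Sorting the permutations in \<open>P\<^sub>\<lambda>\<close> by the level sets of \<open>\<lambda>\<close> turns the left-hand side into an iterated
  product of twists of \<open>E(1) \<star> E(ab)\<close> at even levels and \<open>E(-a) \<star> E(-b)\<close> at odd levels, because
  the Rogers-Szego polynomial \<open>H\<^sub>k(z)\<close> is the value of \<open>E(1) \<star> E(z)\<close> on \<open>k\<close>-element sets. The right-hand
  side becomes \<open>R\<^sub>m = C \<star> x\<^sup>2\<^sup>m C(1/x)\<close>, where \<open>C\<close> is the product in \<open>P\<^sup>(\<^sup>B\<^sup>C\<^sup>)\<close> that is symmetric under permutations.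

  The identity \<open>E(d) \<star> E(c x) = E(d + c x)\<close> gives \<open>E((1 - a x)(1 - b x)) = E(1) \<star> E(-a x) \<star> E(-b x) \<star> E(ab x\<^sup>2)\<close>,
  and for \<open>a = b = 0\<close> the function \<open>C\<close> satisfies \<open>C = E(1) \<star> x\<^sup>2 C\<close>. Together they yield
  \<open>R\<^sub>m\<^sub>+\<^sub>1 = E((1 - a x)(1 - b x)) \<star> x\<^sup>2 R\<^sub>m\<close>, which matches the recursion of the left-hand side, and
  \<open>R\<^sub>0 = (ab; t)\<^sub>|\<^sub>A\<^sub>|\<close> starts the induction. Each of these facts is proved by exhibiting a functional equation
  with a unique solution at generic points and, where necessary, extending from generic \<open>t\<close> by polynomiality.
\<close>

section \<open>The shuffle product on functions of sets of variables\<close>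

text \<open>In the weight, \<open>i\<close> runs over the argument of the right factor and
  \<open>j\<close> over that of the left one. The functions multiplied here vanish off the subsets
  of \<open>N\<close>, so that identities hold as equalities of functions and can be rewritten
  inside products.\<close>

definition star :: "nat set \<Rightarrow> (nat \<Rightarrow> nat \<Rightarrow> 'a::field) \<Rightarrow> (nat set \<Rightarrow> 'a) \<Rightarrow> (nat set \<Rightarrow> 'a) \<Rightarrow> nat set \<Rightarrow> 'a" where
  "star N g F G A = (if A \<subseteq> N then \<Sum>K\<in>Pow A. F K * G (A - K) * (\<Prod>i\<in>A - K. \<Prod>j\<in>K. g i j) else 0)"

definition grouplike :: "nat set \<Rightarrow> (nat \<Rightarrow> 'a::field) \<Rightarrow> nat set \<Rightarrow> 'a" where
  "grouplike N w A = (if A \<subseteq> N then \<Prod>i\<in>A. w i else 0)"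

definition primitive :: "nat set \<Rightarrow> (nat \<Rightarrow> 'a::field) \<Rightarrow> nat set \<Rightarrow> 'a" where
  "primitive N w A = (if A \<subseteq> N \<and> card A = 1 then \<Prod>i\<in>A. w i else 0)"

definition card_fun :: "nat set \<Rightarrow> (nat \<Rightarrow> 'a::field) \<Rightarrow> nat set \<Rightarrow> 'a" where
  "card_fun N f A = (if A \<subseteq> N then f (card A) else 0)"

definition twist :: "(nat \<Rightarrow> 'a::field) \<Rightarrow> (nat set \<Rightarrow> 'a) \<Rightarrow> nat set \<Rightarrow> 'a" where
  "twist w F A = (\<Prod>i\<in>A. w i) * F A"

text \<open>Both sides are sums over ordered partitions of \<open>A\<close> into three blocks, with
  the kernel taken over all cross pairs of blocks; the bracketings differ only in which two blocks
  are merged first.\<close>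

lemma star_assoc:
  assumes "finite N"
  shows "star N g (star N g F G) H = star N g F (star N g G H)"
proof
  fix A
  show "star N g (star N g F G) H A = star N g F (star N g G H) A"
  proof (cases "A \<subseteq> N")
    case True
    have fA: "finite A" using True assms finite_subset by blast
    let ?w = "\<lambda>B K. \<Prod>i\<in>B. \<Prod>j\<in>K. g i j"
    have split1: "?w B (K \<union> Q) = ?w B K * ?w B Q" if "finite K" "finite Q" "K \<inter> Q = {}" for B K Q
      using that by (simp add: prod.union_disjoint prod.distrib)
    have split2: "?w (B \<union> D) K = ?w B K * ?w D K" if "finite B" "finite D" "B \<inter> D = {}" for B D K
      using that by (simp add: prod.union_disjoint)
    have "star N g (star N g F G) H A =
      (\<Sum>P\<in>Pow A. \<Sum>K\<in>Pow P. F K * G (P - K) * ?w (P - K) K * (H (A - P) * ?w (A - P) P))"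
      using True unfolding star_def
      by (auto simp: sum_distrib_left sum_distrib_right mult_ac intro!: sum.cong)
    also have "\<dots> = (\<Sum>(P,K)\<in>Sigma (Pow A) Pow. F K * G (P - K) * ?w (P - K) K * (H (A - P) * ?w (A - P) P))"
      using fA by (subst sum.Sigma) (auto intro: finite_subset)
    also have "\<dots> = (\<Sum>(K,Q)\<in>Sigma (Pow A) (\<lambda>K. Pow (A - K)).
       F K * (G Q * H (A - K - Q) * ?w (A - K - Q) Q) * ?w (A - K) K)"
    \<comment> \<open>\<open>P\<close> is the union of the first two blocks and \<open>K\<close> the
      first one, so the second block is \<open>P - K\<close> and the third
      \<open>A - P\<close>.\<close>
    proof (rule sum.reindex_bij_witness[where i = "\<lambda>(K,Q). (K \<union> Q, K)" and j = "\<lambda>(P,K). (K, P - K)"], goal_cases)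
      case (5 a)
      obtain P K where a: "a = (P, K)" "P \<subseteq> A" "K \<subseteq> P" using 5 by (cases a) auto
      have fin: "finite P" "finite K"
        using finite_subset[OF a(2) fA] finite_subset[OF subset_trans[OF a(3) a(2)] fA] by simp_all
      have P: "K \<union> (P - K) = P" using a by auto
      have AK: "(P - K) \<union> (A - P) = A - K" using a by auto
      have e: "A - K - (P - K) = A - P" using a by auto
      have w1: "?w (A - P) P = ?w (A - P) K * ?w (A - P) (P - K)"
        using split1[of K "P - K" "A - P"] fin unfolding P by simp
      have w2: "?w (A - K) K = ?w (P - K) K * ?w (A - P) K"
        using split2[of "P - K" "A - P" K] fin fA unfolding AK by auto
      have "F K * (G (P - K) * H (A - P) * ?w (A - P) (P - K)) * (?w (P - K) K * ?w (A - P) K)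
        = F K * G (P - K) * ?w (P - K) K * (H (A - P) * (?w (A - P) K * ?w (A - P) (P - K)))"
        by (simp only: mult_ac)
      then show ?case unfolding a prod.case e w1 w2 .
    next
      case (1 a) then show ?case by (cases a) auto
    next
      case (2 a) then show ?case by (cases a) auto
    next
      case (3 b) then show ?case by (cases b) auto
    next
      case (4 b) then show ?case by (cases b) auto
    qed
    also have "\<dots> = (\<Sum>K\<in>Pow A. \<Sum>Q\<in>Pow (A - K). F K * (G Q * H (A - K - Q) * ?w (A - K - Q) Q) * ?w (A - K) K)"
      using fA by (subst sum.Sigma) (auto intro: finite_subset)
    also have "\<dots> = (\<Sum>K\<in>Pow A. F K * star N g G H (A - K) * ?w (A - K) K)"
    proof (rule sum.cong[OF refl])
      fix K assume "K \<in> Pow A"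
      then have "A - K \<subseteq> N" using True by auto
      then show "(\<Sum>Q\<in>Pow (A - K). F K * (G Q * H (A - K - Q) * ?w (A - K - Q) Q) * ?w (A - K) K)
        = F K * star N g G H (A - K) * ?w (A - K) K"
        unfolding star_def by (simp only: if_True sum_distrib_left sum_distrib_right)
    qed
    also have "\<dots> = star N g F (star N g G H) A"
      using True by (simp add: star_def[of N g F])
    finally show ?thesis .
  qed (simp add: star_def)
qed

lemma star_add_left: "star N g (F + F') G = star N g F G + star N g F' G"
  by (auto simp: fun_eq_iff star_def algebra_simps sum.distrib)

lemma star_add_right: "star N g F (G + G') = star N g F G + star N g F G'"
  by (auto simp: fun_eq_iff star_def algebra_simps sum.distrib)

text \<open>Replace \<open>K\<close> by its complement. Together with \<open>phi_inverse\<close>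
  this makes the inversion of all variables reverse star products.\<close>

lemma star_swap:
  assumes "finite N"
  shows "star N (\<lambda>i j. g j i) F G = star N g G F"
proof
  fix A
  show "star N (\<lambda>i j. g j i) F G A = star N g G F A"
  proof (cases "A \<subseteq> N")
    case True
    have "(\<Sum>K\<in>Pow A. F K * G (A - K) * (\<Prod>i\<in>A - K. \<Prod>j\<in>K. g j i))
       = (\<Sum>K\<in>Pow A. G K * F (A - K) * (\<Prod>i\<in>A - K. \<Prod>j\<in>K. g i j))"
    proof (rule sum.reindex_bij_witness[where i = "\<lambda>K. A - K" and j = "\<lambda>K. A - K"], goal_cases)
      case (5 K)
      then have "A - (A - K) = K" by auto
      then show ?case by (simp add: mult_ac prod.swap[of _ K])
    qed auto
    then show ?thesis using True by (simp add: star_def)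
  qed (simp add: star_def)
qed

lemma star_cong:
  assumes "\<And>B. B \<subseteq> A \<Longrightarrow> F B = F' B" "\<And>B. B \<subseteq> A \<Longrightarrow> G B = G' B"
    and "\<And>i j. i \<in> A \<Longrightarrow> j \<in> A \<Longrightarrow> i \<noteq> j \<Longrightarrow> g i j = g' i j"
  shows "star N g F G A = star N g' F' G' A"
proof -
  have "F K * G (A - K) * (\<Prod>i\<in>A - K. \<Prod>j\<in>K. g i j) = F' K * G' (A - K) * (\<Prod>i\<in>A - K. \<Prod>j\<in>K. g' i j)"
    if "K \<subseteq> A" for K
    using that by (intro arg_cong2[of _ _ _ _ "(*)"] prod.cong assms refl) auto
  then show ?thesis unfolding star_def by (auto intro!: sum.cong)
qed

lemma star_empty: "star N g F G {} = F {} * G {}"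
  by (simp add: star_def)

text \<open>Separates the only two terms that contain a value of \<open>F\<close> or
  \<open>G\<close> at \<open>A\<close> itself. An equation between products can then be solved at
  \<open>A\<close> once the proper subsets are known.\<close>

lemma star_extremes:
  assumes "finite A" "A \<noteq> {}" "A \<subseteq> N" "F {} = 1" "G {} = 1"
  shows "star N g F G A = F A + G A
    + (\<Sum>K\<in>Pow A - {{}, A}. F K * G (A - K) * (\<Prod>i\<in>A - K. \<Prod>j\<in>K. g i j))"
proof -
  have "Pow A = insert {} (insert A (Pow A - {{}, A}))" by auto
  then have "(\<Sum>K\<in>Pow A. F K * G (A - K) * (\<Prod>i\<in>A - K. \<Prod>j\<in>K. g i j))
    = (\<Sum>K\<in>insert {} (insert A (Pow A - {{}, A})). F K * G (A - K) * (\<Prod>i\<in>A - K. \<Prod>j\<in>K. g i j))"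
    by simp
  also have "\<dots> = F A + G A + (\<Sum>K\<in>Pow A - {{}, A}. F K * G (A - K) * (\<Prod>i\<in>A - K. \<Prod>j\<in>K. g i j))"
    using assms by (subst sum.insert; simp add: add_ac)+
  finally show ?thesis using assms(3) by (simp add: star_def)
qed

lemma twist_star:
  assumes "finite N"
  shows "twist w (star N g F G) = star N g (twist w F) (twist w G)"
proof
  fix A
  show "twist w (star N g F G) A = star N g (twist w F) (twist w G) A"
  proof (cases "A \<subseteq> N")
    case True
    have "prod w A = prod w K * prod w (A - K)" if "K \<subseteq> A" for K
      using that True assms by (metis finite_subset mult.commute prod.subset_diff)
    then show ?thesis using True
      by (auto simp: twist_def star_def sum_distrib_left mult_ac intro!: sum.cong)
  qed (simp add: star_def twist_def)
qed

lemma twist_twist: "twist w (twist w' F) = twist (\<lambda>i. w i * w' i) F"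
  by (simp add: twist_def fun_eq_iff prod.distrib mult_ac)

lemma twist_grouplike: "twist w (grouplike N w') = grouplike N (\<lambda>i. w i * w' i)"
  by (simp add: twist_def fun_eq_iff grouplike_def prod.distrib)

lemma twist_primitive: "twist w (primitive N w') = primitive N (\<lambda>i. w i * w' i)"
  by (simp add: twist_def fun_eq_iff primitive_def prod.distrib)

lemma twist_add: "twist w (F + G) = twist w F + twist w G"
  by (simp add: twist_def fun_eq_iff algebra_simps)

text \<open>A function carried by singletons removes one variable at a time, so the sums produced by
  partial fractions become products with a \<open>primitive\<close> factor.\<close>

lemma star_primitive_left:
  assumes "finite N" "A \<subseteq> N"
  shows "star N g (primitive N w) F A = (\<Sum>i\<in>A. w i * F (A - {i}) * (\<Prod>j\<in>A - {i}. g j i))"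
proof -
  have fA: "finite A" using assms finite_subset by blast
  have "(\<Sum>K\<in>Pow A. primitive N w K * F (A - K) * (\<Prod>i\<in>A - K. \<Prod>j\<in>K. g i j))
    = (\<Sum>K\<in>(\<lambda>i. {i}) ` A. primitive N w K * F (A - K) * (\<Prod>i\<in>A - K. \<Prod>j\<in>K. g i j))"
    using fA by (intro sum.mono_neutral_right) (auto simp: primitive_def card_1_singleton_iff)
  also have "\<dots> = (\<Sum>i\<in>A. w i * F (A - {i}) * (\<Prod>j\<in>A - {i}. g j i))"
    using assms by (subst sum.reindex) (auto simp: primitive_def inj_on_def intro!: sum.cong)
  finally show ?thesis using assms by (simp add: star_def)
qed

lemma star_primitive_right:
  assumes "finite N" "A \<subseteq> N"
  shows "star N g F (primitive N w) A = (\<Sum>i\<in>A. w i * F (A - {i}) * (\<Prod>j\<in>A - {i}. g i j))"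
  using star_primitive_left[OF assms, of "\<lambda>i j. g j i" w F] star_swap[OF assms(1), of g "primitive N w" F]
  by simp

section \<open>Partial fractions and linear factors\<close>

text \<open>As a function of \<open>z\<close>, the product tends to 1 at infinity and has simple
  poles at the \<open>s i\<close>; the summands are its principal parts. Induction on
  \<open>A\<close> replaces the analytic argument and works over any field.\<close>

lemma partial_fractions:
  fixes s :: "'i \<Rightarrow> 'a::field"
  assumes "finite A" "inj_on s A" "z \<notin> s ` A"
  shows "(\<Prod>j\<in>A. (z - r j) / (z - s j)) =
    1 + (\<Sum>i\<in>A. (s i - r i) / (z - s i) * (\<Prod>j\<in>A - {i}. (s i - r j) / (s i - s j)))"
  using assms
proof (induction A arbitrary: z)
  case (insert k A)
  let ?c = "\<lambda>i. (s i - r i) * (\<Prod>j\<in>A - {i}. (s i - r j) / (s i - s j))"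
  have IH: "(\<Prod>j\<in>A. (z - r j) / (z - s j)) = 1 + (\<Sum>i\<in>A. ?c i / (z - s i))" if "z \<notin> s ` A" for z
    using insert.IH[of z] insert.prems that by simp
  have z: "z \<noteq> s k" "\<And>i. i \<in> A \<Longrightarrow> z \<noteq> s i" using insert.prems by auto
  have k: "\<And>i. i \<in> A \<Longrightarrow> s i \<noteq> s k" "s k \<notin> s ` A" using insert.prems insert.hyps by (auto simp: inj_on_def)
  have summand: "(s i - r i) / (z - s i) * (\<Prod>j\<in>insert k A - {i}. (s i - r j) / (s i - s j))
      = ?c i / (z - s i) * ((s i - r k) / (s i - s k))" if "i \<in> A" for i
  proof -
    have "insert k A - {i} = insert k (A - {i})" using that insert.hyps by auto
    then show ?thesis using insert.hyps by simp
  qed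
  \<comment> \<open>The new factor times the pole at \<open>s i\<close> is split into separate poles
    at \<open>s i\<close> and \<open>s k\<close>.\<close>
  have pf: "(z - r k) / (z - s k) * (c / (z - s i)) =
     c / (z - s i) * ((s i - r k) / (s i - s k)) + (s k - r k) / (z - s k) * (c / (s k - s i))"
    if "i \<in> A" for i c
  proof -
    define p q u where "p = z - s k" and "q = z - s i" and "u = z - r k"
    have nz: "p \<noteq> 0" "q \<noteq> 0" "p - q \<noteq> 0" using z k that by (auto simp: p_def q_def)
    have e: "z - s k = p" "z - s i = q" "z - r k = u" "s i - r k = u - q" "s i - s k = p - q"
       "s k - r k = u - p" "s k - s i = - (p - q)"
      by (auto simp: p_def q_def u_def)
    have "u / p * (c / q) = c / q * ((u - q) / (p - q)) + (u - p) / p * (c / (- (p - q)))"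
      using nz by (simp add: divide_simps) (simp add: algebra_simps)
    then show ?thesis by (simp only: e)
  qed
  have "(\<Prod>j\<in>insert k A. (z - r j) / (z - s j)) = (z - r k) / (z - s k) * (1 + (\<Sum>i\<in>A. ?c i / (z - s i)))"
    using insert.hyps IH z insert.prems by simp
  also have "\<dots> = (z - r k) / (z - s k) + (\<Sum>i\<in>A. ?c i / (z - s i) * ((s i - r k) / (s i - s k)))
      + (s k - r k) / (z - s k) * (\<Sum>i\<in>A. ?c i / (s k - s i))"
    using pf by (simp add: distrib_left sum_distrib_left sum.distrib[symmetric] add.assoc)
  also have "\<dots> = 1 + (\<Sum>i\<in>A. ?c i / (z - s i) * ((s i - r k) / (s i - s k)))
      + (s k - r k) / (z - s k) * (1 + (\<Sum>i\<in>A. ?c i / (s k - s i)))"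
  proof -
    have "(z - r k) / (z - s k) = 1 + (s k - r k) / (z - s k)"
      using z by (simp add: divide_simps)
    then show ?thesis by (simp add: algebra_simps)
  qed
  \<comment> \<open>The contributions to the new pole are recognised as the induction hypothesis at
    \<open>z = s k\<close>, that is, as the old product evaluated there.\<close>
  also have "1 + (\<Sum>i\<in>A. ?c i / (s k - s i)) = (\<Prod>j\<in>A. (s k - r j) / (s k - s j))"
    using IH[OF k(2)] by simp
  finally have e1: "(\<Prod>j\<in>insert k A. (z - r j) / (z - s j)) =
     1 + ((s k - r k) / (z - s k) * (\<Prod>j\<in>A. (s k - r j) / (s k - s j))
       + (\<Sum>i\<in>A. ?c i / (z - s i) * ((s i - r k) / (s i - s k))))"
    by (simp only: add_ac)
  have e2: "insert k A - {k} = A" using insert.hyps by auto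
  have e3: "(\<Sum>i\<in>A. (s i - r i) / (z - s i) * (\<Prod>j\<in>insert k A - {i}. (s i - r j) / (s i - s j)))
      = (\<Sum>i\<in>A. ?c i / (z - s i) * ((s i - r k) / (s i - s k)))"
    using summand by (rule sum.cong[OF refl])
  show ?case unfolding sum.insert[OF insert.hyps] e1 e2 e3 by (rule refl)
next
  case empty
  show ?case by simp
qed

text \<open>This compares the coefficients of \<open>1 / z\<close> at infinity on the two sides of
  \<open>partial_fractions\<close>.\<close>

lemma partial_fractions_moment:
  fixes s :: "'i \<Rightarrow> 'a::field"
  assumes "finite A" "inj_on s A"
  shows "(\<Sum>i\<in>A. (s i - r i) * (\<Prod>j\<in>A - {i}. (s i - r j) / (s i - s j))) = (\<Sum>i\<in>A. s i - r i)"
  using assms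
proof (induction A)
  case (insert k A)
  let ?c = "\<lambda>i. (s i - r i) * (\<Prod>j\<in>A - {i}. (s i - r j) / (s i - s j))"
  have k: "\<And>i. i \<in> A \<Longrightarrow> s i \<noteq> s k" "s k \<notin> s ` A" using insert.prems insert.hyps by (auto simp: inj_on_def)
  have summand: "(s i - r i) * (\<Prod>j\<in>insert k A - {i}. (s i - r j) / (s i - s j))
      = ?c i - (s k - r k) * (?c i / (s k - s i))" if "i \<in> A" for i
  proof -
    have "insert k A - {i} = insert k (A - {i})" using that insert.hyps by auto
    moreover have "(s i - r k) / (s i - s k) = 1 - (s k - r k) / (s k - s i)"
      using k(1)[OF that] by (simp add: divide_simps) (simp add: algebra_simps)
    ultimately have "(s i - r i) * (\<Prod>j\<in>insert k A - {i}. (s i - r j) / (s i - s j))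
      = ?c i * (1 - (s k - r k) / (s k - s i))"
      using insert.hyps by simp
    moreover have "c * (1 - u / d) = c - u * (c / d)" for c u d :: 'a
      by (simp add: algebra_simps)
    ultimately show ?thesis by (simp only:)
  qed
  have pk: "(\<Prod>j\<in>A. (s k - r j) / (s k - s j)) = 1 + (\<Sum>i\<in>A. ?c i / (s k - s i))"
    using partial_fractions[of A s "s k" r] insert k by simp
  have "(\<Sum>i\<in>insert k A. (s i - r i) * (\<Prod>j\<in>insert k A - {i}. (s i - r j) / (s i - s j)))
    = (s k - r k) * (1 + (\<Sum>i\<in>A. ?c i / (s k - s i))) + (\<Sum>i\<in>A. ?c i) - (s k - r k) * (\<Sum>i\<in>A. ?c i / (s k - s i))"
    (is "?L = ?R")
  proof -
    have "insert k A - {k} = A" using insert.hyps by auto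
    then have "?L = (s k - r k) * (1 + (\<Sum>i\<in>A. ?c i / (s k - s i)))
        + (\<Sum>i\<in>A. ?c i - (s k - r k) * (?c i / (s k - s i)))"
      using summand by (simp only: sum.insert[OF insert.hyps] pk cong: sum.cong)
    then show ?thesis by (simp only: sum_subtractf sum_distrib_left add_diff_eq)
  qed
  also have "\<dots> = (s k - r k) + (\<Sum>i\<in>A. ?c i)" by (simp add: distrib_left)
  also have "(\<Sum>i\<in>A. ?c i) = (\<Sum>i\<in>A. s i - r i)" using insert by (simp add: inj_on_def)
  finally show ?case using insert.hyps by simp
qed simp

section \<open>Symmetric sums of products of the Hall-Littlewood kernel\<close>

definition phi :: "(nat \<Rightarrow> 'a::field) \<Rightarrow> 'a \<Rightarrow> nat \<Rightarrow> nat \<Rightarrow> 'a" where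
  "phi x t i j = (x i - t * x j) / (x i - x j)"

text \<open>Clearing denominators exchanges the two variables. If \<open>x i = x j\<close>, both
  sides are 0 because division by 0 gives 0.\<close>

lemma phi_inverse:
  assumes "x i \<noteq> 0" "x j \<noteq> 0"
  shows "phi (\<lambda>k. inverse (x k)) t i j = phi x t j i"
proof (cases "x i = x j")
  case False
  then have "inverse (x i) - inverse (x j) = (x j - x i) / (x i * x j)"
    "inverse (x i) - t * inverse (x j) = (x j - t * x i) / (x i * x j)"
    using assms by (simp_all add: field_simps)
  then show ?thesis using assms by (simp add: phi_def)
qed (simp add: phi_def)

text \<open>\<open>partial_fractions\<close> with zeros \<open>t * x i\<close>, where each residue
  acquires the factor \<open>(1 - t) * x i\<close>.\<close>

lemma prod_phi_plus:
  assumes "finite A" "inj_on x A" "s \<notin> x ` A"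
  shows "(\<Prod>j\<in>A. (s - t * x j) / (s - x j)) = 1 + (1 - t) * (\<Sum>i\<in>A. x i / (s - x i) * (\<Prod>j\<in>A - {i}. phi x t i j))"
  using partial_fractions[OF assms, of "\<lambda>i. t * x i"]
  by (simp add: phi_def sum_distrib_left algebra_simps)

text \<open>This is \<open>prod_phi_plus\<close> at the inverse variables, which transposes the
  kernel.\<close>

lemma prod_phi_minus:
  assumes "finite A" "inj_on x A" "s \<notin> x ` A" "s \<noteq> 0" "\<And>i. i \<in> A \<Longrightarrow> x i \<noteq> 0"
  shows "(\<Prod>j\<in>A. (x j - t * s) / (x j - s)) = 1 + (1 - t) * (\<Sum>i\<in>A. s / (x i - s) * (\<Prod>j\<in>A - {i}. phi x t j i))"
proof -
  let ?y = "\<lambda>i. inverse (x i)"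
  have "inj_on ?y A" using assms(2) by (auto simp: inj_on_def)
  moreover have "inverse s \<notin> ?y ` A" using assms(3) by auto
  ultimately have "(\<Prod>j\<in>A. (inverse s - t * ?y j) / (inverse s - ?y j))
    = 1 + (1 - t) * (\<Sum>i\<in>A. ?y i / (inverse s - ?y i) * (\<Prod>j\<in>A - {i}. phi ?y t i j))"
    using assms(1) by (intro prod_phi_plus)
  \<comment> \<open>Since \<open>s\<close> is not one of the variables, \<open>phi_inverse\<close>
    is applied to an auxiliary function with the values \<open>s\<close> and
    \<open>x j\<close>.\<close>
  moreover have "(inverse s - t * ?y j) / (inverse s - ?y j) = (x j - t * s) / (x j - s)" if "j \<in> A" for j
    using phi_inverse[of "\<lambda>k. if k = 0 then s else x j" 0 1 t] assms that by (simp add: phi_def)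
  moreover have "?y i / (inverse s - ?y i) = s / (x i - s)" if "i \<in> A" for i
  proof -
    have "x i \<noteq> s" "x i \<noteq> 0" using assms that by auto
    then have "inverse s - ?y i = (x i - s) / (s * x i)" using assms(4) by (simp add: field_simps)
    then show ?thesis using \<open>x i \<noteq> 0\<close> assms(4) by (simp add: field_simps)
  qed
  moreover have "(\<Prod>j\<in>A - {i}. phi ?y t i j) = (\<Prod>j\<in>A - {i}. phi x t j i)" if "i \<in> A" for i
    using assms that by (intro prod.cong phi_inverse) auto
  ultimately show ?thesis by simp
qed

text \<open>The expansion \<open>prod_phi_plus\<close> at \<open>s = 0\<close>, where every factor
  of the product equals \<open>t\<close>.\<close>

lemma sum_prod_phi_plus:
  assumes "finite A" "inj_on x A" "\<And>i. i \<in> A \<Longrightarrow> x i \<noteq> 0"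
  shows "(1 - t) * (\<Sum>i\<in>A. \<Prod>j\<in>A - {i}. phi x t i j) = 1 - t ^ card A"
proof -
  have "(\<Prod>j\<in>A. (0 - t * x j) / (0 - x j)) = t ^ card A"
    using assms by (simp add: prod_constant[symmetric] del: prod_constant cong: prod.cong)
  moreover have "(\<Sum>i\<in>A. x i / (0 - x i) * (\<Prod>j\<in>A - {i}. phi x t i j)) = - (\<Sum>i\<in>A. \<Prod>j\<in>A - {i}. phi x t i j)"
    unfolding sum_negf[symmetric] using assms by (intro sum.cong) auto
  ultimately show ?thesis using prod_phi_plus[of A x 0 t] assms by force
qed

lemma sum_prod_phi_minus:
  assumes "finite A" "inj_on x A" "\<And>i. i \<in> A \<Longrightarrow> x i \<noteq> 0"
  shows "(1 - t) * (\<Sum>i\<in>A. \<Prod>j\<in>A - {i}. phi x t j i) = 1 - t ^ card A"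
proof -
  let ?y = "\<lambda>i. inverse (x i)"
  have "inj_on ?y A" using assms(2) by (auto simp: inj_on_def)
  moreover have "(\<Prod>j\<in>A - {i}. phi ?y t i j) = (\<Prod>j\<in>A - {i}. phi x t j i)" if "i \<in> A" for i
    using assms that by (intro prod.cong phi_inverse) auto
  ultimately show ?thesis using sum_prod_phi_plus[of A ?y t] assms by simp
qed

text \<open>Both sides equal \<open>t ^ (card A - 1)\<close> times the sum of the
  \<open>x i\<close>. This follows from \<open>partial_fractions_moment\<close>, with zeros
  \<open>t * x i\<close> for the right side and, after division of each factor by \<open>t\<close>,
  with zeros \<open>x i / t\<close> for the left side.\<close>

lemma sum_prod_phi_exchange:
  assumes "finite A" "inj_on x A" "t \<noteq> 0" "t \<noteq> 1"
  shows "(\<Sum>i\<in>A. x i * (\<Prod>j\<in>A - {i}. phi x t j i)) = (\<Sum>i\<in>A. x i * (t ^ card (A - {i}) * (\<Prod>j\<in>A - {i}. phi x t i j)))"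
proof -
  have p: "(\<Sum>i\<in>A. x i * (\<Prod>j\<in>A - {i}. phi x t i j)) = (\<Sum>i\<in>A. x i)"
  proof -
    have "(1 - t) * (\<Sum>i\<in>A. x i * (\<Prod>j\<in>A - {i}. phi x t i j)) = (1 - t) * (\<Sum>i\<in>A. x i)"
      using partial_fractions_moment[OF assms(1,2), of "\<lambda>i. t * x i"]
      by (simp add: phi_def sum_distrib_left algebra_simps)
    then show ?thesis using assms by simp
  qed
  have m: "(\<Sum>i\<in>A. x i * (\<Prod>j\<in>A - {i}. phi x t j i / t)) = (\<Sum>i\<in>A. x i)"
  proof -
    have "phi x t j i / t = (x i - x j / t) / (x i - x j)" if "i \<in> A" "j \<in> A - {i}" for i j
    proof -
      have "x i \<noteq> x j" using that assms(2) by (auto simp: inj_on_def)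
      then show ?thesis using assms(3) unfolding phi_def by (simp add: divide_simps) (simp add: algebra_simps)
    qed
    then have "(\<Sum>i\<in>A. x i * (\<Prod>j\<in>A - {i}. phi x t j i / t)) =
       (\<Sum>i\<in>A. x i * (\<Prod>j\<in>A - {i}. (x i - x j / t) / (x i - x j)))"
      by (intro sum.cong refl arg_cong2[of _ _ _ _ "(*)"] prod.cong) auto
    moreover have "(1 - 1 / t) * (\<Sum>i\<in>A. x i * (\<Prod>j\<in>A - {i}. (x i - x j / t) / (x i - x j))) = (1 - 1 / t) * (\<Sum>i\<in>A. x i)"
      using partial_fractions_moment[OF assms(1,2), of "\<lambda>i. x i / t"]
      by (simp add: sum_distrib_left left_diff_distrib)
    ultimately show ?thesis using assms by simp
  qed
  have "(\<Sum>i\<in>A. x i * (t ^ card (A - {i}) * (\<Prod>j\<in>A - {i}. phi x t i j))) = t ^ (card A - 1) * (\<Sum>i\<in>A. x i)"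
    using assms(1) by (simp add: p[symmetric] sum_distrib_left mult_ac)
  also have "\<dots> = (\<Sum>i\<in>A. x i * (\<Prod>j\<in>A - {i}. phi x t j i))"
    using assms(1,3) by (simp add: m[symmetric] sum_distrib_left prod_dividef)
  finally show ?thesis by simp
qed

text \<open>At a nonempty \<open>A\<close> the equation expresses
  \<open>(1 - prod w A) * F A\<close> through values of \<open>F\<close> on sets with one element
  fewer. Hence the value at the empty set determines all others.\<close>

lemma twisted_equation_unique:
  assumes N: "finite N" "A \<subseteq> N"
    and F: "twist w F + star N g (primitive N v) F = F"
    and G: "twist w G + star N g (primitive N v) G = G"
    and "F {} = G {}"
    and w: "\<And>B. B \<subseteq> N \<Longrightarrow> B \<noteq> {} \<Longrightarrow> prod w B \<noteq> 1"
  shows "F A = G A"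
  using finite_subset[OF N(2,1)] N(2)
proof (induction A rule: finite_psubset_induct)
  case (psubset A)
  show ?case
  proof (cases "A = {}")
    case False
    have "star N g (primitive N v) F A = star N g (primitive N v) G A"
    proof -
      have "F (A - {i}) = G (A - {i})" if "i \<in> A" for i
        using psubset.IH[of "A - {i}"] psubset.prems that by auto
      then show ?thesis unfolding star_primitive_left[OF N(1) psubset.prems]
        by (intro sum.cong) auto
    qed
    then have "F A - prod w A * F A = G A - prod w A * G A"
      using fun_cong[OF F, of A] fun_cong[OF G, of A]
      by (metis add_diff_cancel_left' plus_fun_apply twist_def)
    then have "(1 - prod w A) * (F A - G A) = 0" by (simp add: algebra_simps)
    then show ?thesis using w[OF psubset.prems False] by simp
  qed (use assms in simp)
qed

lemma primitive_add: "primitive N (\<lambda>i. v i + w i) = primitive N v + primitive N w"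
  by (auto simp: primitive_def fun_eq_iff card_1_singleton_iff)

text \<open>At \<open>A\<close> the primitive term is \<open>prod w A * (1 - t ^ card A)\<close> by
  \<open>sum_prod_phi_minus\<close>, and the twist supplies the missing \<open>t ^ card A\<close>.
  In this equation \<open>E(w)\<close> plays the role of a q-exponential.\<close>

lemma grouplike_equation:
  assumes "finite N" "inj_on x N" "\<And>i. i \<in> N \<Longrightarrow> x i \<noteq> 0"
  shows "twist (\<lambda>_. t) (grouplike N w) + star N (phi x t) (primitive N (\<lambda>i. (1 - t) * w i)) (grouplike N w) = grouplike N w"
proof
  fix A
  show "(twist (\<lambda>_. t) (grouplike N w) + star N (phi x t) (primitive N (\<lambda>i. (1 - t) * w i)) (grouplike N w)) A = grouplike N w A"
  proof (cases "A \<subseteq> N")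
    case True
    have fA: "finite A" using True assms(1) finite_subset by blast
    have "star N (phi x t) (primitive N (\<lambda>i. (1 - t) * w i)) (grouplike N w) A
      = (\<Sum>i\<in>A. (1 - t) * w i * grouplike N w (A - {i}) * (\<Prod>j\<in>A - {i}. phi x t j i))"
      by (rule star_primitive_left[OF assms(1) True])
    also have "\<dots> = (\<Sum>i\<in>A. prod w A * ((1 - t) * (\<Prod>j\<in>A - {i}. phi x t j i)))"
    proof (rule sum.cong[OF refl])
      fix i assume "i \<in> A"
      then have "prod w A = w i * grouplike N w (A - {i})"
        using True fA by (auto simp: grouplike_def prod.remove)
      then show "(1 - t) * w i * grouplike N w (A - {i}) * (\<Prod>j\<in>A - {i}. phi x t j i)
         = prod w A * ((1 - t) * (\<Prod>j\<in>A - {i}. phi x t j i))" by simp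
    qed
    also have "\<dots> = prod w A * (1 - t ^ card A)"
      using sum_prod_phi_minus[of A x t] fA assms True
      by (simp add: sum_distrib_left[symmetric] inj_on_subset subset_iff)
    finally show ?thesis using True by (simp add: twist_def grouplike_def algebra_simps)
  qed (simp add: twist_def grouplike_def star_def)
qed

text \<open>The product solves the equation that \<open>grouplike_equation\<close> gives for
  \<open>d + c * x i\<close>, so uniqueness identifies the two functions.\<close>

lemma star_grouplike_linear_generic:
  assumes "finite N" "inj_on x N" "\<And>i. i \<in> N \<Longrightarrow> x i \<noteq> 0"
    and "t \<noteq> 0" "t \<noteq> 1" "\<And>k. 1 \<le> k \<Longrightarrow> k \<le> card N \<Longrightarrow> t ^ k \<noteq> 1" "A \<subseteq> N"
  shows "star N (phi x t) (grouplike N (\<lambda>_. d)) (grouplike N (\<lambda>i. c * x i)) A = grouplike N (\<lambda>i. d + c * x i) A"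
proof -
  let ?T = "twist (\<lambda>_. t)"
  let ?E = "grouplike N" and ?P = "\<lambda>w. primitive N (\<lambda>i. (1 - t) * w i)" and ?s = "star N (phi x t)"
  let ?d = "\<lambda>_::nat. d" and ?cx = "\<lambda>i. c * x i"
  let ?F = "?s (?E ?d) (?E ?cx)"
  have PE: "?T (?E w) + ?s (?P w) (?E w) = ?E w" for w
    by (rule grouplike_equation[OF assms(1-3)])
  \<comment> \<open>By \<open>sum_prod_phi_exchange\<close>, the primitive factor of
    \<open>c * x i\<close> moves past the constant function at the cost of a twist by
    \<open>t\<close>. It then stands next to \<open>E(c x)\<close>, where its own equation
    applies.\<close>
  have ex: "?s (?P ?cx) (?E ?d) = ?s (?T (?E ?d)) (?P ?cx)"
  proof
    fix A
    show "?s (?P ?cx) (?E ?d) A = ?s (?T (?E ?d)) (?P ?cx) A"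
    proof (cases "A \<subseteq> N")
      case True
      have fA: "finite A" using True assms(1) finite_subset by blast
      have E: "?E ?d (A - {i}) = d ^ (card A - 1)" "?T (?E ?d) (A - {i}) = d ^ (card A - 1) * t ^ card (A - {i})"
        if "i \<in> A" for i
        using that True fA by (auto simp: grouplike_def twist_def)
      have "?s (?P ?cx) (?E ?d) A = ((1 - t) * c * d ^ (card A - 1)) * (\<Sum>i\<in>A. x i * (\<Prod>j\<in>A - {i}. phi x t j i))"
        unfolding star_primitive_left[OF assms(1) True] sum_distrib_left
        using E(1) by (intro sum.cong) (auto simp: mult_ac)
      also have "\<dots> = ((1 - t) * c * d ^ (card A - 1)) * (\<Sum>i\<in>A. x i * (t ^ card (A - {i}) * (\<Prod>j\<in>A - {i}. phi x t i j)))"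
        using sum_prod_phi_exchange[of A x t] fA inj_on_subset[OF assms(2) True] assms(4,5) by simp
      also have "\<dots> = ?s (?T (?E ?d)) (?P ?cx) A"
        unfolding star_primitive_right[OF assms(1) True] sum_distrib_left
        using E(2) by (intro sum.cong) (auto simp: mult_ac)
      finally show ?thesis .
    qed (simp add: star_def)
  qed
  have "?T ?F + ?s (?P (\<lambda>i. d + c * x i)) ?F = ?F"
  proof -
    have "?P (\<lambda>i. d + c * x i) = ?P ?d + ?P ?cx"
      unfolding primitive_add[symmetric] by (simp add: distrib_left)
    then have "?s (?P (\<lambda>i. d + c * x i)) ?F = ?s (?s (?P ?d) (?E ?d)) (?E ?cx) + ?s (?s (?P ?cx) (?E ?d)) (?E ?cx)"
      by (simp only: star_add_left star_assoc[OF assms(1)])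
    also have "?s (?s (?P ?cx) (?E ?d)) (?E ?cx) = ?s (?T (?E ?d)) (?s (?P ?cx) (?E ?cx))"
      unfolding ex star_assoc[OF assms(1)] ..
    finally have "?T ?F + ?s (?P (\<lambda>i. d + c * x i)) ?F
       = ?s (?s (?P ?d) (?E ?d)) (?E ?cx) + ?s (?T (?E ?d)) (?T (?E ?cx) + ?s (?P ?cx) (?E ?cx))"
      by (simp only: twist_star[OF assms(1)] star_add_right add_ac)
    also have "\<dots> = ?s (?T (?E ?d) + ?s (?P ?d) (?E ?d)) (?E ?cx)"
      by (simp only: PE[of ?cx] star_add_left add_ac)
    finally show ?thesis unfolding PE .
  qed
  \<comment> \<open>The product is \<open>t ^ card B\<close>, which differs from 1 by the assumption
    on the powers of \<open>t\<close>.\<close>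
  moreover have "prod (\<lambda>_. t) B \<noteq> 1" if "B \<subseteq> N" "B \<noteq> {}" for B
    using that assms(6)[of "card B"] assms(1)
    by (simp add: card_gt_0_iff finite_subset card_mono Suc_leI)
  ultimately show ?thesis
    using twisted_equation_unique[OF assms(1,7) _ PE[of "\<lambda>i. d + c * x i"]]
    by (simp add: star_empty grouplike_def)
qed

section \<open>Extension from generic to arbitrary parameters\<close>

text \<open>Polynomiality is a property of functions here, so that it can be read off the shape of
  an expression. In the identities to be extended, \<open>t\<close> occurs in numerators
  only.\<close>

definition poly_fun :: "('a::comm_ring_1 \<Rightarrow> 'a) \<Rightarrow> bool" where
  "poly_fun f \<longleftrightarrow> (\<exists>p. \<forall>t. f t = poly p t)"

lemma poly_fun_const [intro]: "poly_fun (\<lambda>_. c)"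
  unfolding poly_fun_def by (rule exI[of _ "[:c:]"]) simp

lemma poly_fun_ident [intro]: "poly_fun (\<lambda>t. t)"
  unfolding poly_fun_def by (rule exI[of _ "[:0, 1:]"]) simp

lemma poly_fun_add [intro]: "poly_fun f \<Longrightarrow> poly_fun g \<Longrightarrow> poly_fun (\<lambda>t. f t + g t)"
  unfolding poly_fun_def by (metis poly_add)

lemma poly_fun_diff [intro]: "poly_fun f \<Longrightarrow> poly_fun g \<Longrightarrow> poly_fun (\<lambda>t. f t - g t)"
  unfolding poly_fun_def by (metis poly_diff)

lemma poly_fun_mult [intro]: "poly_fun f \<Longrightarrow> poly_fun g \<Longrightarrow> poly_fun (\<lambda>t. f t * g t)"
  unfolding poly_fun_def by (metis poly_mult)

lemma poly_fun_divide [intro]: "poly_fun f \<Longrightarrow> poly_fun (\<lambda>t. f t / c)" for c :: "'a::field"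
  using poly_fun_mult[of f "\<lambda>_. inverse c"] by (auto simp: divide_inverse)

lemma poly_fun_sum [intro]: "(\<And>i. i \<in> I \<Longrightarrow> poly_fun (f i)) \<Longrightarrow> poly_fun (\<lambda>t. \<Sum>i\<in>I. f i t)"
  by (induction I rule: infinite_finite_induct) auto

lemma poly_fun_prod [intro]: "(\<And>i. i \<in> I \<Longrightarrow> poly_fun (f i)) \<Longrightarrow> poly_fun (\<lambda>t. \<Prod>i\<in>I. f i t)"
  by (induction I rule: infinite_finite_induct) auto

lemma poly_fun_finite_zeros:
  fixes f :: "'a::idom \<Rightarrow> 'a"
  assumes "poly_fun f" "f a \<noteq> 0"
  shows "finite {t. f t = 0}"
proof -
  obtain p where p: "\<And>t. f t = poly p t" using assms by (auto simp: poly_fun_def)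
  then have "p \<noteq> 0" using assms(2) by auto
  then show ?thesis using poly_roots_finite[of p] by (simp add: p)
qed

text \<open>A nonzero polynomial would vanish on the complement of \<open>B\<close>, which is
  infinite in characteristic 0.\<close>

lemma poly_fun_eq_zero:
  fixes f :: "'a::field_char_0 \<Rightarrow> 'a"
  assumes "poly_fun f" "finite B" "\<And>t. t \<notin> B \<Longrightarrow> f t = 0"
  shows "f t = 0"
proof (rule ccontr)
  assume "f t \<noteq> 0"
  then have "finite ({t. f t = 0} \<union> B)" using poly_fun_finite_zeros assms by auto
  moreover have "{t. f t = 0} \<union> B = UNIV" using assms(3) by auto
  ultimately show False using infinite_UNIV_char_0[where 'a = 'a] by simp
qed

lemma poly_fun_star:
  assumes "\<And>B. poly_fun (\<lambda>t. F t B)" "\<And>B. poly_fun (\<lambda>t. G t B)"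
  shows "poly_fun (\<lambda>t. star N (phi x t) (F t) (G t) A)"
proof (cases "A \<subseteq> N")
  case True
  then show ?thesis unfolding star_def phi_def
    by (simp only: if_True) (intro poly_fun_sum poly_fun_mult poly_fun_prod poly_fun_divide
      poly_fun_diff poly_fun_const poly_fun_ident assms)
qed (auto simp: star_def)

lemma finite_roots_of_unity:
  "finite {t::'a::field_char_0. \<exists>k\<in>{1..n}. t ^ k = 1}"
proof -
  have "finite {t::'a. t ^ k - 1 = 0}" if "k \<in> {1..n}" for k
  proof (rule poly_fun_finite_zeros[where a = 0])
    show "poly_fun (\<lambda>t::'a. t ^ k - 1)"
      using poly_fun_prod[of "{..<k}" "\<lambda>_ t. t", OF poly_fun_ident] by (auto intro!: poly_fun_diff)
  qed (use that in \<open>auto simp: power_0_left\<close>)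
  then have "finite (\<Union>k\<in>{1..n}. {t::'a. t ^ k - 1 = 0})" by blast
  moreover have "(\<Union>k\<in>{1..n}. {t::'a. t ^ k - 1 = 0}) = {t. \<exists>k\<in>{1..n}. t ^ k = 1}" by auto
  ultimately show ?thesis by simp
qed

lemma star_grouplike_linear:
  fixes x :: "nat \<Rightarrow> 'a::field_char_0"
  assumes "finite N" "inj_on x N" "\<And>i. i \<in> N \<Longrightarrow> x i \<noteq> 0"
  shows "star N (phi x t) (grouplike N (\<lambda>_. d)) (grouplike N (\<lambda>i. c * x i)) = grouplike N (\<lambda>i. d + c * x i)"
proof
  fix A
  let ?f = "\<lambda>t. star N (phi x t) (grouplike N (\<lambda>_. d)) (grouplike N (\<lambda>i. c * x i)) A - grouplike N (\<lambda>i. d + c * x i) A"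
  show "star N (phi x t) (grouplike N (\<lambda>_. d)) (grouplike N (\<lambda>i. c * x i)) A = grouplike N (\<lambda>i. d + c * x i) A"
  proof (cases "A \<subseteq> N")
    case True
    have "?f t = 0"
    proof (rule poly_fun_eq_zero[of ?f])
      show "poly_fun ?f" by (intro poly_fun_diff poly_fun_star) auto
      show "finite ({0, 1} \<union> {t::'a. \<exists>k\<in>{1..card N}. t ^ k = 1})"
        using finite_roots_of_unity by auto
      show "?f t = 0" if "t \<notin> {0, 1} \<union> {t. \<exists>k\<in>{1..card N}. t ^ k = 1}" for t
        using that star_grouplike_linear_generic[OF assms _ _ _ True, where d = d and c = c and t = t] by auto
    qed
    then show ?thesis by simp
  qed (simp add: star_def grouplike_def)
qed

section \<open>The Littlewood product\<close>

definition pair_prod :: "(nat \<Rightarrow> nat \<Rightarrow> 'a::comm_monoid_mult) \<Rightarrow> nat set \<Rightarrow> 'a" where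
  "pair_prod g A = (\<Prod>j\<in>A. \<Prod>i\<in>{i\<in>A. i < j}. g i j)"

text \<open>The new index stands first or second in a pair according to the order of the indices;
  symmetry of \<open>g\<close> merges the two cases.\<close>

lemma pair_prod_insert:
  assumes "finite A" "a \<notin> A" "\<And>i j. g i j = g j i"
  shows "pair_prod g (insert a A) = (\<Prod>j\<in>A. g a j) * pair_prod g A"
proof -
  have "(\<Prod>i\<in>{i \<in> insert a A. i < j}. g i j) = (if a < j then g a j else 1) * (\<Prod>i\<in>{i\<in>A. i < j}. g i j)"
    if "j \<in> A" for j
  proof (cases "a < j")
    case True
    then have "{i \<in> insert a A. i < j} = insert a {i\<in>A. i < j}" by auto
    then show ?thesis using True assms by simp
  next
    case False
    then have "{i \<in> insert a A. i < j} = {i\<in>A. i < j}" by auto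
    then show ?thesis using False by simp
  qed
  then have "(\<Prod>j\<in>A. \<Prod>i\<in>{i \<in> insert a A. i < j}. g i j) = (\<Prod>j\<in>A. if a < j then g a j else 1) * pair_prod g A"
    by (simp add: pair_prod_def prod.distrib)
  moreover have "{i \<in> insert a A. i < a} = {i\<in>A. i < a}" by auto
  moreover have "(\<Prod>i\<in>{i\<in>A. i < a}. g i a) = (\<Prod>j\<in>A. if j < a then g a j else 1)"
    using assms by (simp add: prod.If_cases Int_def)
  moreover have "(\<Prod>j\<in>A. if j < a then g a j else 1) * (\<Prod>j\<in>A. if a < j then g a j else 1) = (\<Prod>j\<in>A. g a j)"
    unfolding prod.distrib[symmetric] using assms(2) by (intro prod.cong) (auto simp: not_less_iff_gr_or_eq)
  ultimately show ?thesis
    using assms(1,2) unfolding pair_prod_def by (simp add: mult.assoc[symmetric])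
qed

text \<open>The product side of the Littlewood identity for the sum of \<open>P_\<lambda>\<close>
  over partitions with even parts. \<open>littlewood_recursion\<close> corresponds to splitting off
  the zero parts and lowering all others by 2.\<close>

definition littlewood :: "nat set \<Rightarrow> (nat \<Rightarrow> 'a::field) \<Rightarrow> 'a \<Rightarrow> nat set \<Rightarrow> 'a" where
  "littlewood N x t A = (if A \<subseteq> N then (\<Prod>i\<in>A. 1 / (1 - (x i)\<^sup>2)) *
     pair_prod (\<lambda>i j. (1 - t * x i * x j) / (1 - x i * x j)) A else 0)"

lemma littlewood_remove:
  assumes "finite N" "A \<subseteq> N" "i \<in> A"
  shows "littlewood N x t A = littlewood N x t (A - {i}) *
    (1 / (1 - (x i)\<^sup>2) * (\<Prod>j\<in>A - {i}. (1 - t * x i * x j) / (1 - x i * x j)))"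
proof -
  let ?g = "\<lambda>i j. (1 - t * x i * x j) / (1 - x i * x j)"
  have fA: "finite A" using assms finite_subset by blast
  have "pair_prod ?g (insert i (A - {i})) = (\<Prod>j\<in>A - {i}. ?g i j) * pair_prod ?g (A - {i})"
    using fA by (intro pair_prod_insert) (auto simp: mult_ac)
  moreover have "insert i (A - {i}) = A" using assms by auto
  moreover have "(\<Prod>i\<in>A. 1 / (1 - (x i)\<^sup>2)) = 1 / (1 - (x i)\<^sup>2) * (\<Prod>i\<in>A - {i}. 1 / (1 - (x i)\<^sup>2))"
    using fA assms by (simp add: prod.remove)
  moreover have "A - {i} \<subseteq> N" using assms by auto
  ultimately show ?thesis using assms(2) by (simp add: littlewood_def mult_ac)
qed

text \<open>The function \<open>z + 1 / (t z)\<close> is invariant under \<open>z \<mapsto> 1 / (t z)\<close>; in terms of it \<open>reflection\<close> is a ratio of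
  linear factors.\<close>

definition reflection :: "'a::field \<Rightarrow> 'a \<Rightarrow> 'a \<Rightarrow> 'a" where
  "reflection t z y = (y - t * z) * (1 - z * y) / ((y - z) * (1 - t * z * y))"

text \<open>Up to the factor \<open>1 - y\<^sup>2\<close>, the principal part in the expansion of a
  product of reflections. That factor is kept apart because it cancels against
  \<open>1 / (1 - (x i)\<^sup>2)\<close> in \<open>littlewood\<close>.\<close>

definition refl_res :: "'a::field \<Rightarrow> 'a \<Rightarrow> 'a \<Rightarrow> 'a" where
  "refl_res t z y = z * (1 - t) / ((y - z) * (1 - t * z * y))"

text \<open>\<open>1 / y + y / t\<close> is the invariant at \<open>1 / y\<close>, with second
  preimage \<open>y / t\<close>. The factors thus show where two invariants coincide: for
  \<open>z = y\<close> or \<open>z = 1 / (t * y)\<close> in the first difference, for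
  \<open>z = 1 / y\<close> or \<open>z = y / t\<close> in the second.\<close>

lemma invariant_diff:
  fixes t z y :: "'a::field"
  assumes "t \<noteq> 0" "z \<noteq> 0" "y \<noteq> 0"
  shows "(z + 1 / (t * z)) - (y + 1 / (t * y)) = (y - z) * (1 - t * z * y) / (t * z * y)"
    and "(z + 1 / (t * z)) - (1 / y + y / t) = (y - t * z) * (1 - z * y) / (t * z * y)"
  using assms by (simp_all add: divide_simps) (simp_all add: algebra_simps)

lemma reflection_invariant:
  fixes t z y :: "'a::field"
  assumes "t \<noteq> 0" "z \<noteq> 0" "y \<noteq> 0"
  shows "((z + 1 / (t * z)) - (1 / y + y / t)) / ((z + 1 / (t * z)) - (y + 1 / (t * y))) = reflection t z y"
  unfolding invariant_diff[OF assms] reflection_def using assms by simp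

text \<open>\<open>partial_fractions\<close> in the invariant of \<open>z\<close>, with poles at the
  invariants of the \<open>x i\<close> and zeros at those of their inverses. Hypothesis
  \<open>tx\<close> and injectivity of \<open>x\<close> keep the poles distinct.\<close>

lemma prod_reflection:
  fixes x :: "nat \<Rightarrow> 'a::field"
  assumes "finite A" "inj_on x A" "\<And>i. i \<in> A \<Longrightarrow> x i \<noteq> 0" "t \<noteq> 0" "z \<noteq> 0"
    and tx: "\<And>i j. i \<in> A \<Longrightarrow> j \<in> A \<Longrightarrow> t * x i * x j \<noteq> 1"
    and z: "\<And>i. i \<in> A \<Longrightarrow> z \<noteq> x i" "\<And>i. i \<in> A \<Longrightarrow> t * z * x i \<noteq> 1"
  shows "(\<Prod>j\<in>A. reflection t z (x j)) =
    1 + (\<Sum>i\<in>A. (1 - (x i)\<^sup>2) * refl_res t z (x i) * (\<Prod>j\<in>A - {i}. reflection t (x i) (x j)))"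
proof -
  let ?s = "\<lambda>y. y + 1 / (t * y)" and ?r = "\<lambda>y. 1 / y + y / t"
  have inj: "inj_on (\<lambda>i. ?s (x i)) A"
  proof (rule inj_onI, rule ccontr)
    fix i j assume ij: "i \<in> A" "j \<in> A" "?s (x i) = ?s (x j)" "i \<noteq> j"
    then have "(x j - x i) * (1 - t * x i * x j) / (t * x i * x j) = 0"
      using invariant_diff(1)[of t "x i" "x j"] assms by simp
    then show False using ij assms by (auto simp: inj_on_def)
  qed
  have nz: "?s z \<notin> (\<lambda>i. ?s (x i)) ` A"
  proof
    assume "?s z \<in> (\<lambda>i. ?s (x i)) ` A"
    then obtain i where i: "i \<in> A" "?s z - ?s (x i) = 0" by auto
    then show False using invariant_diff(1)[of t z "x i"] assms z[OF i(1)] by auto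
  qed
  have res: "(?s y - ?r y) / (?s z - ?s y) = (1 - y\<^sup>2) * refl_res t z y" if "y \<noteq> 0" for y
    unfolding invariant_diff[OF assms(4,5) that] invariant_diff[OF assms(4) that that] refl_res_def
    using assms that by (simp add: power2_eq_square divide_simps) (simp add: algebra_simps)
  have 1: "(\<Prod>j\<in>A. (?s z - ?r (x j)) / (?s z - ?s (x j))) = (\<Prod>j\<in>A. reflection t z (x j))"
    by (intro prod.cong reflection_invariant refl) (use assms in auto)
  have 2: "(\<Sum>i\<in>A. (?s (x i) - ?r (x i)) / (?s z - ?s (x i)) * (\<Prod>j\<in>A - {i}. (?s (x i) - ?r (x j)) / (?s (x i) - ?s (x j))))
    = (\<Sum>i\<in>A. (1 - (x i)\<^sup>2) * refl_res t z (x i) * (\<Prod>j\<in>A - {i}. reflection t (x i) (x j)))"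
    by (intro sum.cong arg_cong2[of _ _ _ _ "(*)"] res prod.cong reflection_invariant refl) (use assms in auto)
  show ?thesis
    using partial_fractions[OF assms(1) inj nz, of "\<lambda>i. ?r (x i)"] unfolding 1 2 .
qed

text \<open>Taking \<open>i\<close> out of the Littlewood product turns the kernel
  \<open>phi x t j i\<close> into \<open>reflection t (x i) (x j)\<close>. The equation is then
  \<open>prod_reflection\<close> multiplied by the value at \<open>A\<close>.\<close>

lemma twist_reflection_littlewood:
  fixes x :: "nat \<Rightarrow> 'a::field"
  assumes "finite N" "inj_on x N" "\<And>i. i \<in> N \<Longrightarrow> x i \<noteq> 0" "t \<noteq> 0" "z \<noteq> 0"
    and xx: "\<And>i j. i \<in> N \<Longrightarrow> j \<in> N \<Longrightarrow> x i * x j \<noteq> 1"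
    and tx: "\<And>i j. i \<in> N \<Longrightarrow> j \<in> N \<Longrightarrow> t * x i * x j \<noteq> 1"
    and z: "\<And>i. i \<in> N \<Longrightarrow> z \<noteq> x i" "\<And>i. i \<in> N \<Longrightarrow> t * z * x i \<noteq> 1"
  shows "twist (\<lambda>i. reflection t z (x i)) (littlewood N x t) =
    littlewood N x t + star N (phi x t) (primitive N (\<lambda>i. refl_res t z (x i))) (littlewood N x t)"
proof
  fix A
  show "twist (\<lambda>i. reflection t z (x i)) (littlewood N x t) A =
    (littlewood N x t + star N (phi x t) (primitive N (\<lambda>i. refl_res t z (x i))) (littlewood N x t)) A"
  proof (cases "A \<subseteq> N")
    case True
    let ?C = "littlewood N x t"
    have fA: "finite A" using True assms(1) finite_subset by blast
    have "refl_res t z (x i) * ?C (A - {i}) * (\<Prod>j\<in>A - {i}. phi x t j i) =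
      ?C A * ((1 - (x i)\<^sup>2) * refl_res t z (x i) * (\<Prod>j\<in>A - {i}. reflection t (x i) (x j)))"
      if i: "i \<in> A" for i
    proof -
      have iN: "i \<in> N" using i True by auto
      have "(1 - (x i)\<^sup>2) \<noteq> 0" using xx[OF iN iN] by (simp add: power2_eq_square)
      moreover have "(\<Prod>j\<in>A - {i}. phi x t j i) =
        (\<Prod>j\<in>A - {i}. (1 - t * x i * x j) / (1 - x i * x j)) * (\<Prod>j\<in>A - {i}. reflection t (x i) (x j))"
        unfolding prod.distrib[symmetric]
      proof (intro prod.cong refl)
        fix j assume j: "j \<in> A - {i}"
        have jN: "j \<in> N" using j True by auto
        show "phi x t j i = (1 - t * x i * x j) / (1 - x i * x j) * reflection t (x i) (x j)"
          using xx[OF iN jN] tx[OF iN jN] by (simp add: phi_def reflection_def)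
      qed
      ultimately show ?thesis
        unfolding littlewood_remove[OF assms(1) True i] by simp
    qed
    then have "star N (phi x t) (primitive N (\<lambda>i. refl_res t z (x i))) ?C A =
      ?C A * (\<Sum>i\<in>A. (1 - (x i)\<^sup>2) * refl_res t z (x i) * (\<Prod>j\<in>A - {i}. reflection t (x i) (x j)))"
      unfolding star_primitive_left[OF assms(1) True] sum_distrib_left by (intro sum.cong) auto
    moreover have "(\<Prod>j\<in>A. reflection t z (x j)) =
      1 + (\<Sum>i\<in>A. (1 - (x i)\<^sup>2) * refl_res t z (x i) * (\<Prod>j\<in>A - {i}. reflection t (x i) (x j)))"
      using assms(3)[OF subsetD[OF True]] assms(4,5) tx[OF subsetD[OF True] subsetD[OF True]]
        z[OF subsetD[OF True]]
      by (rule prod_reflection[OF fA inj_on_subset[OF assms(2) True]])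
    ultimately show ?thesis by (simp add: twist_def algebra_simps)
  qed (simp add: twist_def littlewood_def star_def)
qed

text \<open>Separates the two poles in \<open>y\<close> of \<open>refl_res\<close>, and of
  \<open>y\<^sup>2\<close> times its quotient by \<open>reflection\<close>. In both cases the poles
  collide when \<open>t * z\<^sup>2 = 1\<close>, which explains the factor in front.\<close>

lemma two_pole_splitting:
  fixes t z y :: "'a::field"
  shows "y - z \<noteq> 0 \<Longrightarrow> 1 - t * z * y \<noteq> 0 \<Longrightarrow> (1 - t * z\<^sup>2) * (z * (1 - t) / ((y - z) * (1 - t * z * y)))
      = (1 - t) * (z / (y - z)) - t * z\<^sup>2 * ((1 - t) * (- 1 / (1 - t * z * y)))"
    and "1 - z * y \<noteq> 0 \<Longrightarrow> y - t * z \<noteq> 0 \<Longrightarrow> (1 - t * z\<^sup>2) * (y\<^sup>2 * z * (1 - t) / ((y - t * z) * (1 - z * y)))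
      = (1 - t) * (z * y / (1 - z * y)) - t * z\<^sup>2 * ((1 - t) * (- y / (y - t * z)))"
proof -
  have factor: "u * a - b * (u * (- c / d)) = u * (a + b * c / d)" for u a b c d :: 'a
    by (simp add: algebra_simps)
  have num: "z * (1 - t * z * y) + t * z\<^sup>2 * 1 * (y - z) = (1 - t * z\<^sup>2) * z"
    "z * y * (y - t * z) + t * z\<^sup>2 * y * (1 - z * y) = (1 - t * z\<^sup>2) * (y\<^sup>2 * z)"
    by (simp_all add: algebra_simps power2_eq_square)
  show "(1 - t * z\<^sup>2) * (z * (1 - t) / ((y - z) * (1 - t * z * y)))
      = (1 - t) * (z / (y - z)) - t * z\<^sup>2 * ((1 - t) * (- 1 / (1 - t * z * y)))"
    if "y - z \<noteq> 0" "1 - t * z * y \<noteq> 0"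
    unfolding factor add_frac_eq[OF that] num by (simp only: times_divide_eq_right mult_ac)
  show "(1 - t * z\<^sup>2) * (y\<^sup>2 * z * (1 - t) / ((y - t * z) * (1 - z * y)))
      = (1 - t) * (z * y / (1 - z * y)) - t * z\<^sup>2 * ((1 - t) * (- y / (y - t * z)))"
    if "1 - z * y \<noteq> 0" "y - t * z \<noteq> 0"
    unfolding factor add_frac_eq[OF that] num by (simp only: times_divide_eq_right mult_ac)
qed

text \<open>After multiplication by \<open>1 - t * z\<^sup>2\<close>, both sides equal
  \<open>p - t * z\<^sup>2 * q\<close> for two products \<open>p\<close>, \<open>q\<close> of linear
  fractions. On the left, \<open>prod ?\<rho> A\<close> is first taken out of the sum, which
  replaces the poles \<open>z\<close> and \<open>1 / (t * z)\<close> by \<open>1 / z\<close> and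
  \<open>t * z\<close>.\<close>

lemma reflection_intertwines_grouplike:
  fixes x :: "nat \<Rightarrow> 'a::field"
  assumes "finite N" "inj_on x N" "\<And>i. i \<in> N \<Longrightarrow> x i \<noteq> 0" "t \<noteq> 0" "z \<noteq> 0" "t * z\<^sup>2 \<noteq> 1"
    and z: "\<And>i. i \<in> N \<Longrightarrow> z \<noteq> x i" "\<And>i. i \<in> N \<Longrightarrow> t * z * x i \<noteq> 1"
      "\<And>i. i \<in> N \<Longrightarrow> t * z \<noteq> x i" "\<And>i. i \<in> N \<Longrightarrow> z * x i \<noteq> 1"
  defines "E \<equiv> grouplike N (\<lambda>i. reflection t z (x i))"
  shows "E + star N (phi x t) E (primitive N (\<lambda>i. (x i)\<^sup>2 * refl_res t z (x i))) =
    grouplike N (\<lambda>_. 1) + star N (phi x t) (primitive N (\<lambda>i. refl_res t z (x i))) (grouplike N (\<lambda>_. 1))"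
    (is "?L = ?R")
proof
  fix A
  show "?L A = ?R A"
  proof (cases "A \<subseteq> N")
    case True
    have fA: "finite A" using True assms(1) finite_subset by blast
    have inj: "inj_on x A" using inj_on_subset[OF assms(2) True] .
    let ?m = "\<lambda>i. \<Prod>j\<in>A - {i}. phi x t j i" and ?p = "\<lambda>i. \<Prod>j\<in>A - {i}. phi x t i j"
    let ?v = "\<lambda>i. refl_res t z (x i)" and ?\<rho> = "\<lambda>i. reflection t z (x i)"
    \<comment> \<open>The image of \<open>z\<close> under the involution, which is the second pole
      of \<open>refl_res\<close>.\<close>
    define w where "w = 1 / (t * z)"
    define p where "p = (\<Prod>j\<in>A. (x j - t * z) / (x j - z))"
    define q where "q = (\<Prod>j\<in>A. (x j - t * w) / (x j - w))"
    have nz: "x i \<noteq> 0" "z \<noteq> x i" "t * z * x i \<noteq> 1" "t * z \<noteq> x i" "z * x i \<noteq> 1"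
        "x i - z \<noteq> 0" "1 - t * z * x i \<noteq> 0" "x i - t * z \<noteq> 0" "1 - z * x i \<noteq> 0" if "i \<in> A" for i
      using assms(3)[OF subsetD[OF True that]] z[OF subsetD[OF True that]]
      by (metis right_minus_eq)+
    have w: "w \<noteq> 0" "t * w = 1 / z" "w \<notin> x ` A" using assms nz(3) by (auto simp: w_def field_simps)
    have xw: "x i - w = (1 - t * z * x i) / - (t * z)" if "i \<in> A" for i
      using nz[OF that] assms(4,5) unfolding w_def by (simp add: field_simps)
    have p: "p = 1 + (1 - t) * (\<Sum>i\<in>A. z / (x i - z) * ?m i)"
      unfolding p_def using nz assms by (intro prod_phi_minus fA inj) auto
    have q: "q = 1 + (1 - t) * (\<Sum>i\<in>A. w / (x i - w) * ?m i)"
      unfolding q_def using nz w by (intro prod_phi_minus fA inj) auto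
    \<comment> \<open>The points \<open>1 / z\<close> and \<open>t * z\<close> are the zeros of
      \<open>reflection t z\<close>, hence the poles that remain after division by it.\<close>
    define p' where "p' = (\<Prod>j\<in>A. (1 / z - t * x j) / (1 / z - x j))"
    define q' where "q' = (\<Prod>j\<in>A. (t * z - t * x j) / (t * z - x j))"
    have p': "p' = 1 + (1 - t) * (\<Sum>i\<in>A. x i / (1 / z - x i) * ?p i)"
      unfolding p'_def using nz assms by (intro prod_phi_plus fA inj) (auto simp: field_simps)
    have q': "q' = 1 + (1 - t) * (\<Sum>i\<in>A. x i / (t * z - x i) * ?p i)"
      unfolding q'_def using nz assms by (intro prod_phi_plus fA inj) auto
    have R: "(1 - t * z\<^sup>2) * (1 + (\<Sum>i\<in>A. ?v i * ?m i)) = p - t * z\<^sup>2 * q"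
    proof -
      have "(1 - t * z\<^sup>2) * ?v i = (1 - t) * (z / (x i - z)) - t * z\<^sup>2 * ((1 - t) * (w / (x i - w)))" if "i \<in> A" for i
      proof -
        have e: "w / (x i - w) = - 1 / (1 - t * z * x i)"
          using nz[OF that] assms(4,5) unfolding xw[OF that] by (simp add: w_def)
        show ?thesis unfolding e refl_res_def using nz(6,7)[OF that] by (rule two_pole_splitting)
      qed
      then have "(1 - t * z\<^sup>2) * (\<Sum>i\<in>A. ?v i * ?m i) =
        (\<Sum>i\<in>A. ((1 - t) * (z / (x i - z)) - t * z\<^sup>2 * ((1 - t) * (w / (x i - w)))) * ?m i)"
        unfolding sum_distrib_left mult.assoc[symmetric] by (intro sum.cong) auto
      also have "\<dots> = (p - 1) - t * z\<^sup>2 * (q - 1)"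
        unfolding p q by (simp add: left_diff_distrib sum_subtractf sum_distrib_left mult.assoc)
      finally show ?thesis by (simp add: algebra_simps)
    qed
    have L: "(1 - t * z\<^sup>2) * (1 + (\<Sum>i\<in>A. (x i)\<^sup>2 * ?v i / ?\<rho> i * ?p i)) = p' - t * z\<^sup>2 * q'"
    proof -
      have "(1 - t * z\<^sup>2) * ((x i)\<^sup>2 * ?v i / ?\<rho> i) =
          (1 - t) * (x i / (1 / z - x i)) - t * z\<^sup>2 * ((1 - t) * (x i / (t * z - x i)))" if "i \<in> A" for i
      proof -
        have a: "(x i)\<^sup>2 * ?v i / ?\<rho> i = (x i)\<^sup>2 * z * (1 - t) / ((x i - t * z) * (1 - z * x i))"
          using nz[OF that] unfolding refl_res_def reflection_def by simp
        have b: "x i / (1 / z - x i) = z * x i / (1 - z * x i)"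
          using nz[OF that] assms(5) by (simp add: divide_simps mult.commute)
        have c: "x i / (t * z - x i) = - x i / (x i - t * z)"
          by (metis minus_diff_eq minus_divide_divide minus_minus)
        show ?thesis unfolding a b c using nz(9,8)[OF that] by (rule two_pole_splitting)
      qed
      then have "(1 - t * z\<^sup>2) * (\<Sum>i\<in>A. (x i)\<^sup>2 * ?v i / ?\<rho> i * ?p i) =
        (\<Sum>i\<in>A. ((1 - t) * (x i / (1 / z - x i)) - t * z\<^sup>2 * ((1 - t) * (x i / (t * z - x i)))) * ?p i)"
        unfolding sum_distrib_left mult.assoc[symmetric] by (intro sum.cong) auto
      also have "\<dots> = (p' - 1) - t * z\<^sup>2 * (q' - 1)"
        unfolding p' q' by (simp add: left_diff_distrib sum_subtractf sum_distrib_left mult.assoc)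
      finally show ?thesis by (simp add: algebra_simps)
    qed
    have "prod ?\<rho> A * p' = p"
      unfolding p_def p'_def prod.distrib[symmetric]
    proof (intro prod.cong refl)
      fix i assume i: "i \<in> A"
      have "(1 / z - t * x i) / (1 / z - x i) = (1 - t * z * x i) / (1 - z * x i)"
        using mult_divide_mult_cancel_left[OF assms(5), of "1 / z - t * x i" "1 / z - x i"] assms(5)
        by (simp add: right_diff_distrib mult_ac)
      then show "?\<rho> i * ((1 / z - t * x i) / (1 / z - x i)) = (x i - t * z) / (x i - z)"
        using nz[OF i] by (simp add: reflection_def)
    qed
    moreover have "prod ?\<rho> A * q' = q"
      unfolding q_def q'_def prod.distrib[symmetric]
    proof (intro prod.cong refl)
      fix i assume i: "i \<in> A"
      have a: "(x i - t * w) / (x i - w) = t * (1 - z * x i) / (1 - t * z * x i)"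
      proof -
        have "x i - 1 / z = (1 - z * x i) / - z" using assms(5) by (simp add: field_simps)
        then show ?thesis unfolding xw[OF i] w(2) using assms(4,5) by simp
      qed
      have b: "(t * z - t * x i) / (t * z - x i) = t * (x i - z) / (x i - t * z)"
        using minus_divide_divide[of "t * z - t * x i" "t * z - x i"] by (simp add: right_diff_distrib)
      show "?\<rho> i * ((t * z - t * x i) / (t * z - x i)) = (x i - t * w) / (x i - w)"
        unfolding a b using nz[OF i] by (simp add: reflection_def)
    qed
    ultimately have "(1 - t * z\<^sup>2) * (prod ?\<rho> A * (1 + (\<Sum>i\<in>A. (x i)\<^sup>2 * ?v i / ?\<rho> i * ?p i))) = p - t * z\<^sup>2 * q"
      using L by (simp only: mult.left_commute[of _ "prod ?\<rho> A"] mult.left_commute[of "prod ?\<rho> A" "t * z\<^sup>2"] right_diff_distrib)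
    moreover have "prod ?\<rho> A * (1 + (\<Sum>i\<in>A. (x i)\<^sup>2 * ?v i / ?\<rho> i * ?p i)) = ?L A"
    proof -
      have "prod ?\<rho> A * ((x i)\<^sup>2 * ?v i / ?\<rho> i * ?p i) = (x i)\<^sup>2 * ?v i * E (A - {i}) * ?p i" if "i \<in> A" for i
      proof -
        have "?\<rho> i \<noteq> 0" using nz[OF that] by (simp add: reflection_def)
        moreover have "prod ?\<rho> A = ?\<rho> i * E (A - {i})"
          using True fA that by (auto simp: E_def grouplike_def prod.remove)
        ultimately show ?thesis by simp
      qed
      then have "prod ?\<rho> A * (\<Sum>i\<in>A. (x i)\<^sup>2 * ?v i / ?\<rho> i * ?p i) =
         star N (phi x t) E (primitive N (\<lambda>i. (x i)\<^sup>2 * refl_res t z (x i))) A"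
        unfolding star_primitive_right[OF assms(1) True] sum_distrib_left by (intro sum.cong) auto
      then show ?thesis using True by (simp add: distrib_left E_def grouplike_def)
    qed
    moreover have "1 + (\<Sum>i\<in>A. ?v i * ?m i) = ?R A"
      using True unfolding plus_fun_apply star_primitive_left[OF assms(1) True]
      by (auto simp: grouplike_def intro!: sum.cong)
    ultimately have "(1 - t * z\<^sup>2) * ?L A = (1 - t * z\<^sup>2) * ?R A" using R by (simp only:)
    then show ?thesis using assms(6) unfolding mult_cancel_left by auto
  qed (simp add: E_def grouplike_def star_def)
qed

text \<open>Each condition says that a polynomial in \<open>z\<close> does not vanish. There are
  finitely many of them, and each is nonzero by its value at a suitable point.\<close>

lemma exists_generic_reflection:
  fixes x :: "nat \<Rightarrow> 'a::field_char_0"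
  assumes "finite N" "\<And>i. i \<in> N \<Longrightarrow> x i \<noteq> 0"
    and xx: "\<And>i j. i \<in> N \<Longrightarrow> j \<in> N \<Longrightarrow> x i * x j \<noteq> 1"
    and tx: "\<And>i j. i \<in> N \<Longrightarrow> j \<in> N \<Longrightarrow> t * x i \<noteq> x j"
  obtains z where "z \<noteq> 0" "t * z\<^sup>2 \<noteq> 1"
    "\<And>i. i \<in> N \<Longrightarrow> z \<noteq> x i" "\<And>i. i \<in> N \<Longrightarrow> t * z * x i \<noteq> 1"
    "\<And>i. i \<in> N \<Longrightarrow> t * z \<noteq> x i" "\<And>i. i \<in> N \<Longrightarrow> z * x i \<noteq> 1"
    "\<And>B. B \<subseteq> N \<Longrightarrow> B \<noteq> {} \<Longrightarrow> (\<Prod>i\<in>B. reflection t z (x i)) \<noteq> 1"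
proof -
  define K where "K z = (1 - t * (z * z)) *
    (\<Prod>i\<in>N. (x i - z) * (1 - t * z * x i) * (x i - t * z) * (1 - z * x i))" for z
  define D where "D B z = (\<Prod>i\<in>B. (x i - t * z) * (1 - z * x i)) - (\<Prod>i\<in>B. (x i - z) * (1 - t * z * x i))" for B z
  have "poly_fun K"
    unfolding K_def by (intro poly_fun_sum poly_fun_mult poly_fun_prod poly_fun_diff poly_fun_const poly_fun_ident)
  moreover have "K 0 \<noteq> 0" using assms by (simp add: K_def)
  ultimately have "finite {z. K z = 0}" by (rule poly_fun_finite_zeros)
  moreover have "finite {z. D B z = 0}" if B: "B \<in> Pow N - {{}}" for B
  proof -
    have fB: "finite B" using B assms(1) finite_subset by blast
    obtain b where b: "b \<in> B" using B by auto
    \<comment> \<open>At \<open>z = x b\<close> exactly one of the two products in \<open>D\<close>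
      vanishes, so \<open>D B\<close> is not the zero polynomial.\<close>
    have "(\<Prod>i\<in>B. (x i - x b) * (1 - t * x b * x i)) = 0" using fB b by auto
    moreover have "(\<Prod>i\<in>B. (x i - t * x b) * (1 - x b * x i)) \<noteq> 0"
    proof -
      have "x i - t * x b \<noteq> 0" "1 - x b * x i \<noteq> 0" if "i \<in> B" for i
        using tx[of b i] xx[of b i] B b that by (simp_all add: subset_iff)
      then show ?thesis using fB by simp
    qed
    ultimately have "D B (x b) \<noteq> 0" by (simp add: D_def)
    moreover have "poly_fun (D B)"
      unfolding D_def by (intro poly_fun_mult poly_fun_prod poly_fun_diff poly_fun_const poly_fun_ident)
    ultimately show ?thesis by (intro poly_fun_finite_zeros)
  qed
  ultimately have fin: "finite ({0} \<union> {z. K z = 0} \<union> (\<Union>B\<in>Pow N - {{}}. {z. D B z = 0}))"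
    using assms(1) by blast
  obtain z where z: "z \<notin> {0} \<union> {z. K z = 0} \<union> (\<Union>B\<in>Pow N - {{}}. {z. D B z = 0})"
    using ex_new_if_finite[OF infinite_UNIV_char_0 fin] by (elim exE)
  have Kz: "K z \<noteq> 0" using z by auto
  have 1: "1 - t * (z * z) \<noteq> 0" using Kz by (auto simp: K_def)
  have 2: "x i - z \<noteq> 0" "1 - t * z * x i \<noteq> 0" "x i - t * z \<noteq> 0" "1 - z * x i \<noteq> 0" if "i \<in> N" for i
    using Kz that assms(1) by (auto simp: K_def)
  show ?thesis
  proof (rule that[of z])
    show "z \<noteq> 0" "t * z\<^sup>2 \<noteq> 1" using z 1 by (simp_all add: power2_eq_square)
  next
    fix i assume "i \<in> N"
    from 2[OF this] show "z \<noteq> x i" "t * z * x i \<noteq> 1" "t * z \<noteq> x i" "z * x i \<noteq> 1"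
      by (metis right_minus_eq)+
  next
    fix B assume B: "B \<subseteq> N" "B \<noteq> {}"
    have "D B z \<noteq> 0" using z B by auto
    moreover have "(\<Prod>i\<in>B. (x i - z) * (1 - t * z * x i)) \<noteq> 0"
      using 2[OF subsetD[OF B(1)]] finite_subset[OF B(1) assms(1)] by simp
    ultimately show "(\<Prod>i\<in>B. reflection t z (x i)) \<noteq> 1"
      by (simp add: D_def reflection_def prod_dividef)
  qed
qed

lemma star_primitive_uminus:
  assumes "finite N"
  shows "star N g (primitive N v) F + star N g (primitive N (\<lambda>i. - v i)) F = (\<lambda>_. 0)"
proof
  fix A
  show "(star N g (primitive N v) F + star N g (primitive N (\<lambda>i. - v i)) F) A = 0"
  proof (cases "A \<subseteq> N")
    case True
    then show ?thesis by (simp add: star_primitive_left[OF assms True] sum_negf)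
  qed (simp add: star_def)
qed

text \<open>Both sides satisfy the equation of \<open>twist_reflection_littlewood\<close>. For the
  product, the twisted equation of the right factor yields a primitive function between the two
  factors, which \<open>reflection_intertwines_grouplike\<close> carries to the far left.\<close>

lemma littlewood_recursion_generic:
  fixes x :: "nat \<Rightarrow> 'a::field_char_0"
  assumes "finite N" "inj_on x N" "\<And>i. i \<in> N \<Longrightarrow> x i \<noteq> 0" "t \<noteq> 0"
    and xx: "\<And>i j. i \<in> N \<Longrightarrow> j \<in> N \<Longrightarrow> x i * x j \<noteq> 1"
    and txx: "\<And>i j. i \<in> N \<Longrightarrow> j \<in> N \<Longrightarrow> t * x i * x j \<noteq> 1"
    and tx: "\<And>i j. i \<in> N \<Longrightarrow> j \<in> N \<Longrightarrow> t * x i \<noteq> x j"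
    and "A \<subseteq> N"
  shows "star N (phi x t) (grouplike N (\<lambda>_. 1)) (twist (\<lambda>i. (x i)\<^sup>2) (littlewood N x t)) A = littlewood N x t A"
proof -
  let ?s = "star N (phi x t)"
  let ?C = "littlewood N x t"
  obtain z where z: "z \<noteq> 0" "t * z\<^sup>2 \<noteq> 1"
    "\<And>i. i \<in> N \<Longrightarrow> z \<noteq> x i" "\<And>i. i \<in> N \<Longrightarrow> t * z * x i \<noteq> 1"
    "\<And>i. i \<in> N \<Longrightarrow> t * z \<noteq> x i" "\<And>i. i \<in> N \<Longrightarrow> z * x i \<noteq> 1"
    "\<And>B. B \<subseteq> N \<Longrightarrow> B \<noteq> {} \<Longrightarrow> (\<Prod>i\<in>B. reflection t z (x i)) \<noteq> 1"
    using exists_generic_reflection[of N x t, OF assms(1,3) xx tx] by metis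
  let ?r = "\<lambda>i. reflection t z (x i)" and ?v = "\<lambda>i. refl_res t z (x i)" and ?x2 = "\<lambda>i. (x i)\<^sup>2"
  let ?E = "grouplike N" and ?P = "primitive N ?v"
  let ?F = "?s (?E (\<lambda>_. 1)) (twist ?x2 ?C)"
  have C: "twist ?r ?C = ?C + ?s ?P ?C"
    using assms z by (intro twist_reflection_littlewood) auto
  have E: "?E ?r + ?s (?E ?r) (primitive N (\<lambda>i. ?x2 i * ?v i)) = ?E (\<lambda>_. 1) + ?s ?P (?E (\<lambda>_. 1))"
    using assms z by (intro reflection_intertwines_grouplike) auto
  have "twist ?r ?F = ?s (?E ?r) (twist ?x2 (twist ?r ?C))"
    by (simp add: twist_star[OF assms(1)] twist_twist twist_grouplike mult.commute)
  also have "twist ?x2 (twist ?r ?C) = twist ?x2 ?C + ?s (primitive N (\<lambda>i. ?x2 i * ?v i)) (twist ?x2 ?C)"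
    unfolding C twist_add twist_star[OF assms(1)] twist_primitive ..
  also have "?s (?E ?r) \<dots> = ?s (?E ?r + ?s (?E ?r) (primitive N (\<lambda>i. ?x2 i * ?v i))) (twist ?x2 ?C)"
    by (simp only: star_add_left star_add_right star_assoc[OF assms(1)])
  also have "\<dots> = ?F + ?s ?P ?F"
    unfolding E by (simp only: star_add_left star_assoc[OF assms(1)])
  finally have F: "twist ?r ?F = ?F + ?s ?P ?F" .
  \<comment> \<open>The sign brings the primitive term to the side on which
    \<open>twisted_equation_unique\<close> expects it.\<close>
  have eq: "twist ?r G + ?s (primitive N (\<lambda>i. - ?v i)) G = G" if "twist ?r G = G + ?s ?P G" for G
    unfolding that using star_primitive_uminus[OF assms(1), of "phi x t" ?v G]
    by (simp add: fun_eq_iff add.assoc)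
  show ?thesis
    by (rule twisted_equation_unique[OF assms(1) \<open>A \<subseteq> N\<close> eq[OF F] eq[OF C]])
      (use z(7) in \<open>simp_all add: star_empty grouplike_def twist_def\<close>)
qed

lemma littlewood_recursion:
  fixes x :: "nat \<Rightarrow> 'a::field_char_0"
  assumes "finite N" "inj_on x N" "\<And>i. i \<in> N \<Longrightarrow> x i \<noteq> 0"
    and xx: "\<And>i j. i \<in> N \<Longrightarrow> j \<in> N \<Longrightarrow> x i * x j \<noteq> 1"
  shows "star N (phi x t) (grouplike N (\<lambda>_. 1)) (twist (\<lambda>i. (x i)\<^sup>2) (littlewood N x t)) = littlewood N x t"
proof
  fix A
  let ?f = "\<lambda>t. star N (phi x t) (grouplike N (\<lambda>_. 1)) (twist (\<lambda>i. (x i)\<^sup>2) (littlewood N x t)) A - littlewood N x t A"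
  show "star N (phi x t) (grouplike N (\<lambda>_. 1)) (twist (\<lambda>i. (x i)\<^sup>2) (littlewood N x t)) A = littlewood N x t A"
  proof (cases "A \<subseteq> N")
    case True
    have C: "poly_fun (\<lambda>t. littlewood N x t B)" for B
      unfolding littlewood_def pair_prod_def
      by (cases "B \<subseteq> N"; simp only: if_True if_False)
        (intro poly_fun_mult poly_fun_prod poly_fun_divide poly_fun_diff poly_fun_const poly_fun_ident)+
    \<comment> \<open>The values of \<open>t\<close> excluded in the generic case: 0 and those with
      \<open>t * x i * x j = 1\<close> or \<open>t * x i = x j\<close>. The case
      \<open>i = j\<close> of the latter is \<open>t = 1\<close>.\<close>
    let ?B = "{0} \<union> (\<lambda>(i,j). 1 / (x i * x j)) ` (N \<times> N) \<union> (\<lambda>(i,j). x j / x i) ` (N \<times> N)"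
    have "?f t = 0"
    proof (rule poly_fun_eq_zero[of ?f])
      show "poly_fun ?f" unfolding twist_def
        by (intro poly_fun_diff poly_fun_star poly_fun_mult poly_fun_const C)
      show "finite ?B" using assms(1) by auto
      show "?f t = 0" if t: "t \<notin> ?B" for t
      proof -
        have "t * x i * x j \<noteq> 1" "t * x i \<noteq> x j" if "i \<in> N" "j \<in> N" for i j
        proof -
          have "t \<noteq> 1 / (x i * x j)" "t \<noteq> x j / x i" using t that by auto
          then show "t * x i * x j \<noteq> 1" "t * x i \<noteq> x j" using assms(3) that by (auto simp: field_simps)
        qed
        then show ?thesis using t littlewood_recursion_generic[OF assms(1-3) _ xx _ _ True, of t] by simp
      qed
    qed
    then show ?thesis by simp
  qed (simp add: star_def littlewood_def)
qed

section \<open>Functions of the cardinality\<close>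

lemma qpoch_Suc: "qpoch a t (Suc k) = qpoch a t k * (1 - a * t ^ k)"
  by (simp add: qpoch_def)

lemma qpoch_0 [simp]: "qpoch a t 0 = 1"
  by (simp add: qpoch_def)

lemma qpoch_nonzero:
  assumes "\<And>k. 1 \<le> k \<Longrightarrow> k \<le> n \<Longrightarrow> t ^ k \<noteq> 1" "k \<le> n"
  shows "qpoch t t k \<noteq> 0"
proof -
  have "t * t ^ j \<noteq> 1" if "j < k" for j
    using assms(1)[of "Suc j"] assms(2) that by simp
  then show ?thesis by (simp add: qpoch_def)
qed

definition qbinom :: "'a::field \<Rightarrow> nat \<Rightarrow> nat \<Rightarrow> 'a" where
  "qbinom t n j = qpoch t t n / (qpoch t t j * qpoch t t (n - j))"

lemma qbinom_sym: "j \<le> n \<Longrightarrow> qbinom t n (n - j) = qbinom t n j"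
  by (simp add: qbinom_def mult.commute)

lemma qbinom_pascal:
  assumes "\<And>k. 1 \<le> k \<Longrightarrow> k \<le> Suc n \<Longrightarrow> t ^ k \<noteq> 1" "1 \<le> j" "j \<le> n"
  shows "qbinom t (Suc n) j = qbinom t n (j - 1) + t ^ j * qbinom t n j"
proof -
  obtain i where i: "j = Suc i" using assms(2) by (cases j) auto
  obtain l where l: "n = Suc i + l" using assms(3) i le_iff_add by blast
  define P where "P = qpoch t t"
  have nz: "P k \<noteq> 0" if "k \<le> Suc n" for k using qpoch_nonzero[OF assms(1) that] by (simp add: P_def)
  have P: "P (Suc n) = P n * (1 - t ^ Suc n)" "P (Suc i) = P i * (1 - t ^ Suc i)" "P (Suc l) = P l * (1 - t ^ Suc l)"
    by (simp_all add: P_def qpoch_Suc)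
  have d: "1 - t ^ Suc i \<noteq> 0" "1 - t ^ Suc l \<noteq> 0" using assms(1)[of "Suc i"] assms(1)[of "Suc l"] l by auto
  have "P n * (1 - t ^ Suc n) / (P i * (1 - t ^ Suc i) * (P l * (1 - t ^ Suc l)))
    = P n / (P i * (P l * (1 - t ^ Suc l))) + t ^ Suc i * (P n / (P i * (1 - t ^ Suc i) * P l))"
  proof -
    have 1: "P n / (P i * (P l * (1 - t ^ Suc l))) = P n * (1 - t ^ Suc i) / (P i * (1 - t ^ Suc i) * (P l * (1 - t ^ Suc l)))"
      using d by simp
    have 2: "t ^ Suc i * (P n / (P i * (1 - t ^ Suc i) * P l)) = P n * (t ^ Suc i * (1 - t ^ Suc l)) / (P i * (1 - t ^ Suc i) * (P l * (1 - t ^ Suc l)))"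
      using d by (simp add: mult_ac)
    \<comment> \<open>Over the common denominator, the Pascal rule is this splitting of
      \<open>1 - t ^ Suc n\<close>.\<close>
    have 3: "1 - t ^ Suc n = (1 - t ^ Suc i) + t ^ Suc i * (1 - t ^ Suc l)"
      by (simp add: l algebra_simps power_add)
    show ?thesis unfolding 1 2 3 by (simp only: add_divide_distrib[symmetric] distrib_left)
  qed
  moreover have "Suc n - Suc i = Suc l" "n - (Suc i - 1) = Suc l" "n - Suc i = l" "Suc i - 1 = i" using l by auto
  ultimately show ?thesis unfolding qbinom_def i P_def[symmetric] by (simp only: P)
qed

text \<open>The Pascal rule splits the sum in two, and the parts recombine termwise because
  \<open>qpoch z t (Suc j) + z * t ^ j * qpoch z t j = qpoch z t j\<close>.\<close>

lemma gauss_sum: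
  assumes "\<And>k. 1 \<le> k \<Longrightarrow> k \<le> n \<Longrightarrow> t ^ k \<noteq> 1"
  shows "(\<Sum>j\<le>n. z ^ (n - j) * qpoch z t j * qbinom t n j) = 1"
  using assms
proof (induction n)
  case (Suc n)
  let ?q = "qbinom t" and ?p = "qpoch z t"
  have nz: "qpoch t t k \<noteq> 0" if "k \<le> Suc n" for k by (rule qpoch_nonzero[OF Suc.prems that])
  have q0: "?q k 0 = 1" "?q k k = 1" if "k \<le> Suc n" for k using nz[OF that] by (simp_all add: qbinom_def)
  have split: "?q (Suc n) j = (if j = 0 then 0 else ?q n (j - 1)) + (if j = Suc n then 0 else t ^ j * ?q n j)"
    if "j \<le> Suc n" for j
  proof (cases "1 \<le> j \<and> j \<le> n")
    case True
    then show ?thesis using qbinom_pascal[of n t j, OF Suc.prems] by auto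
  next
    case False
    then have "j = 0 \<or> j = Suc n" using that by auto
    then show ?thesis using q0[of n] q0[of "Suc n"] by auto
  qed
  have "(\<Sum>j\<le>Suc n. z ^ (Suc n - j) * ?p j * ?q (Suc n) j)
    = (\<Sum>j\<le>Suc n. z ^ (Suc n - j) * ?p j * (if j = 0 then 0 else ?q n (j - 1)))
    + (\<Sum>j\<le>Suc n. z ^ (Suc n - j) * ?p j * (if j = Suc n then 0 else t ^ j * ?q n j))"
    unfolding sum.distrib[symmetric] distrib_left[symmetric] using split by (intro sum.cong) auto
  also have "(\<Sum>j\<le>Suc n. z ^ (Suc n - j) * ?p j * (if j = 0 then 0 else ?q n (j - 1)))
     = (\<Sum>j\<le>n. z ^ (n - j) * ?p (Suc j) * ?q n j)"
    by (subst sum.atMost_Suc_shift) simp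
  also have "(\<Sum>j\<le>Suc n. z ^ (Suc n - j) * ?p j * (if j = Suc n then 0 else t ^ j * ?q n j))
     = (\<Sum>j\<le>n. z ^ (Suc n - j) * ?p j * (t ^ j * ?q n j))"
    by (simp add: sum.atMost_Suc)
  also have "(\<Sum>j\<le>n. z ^ (n - j) * ?p (Suc j) * ?q n j) + (\<Sum>j\<le>n. z ^ (Suc n - j) * ?p j * (t ^ j * ?q n j))
     = (\<Sum>j\<le>n. z ^ (n - j) * ?p j * ?q n j)"
    unfolding sum.distrib[symmetric]
    by (intro sum.cong) (auto simp: qpoch_Suc Suc_diff_le algebra_simps)
  also have "\<dots> = 1" using Suc by simp
  finally show ?case .
qed (simp add: qbinom_def)

section \<open>Generic points and star products of functions of the cardinality\<close>

locale generic_point =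
  fixes N :: "nat set" and x :: "nat \<Rightarrow> 'a::field_char_0" and t :: 'a
  assumes finite_N: "finite N" and inj_x: "inj_on x N"
    and x_nz: "\<And>i. i \<in> N \<Longrightarrow> x i \<noteq> 0"
    and xx_ne_1: "\<And>i j. i \<in> N \<Longrightarrow> j \<in> N \<Longrightarrow> x i * x j \<noteq> 1"
    and t_power_ne_1: "\<And>k. 1 \<le> k \<Longrightarrow> k \<le> card N \<Longrightarrow> t ^ k \<noteq> 1"
begin

abbreviation prod_star (infixl "\<star>" 70) where "F \<star> G \<equiv> star N (phi x t) F G"

abbreviation E where "E \<equiv> grouplike N"

lemmas assoc = star_assoc[OF finite_N]

text \<open>Inverting one variable of a pair exchanges the conditions
  \<open>x i \<noteq> x j\<close> and \<open>x i * x j \<noteq> 1\<close>, so the locale is stable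
  under the sign changes of the hyperoctahedral group.\<close>

lemma sign_point: "generic_point N (\<lambda>i. if i \<in> S then inverse (x i) else x i) t"
proof
  let ?y = "\<lambda>i. if i \<in> S then inverse (x i) else x i"
  have eq: "inverse u = v \<longleftrightarrow> u * v = 1" "u = inverse v \<longleftrightarrow> u * v = 1" "inverse u * v = 1 \<longleftrightarrow> u = v" "u * inverse v = 1 \<longleftrightarrow> u = v"
    "inverse u * inverse v = 1 \<longleftrightarrow> u * v = 1" if "u \<noteq> 0" "v \<noteq> 0" for u v :: 'a
    using that by (auto simp: field_simps)
  have ne: "x i \<noteq> x j" if "i \<in> N" "j \<in> N" "i \<noteq> j" for i j
    using that inj_x by (auto simp: inj_on_def)
  show "?y i \<noteq> 0" if "i \<in> N" for i using x_nz[OF that] by simp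
  show "inj_on ?y N"
  proof (rule inj_onI, rule ccontr)
    fix i j assume ij: "i \<in> N" "j \<in> N" "?y i = ?y j" "i \<noteq> j"
    then show False
      using ne[OF ij(1,2,4)] xx_ne_1[OF ij(1,2)] eq[OF x_nz[OF ij(1)] x_nz[OF ij(2)]]
      by (auto split: if_splits)
  qed
  show "?y i * ?y j \<noteq> 1" if ij: "i \<in> N" "j \<in> N" for i j
    using xx_ne_1[OF ij] ne[OF ij] eq[OF x_nz[OF ij(1)] x_nz[OF ij(2)]] by (cases "i = j") (auto split: if_splits)
qed (fact finite_N t_power_ne_1)+

lemma inverse_point: "generic_point N (\<lambda>i. inverse (x i)) t"
  using sign_point[of UNIV] by simp

lemma flip_point: "generic_point N (x(k := inverse (x k))) t"
proof -
  have "x(k := inverse (x k)) = (\<lambda>i. if i \<in> {k} then inverse (x i) else x i)" by auto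
  then show ?thesis using sign_point[of "{k}"] by simp
qed

lemma star_inverse: "star N (phi (\<lambda>i. inverse (x i)) t) F G = G \<star> F"
proof -
  have "star N (phi (\<lambda>i. inverse (x i)) t) F G A = star N (\<lambda>i j. phi x t j i) F G A" for A
  proof (cases "A \<subseteq> N")
    case True
    then show ?thesis by (intro star_cong phi_inverse refl) (auto simp: x_nz)
  qed (simp add: star_def)
  then show ?thesis using star_swap[OF finite_N, of "phi x t" F G] by (metis ext)
qed

lemma star_scale_left: "(\<lambda>A. c * F A) \<star> G = (\<lambda>A. c * (F \<star> G) A)"
  by (auto simp: fun_eq_iff star_def sum_distrib_left mult_ac)

lemma star_scale_right: "F \<star> (\<lambda>A. c * G A) = (\<lambda>A. c * (F \<star> G) A)"
  by (auto simp: fun_eq_iff star_def sum_distrib_left mult_ac)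

text \<open>The functions \<open>U j\<close> behave like divided powers of the primitive function
  with value \<open>1 - t\<close>: multiplication by it on either side gives
  \<open>1 - t ^ Suc j\<close> times \<open>U (Suc j)\<close>.\<close>

lemma star_levels:
  fixes k j
  defines "U \<equiv> \<lambda>k. card_fun N (\<lambda>m. if m = k then 1 else 0)"
  assumes "A \<subseteq> N" "card A = k + j"
  shows "(U k \<star> U j) A = qbinom t (k + j) j"
  using assms(2,3)
proof (induction j arbitrary: k)
  case 0
  have fA: "finite A" using 0 finite_N finite_subset by blast
  have "(U k \<star> U 0) A = (\<Sum>K\<in>Pow A. U k K * U 0 (A - K) * (\<Prod>i\<in>A - K. \<Prod>j\<in>K. phi x t i j))"
    using 0 by (simp add: star_def)
  also have "\<dots> = (\<Sum>K\<in>{A}. U k K * U 0 (A - K) * (\<Prod>i\<in>A - K. \<Prod>j\<in>K. phi x t i j))"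
  proof (rule sum.mono_neutral_right)
    show "\<forall>K\<in>Pow A - {A}. U k K * U 0 (A - K) * (\<Prod>i\<in>A - K. \<Prod>j\<in>K. phi x t i j) = 0"
    proof
      fix K assume "K \<in> Pow A - {A}"
      then have "A - K \<noteq> {}" by auto
      then have "U 0 (A - K) = 0" using fA by (auto simp: U_def card_fun_def card_eq_0_iff)
      then show "U k K * U 0 (A - K) * (\<Prod>i\<in>A - K. \<Prod>j\<in>K. phi x t i j) = 0" by simp
    qed
  qed (use fA in auto)
  also have "\<dots> = 1" using 0 by (simp add: U_def card_fun_def)
  also have "\<dots> = qbinom t (k + 0) 0"
    using qpoch_nonzero[OF t_power_ne_1, of k] 0 card_mono[OF finite_N 0(1)] by (simp add: qbinom_def)
  finally show ?case .
next
  case (Suc j)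
  let ?P = "primitive N (\<lambda>_. 1 - t)"
  have left: "?P \<star> U j = (\<lambda>A. (1 - t ^ Suc j) * U (Suc j) A)" for j
  proof
    fix A
    show "(?P \<star> U j) A = (1 - t ^ Suc j) * U (Suc j) A"
    proof (cases "A \<subseteq> N")
      case True
      have fA: "finite A" using True finite_N finite_subset by blast
      have U: "U j (A - {i}) = U (Suc j) A" if "i \<in> A" for i
        using card.remove[OF fA that] True by (auto simp: U_def card_fun_def)
      have "(?P \<star> U j) A = U (Suc j) A * ((1 - t) * (\<Sum>i\<in>A. \<Prod>j\<in>A - {i}. phi x t j i))"
        unfolding star_primitive_left[OF finite_N True] sum_distrib_left
        using U by (intro sum.cong) auto
      also have "\<dots> = U (Suc j) A * (1 - t ^ card A)"
        using sum_prod_phi_minus[OF fA inj_on_subset[OF inj_x True], of t] x_nz True by auto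
      also have "\<dots> = (1 - t ^ Suc j) * U (Suc j) A"
        by (simp add: U_def card_fun_def)
      finally show ?thesis .
    qed (simp add: star_def U_def card_fun_def)
  qed
  have right: "U j \<star> ?P = (\<lambda>A. (1 - t ^ Suc j) * U (Suc j) A)" for j
  proof
    fix A
    show "(U j \<star> ?P) A = (1 - t ^ Suc j) * U (Suc j) A"
    proof (cases "A \<subseteq> N")
      case True
      have fA: "finite A" using True finite_N finite_subset by blast
      have U: "U j (A - {i}) = U (Suc j) A" if "i \<in> A" for i
        using card.remove[OF fA that] True by (auto simp: U_def card_fun_def)
      have "(U j \<star> ?P) A = U (Suc j) A * ((1 - t) * (\<Sum>i\<in>A. \<Prod>j\<in>A - {i}. phi x t i j))"
        unfolding star_primitive_right[OF finite_N True] sum_distrib_left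
        using U by (intro sum.cong) auto
      also have "\<dots> = U (Suc j) A * (1 - t ^ card A)"
        using sum_prod_phi_plus[OF fA inj_on_subset[OF inj_x True], of t] x_nz True by auto
      also have "\<dots> = (1 - t ^ Suc j) * U (Suc j) A"
        by (simp add: U_def card_fun_def)
      finally show ?thesis .
    qed (simp add: star_def U_def card_fun_def)
  qed
  have le: "Suc (k + j) \<le> card N" using Suc.prems card_mono[OF finite_N Suc.prems(1)] by simp
  have nz: "qpoch t t i \<noteq> 0" if "i \<le> Suc (k + j)" for i
    using qpoch_nonzero[OF t_power_ne_1, of i] le that by simp
  \<comment> \<open>By associativity, a primitive factor between \<open>U k\<close> and
    \<open>U j\<close> raises either the right or the left index.\<close>
  have "(1 - t ^ Suc j) * (U k \<star> U (Suc j)) A = (U k \<star> (?P \<star> U j)) A"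
    unfolding left star_scale_right ..
  also have "\<dots> = ((U k \<star> ?P) \<star> U j) A" unfolding assoc ..
  also have "\<dots> = (1 - t ^ Suc k) * (U (Suc k) \<star> U j) A"
    unfolding right star_scale_left ..
  also have "(U (Suc k) \<star> U j) A = qbinom t (Suc k + j) j"
    using Suc.IH[of "Suc k"] Suc.prems by simp
  also have "(1 - t ^ Suc k) * \<dots> = (1 - t ^ Suc j) * qbinom t (k + Suc j) (Suc j)"
    using nz[of "Suc k"] nz[of "Suc j"] by (auto simp: qbinom_def qpoch_Suc)
  finally show ?case using nz[of "Suc j"] by (auto simp: qpoch_Suc)
qed

text \<open>The subsets are grouped by the size \<open>j\<close> of their complements, and each
  group is evaluated by \<open>star_levels\<close>.\<close>

lemma star_card_fun:
  assumes "A \<subseteq> N"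
  shows "(card_fun N f \<star> card_fun N g) A = (\<Sum>j\<le>card A. f (card A - j) * g j * qbinom t (card A) j)"
proof -
  have fA: "finite A" using assms finite_N finite_subset by blast
  let ?w = "\<lambda>K. \<Prod>i\<in>A - K. \<Prod>j\<in>K. phi x t i j"
  let ?U = "\<lambda>k. card_fun N (\<lambda>m. if m = k then 1 else 0)"
  have "(card_fun N f \<star> card_fun N g) A = (\<Sum>K\<in>Pow A. f (card K) * g (card (A - K)) * ?w K)"
  proof -
    have "card_fun N f K * card_fun N g (A - K) * ?w K = f (card K) * g (card (A - K)) * ?w K" if "K \<in> Pow A" for K
    proof -
      have "K \<subseteq> N" "A - K \<subseteq> N" using that assms by auto
      then show ?thesis by (simp add: card_fun_def)
    qed
    then show ?thesis unfolding star_def using assms by (simp only: if_True cong: sum.cong)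
  qed
  also have "\<dots> = (\<Sum>j\<le>card A. \<Sum>K | K \<in> Pow A \<and> card (A - K) = j. f (card K) * g (card (A - K)) * ?w K)"
    using fA by (intro sum.group[symmetric]) (auto intro: card_mono)
  also have "\<dots> = (\<Sum>j\<le>card A. f (card A - j) * g j * qbinom t (card A) j)"
  proof (rule sum.cong[OF refl])
    fix j assume j: "j \<in> {..card A}"
    have "(\<Sum>K | K \<in> Pow A \<and> card (A - K) = j. f (card K) * g (card (A - K)) * ?w K)
      = (\<Sum>K\<in>Pow A. if card (A - K) = j then f (card A - j) * g j * ?w K else 0)"
      unfolding sum.inter_filter[OF finite_Pow_iff[THEN iffD2, OF fA], symmetric]
    proof (rule sum.cong[OF refl])
      fix K assume "K \<in> {K \<in> Pow A. card (A - K) = j}"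
      then have "K \<subseteq> A" "card (A - K) = j" by auto
      moreover from this have "card K = card A - j"
        using card_Diff_subset[OF finite_subset[OF _ fA], of K] card_mono[OF fA, of K] by simp
      ultimately show "f (card K) * g (card (A - K)) * ?w K = f (card A - j) * g j * ?w K" by simp
    qed
    also have "\<dots> = f (card A - j) * g j * (?U (card A - j) \<star> ?U j) A"
    proof -
      have "(?U (card A - j) \<star> ?U j) A = (\<Sum>K\<in>Pow A. if card (A - K) = j then ?w K else 0)"
      proof -
        have "?U (card A - j) K * ?U j (A - K) * ?w K = (if card (A - K) = j then ?w K else 0)" if "K \<in> Pow A" for K
        proof -
          have K: "K \<subseteq> A" "K \<subseteq> N" "A - K \<subseteq> N" using that assms by auto
          then show ?thesis
            using card_Diff_subset[OF finite_subset[OF K(1) fA] K(1)] card_mono[OF fA K(1)] j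
            by (simp add: card_fun_def) linarith
        qed
        then show ?thesis unfolding star_def using assms by (simp only: if_True cong: sum.cong)
      qed
      then show ?thesis unfolding sum_distrib_left by (simp only: sum_distrib_left) (intro sum.cong, auto)
    qed
    also have "\<dots> = f (card A - j) * g j * qbinom t (card A) j"
      using star_levels[OF assms, of "card A - j" j] j by simp
    finally show "(\<Sum>K | K \<in> Pow A \<and> card (A - K) = j. f (card K) * g (card (A - K)) * ?w K)
      = f (card A - j) * g j * qbinom t (card A) j" .
  qed
  finally show ?thesis .
qed

lemma star_card_fun_commute: "card_fun N f \<star> card_fun N g = card_fun N g \<star> card_fun N f"
proof
  fix A
  show "(card_fun N f \<star> card_fun N g) A = (card_fun N g \<star> card_fun N f) A"
  proof (cases "A \<subseteq> N")
    case True
    have "(\<Sum>j\<le>card A. f (card A - j) * g j * qbinom t (card A) j) = (\<Sum>j\<le>card A. g (card A - j) * f j * qbinom t (card A) j)"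
      by (rule sum.reindex_bij_witness[where i = "\<lambda>j. card A - j" and j = "\<lambda>j. card A - j"])
        (auto simp: qbinom_sym mult_ac)
    then show ?thesis by (simp add: star_card_fun[OF True])
  qed (simp add: star_def)
qed

lemma E_const: "E (\<lambda>_. c) = card_fun N (\<lambda>k. c ^ k)"
  by (simp add: fun_eq_iff grouplike_def card_fun_def)

lemma E_const_commute: "E (\<lambda>_. c) \<star> E (\<lambda>_. d) = E (\<lambda>_. d) \<star> E (\<lambda>_. c)"
  unfolding E_const by (rule star_card_fun_commute)

lemma rogers_szego_star: "A \<subseteq> N \<Longrightarrow> rogers_szego (card A) z t = (E (\<lambda>_. 1) \<star> E (\<lambda>_. z)) A"
  unfolding E_const by (simp add: star_card_fun rogers_szego_def qbinom_def)

text \<open>This form of \<open>gauss_sum\<close> is the source of the factor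
  \<open>(t2 t3; t)_n\<close>: the Pochhammer function is what remains of \<open>E(1)\<close> after
  \<open>E(z)\<close> is split off.\<close>

lemma gauss_star: "E (\<lambda>_. z) \<star> card_fun N (qpoch z t) = E (\<lambda>_. 1)"
proof
  fix A
  show "(E (\<lambda>_. z) \<star> card_fun N (qpoch z t)) A = E (\<lambda>_. 1) A"
  proof (cases "A \<subseteq> N")
    case True
    have "(E (\<lambda>_. z) \<star> card_fun N (qpoch z t)) A = 1"
      unfolding E_const star_card_fun[OF True]
      using gauss_sum[of "card A" t z] t_power_ne_1 card_mono[OF finite_N True] by (meson le_trans)
    then show ?thesis using True by (simp add: grouplike_def)
  qed (simp add: star_def grouplike_def)
qed

end

section \<open>The hyperoctahedral sum\<close>

definition bc_half :: "nat set \<Rightarrow> (nat \<Rightarrow> 'a::field) \<Rightarrow> 'a \<Rightarrow> 'a \<Rightarrow> 'a \<Rightarrow> nat set \<Rightarrow> 'a" where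
  "bc_half N x t a b = twist (\<lambda>i. (1 - a * x i) * (1 - b * x i)) (littlewood N x t)"

text \<open>The left factor carries the variables that stay, the right one those that are inverted.
  After multiplication by the \<open>m\<close>-th power of all variables, the monomial contributes 1
  for the former and \<open>x i ^ (2 * m)\<close> for the latter.\<close>

definition bc_sum :: "nat set \<Rightarrow> (nat \<Rightarrow> 'a::field) \<Rightarrow> 'a \<Rightarrow> 'a \<Rightarrow> 'a \<Rightarrow> nat \<Rightarrow> nat set \<Rightarrow> 'a" where
  "bc_sum N x t a b m = star N (phi x t) (bc_half N x t a b)
     (twist (\<lambda>i. x i ^ (2 * m)) (bc_half N (\<lambda>i. inverse (x i)) t a b))"

lemma pair_prod_union:
  assumes "finite K" "finite L" "K \<inter> L = {}" "\<And>i j. g i j = g j i"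
  shows "pair_prod g (K \<union> L) = pair_prod g K * pair_prod g L * (\<Prod>i\<in>L. \<Prod>j\<in>K. g i j)"
  using assms(2,3)
proof (induction L)
  case empty
  then show ?case by (simp add: pair_prod_def)
next
  case (insert l L)
  have "pair_prod g (insert l (K \<union> L)) = (\<Prod>j\<in>K \<union> L. g l j) * pair_prod g (K \<union> L)"
    using insert assms by (intro pair_prod_insert) auto
  moreover have "(\<Prod>j\<in>K \<union> L. g l j) = (\<Prod>j\<in>K. g l j) * (\<Prod>j\<in>L. g l j)"
    using insert assms by (intro prod.union_disjoint) auto
  moreover have "pair_prod g (insert l L) = (\<Prod>j\<in>L. g l j) * pair_prod g L"
    using insert assms by (intro pair_prod_insert) auto
  ultimately show ?case using insert by (simp add: mult_ac)
qed

lemma pair_prod_cong: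
  "(\<And>i j. i \<in> A \<Longrightarrow> j \<in> A \<Longrightarrow> i \<noteq> j \<Longrightarrow> g i j = h i j) \<Longrightarrow> pair_prod g A = pair_prod h A"
  unfolding pair_prod_def by (intro prod.cong) auto

lemma bc_half_cong:
  assumes "\<And>i. i \<in> A \<Longrightarrow> x i = y i"
  shows "bc_half N x t a b A = bc_half N y t a b A"
proof -
  have "pair_prod (\<lambda>i j. (1 - t * x i * x j) / (1 - x i * x j)) A = pair_prod (\<lambda>i j. (1 - t * y i * y j) / (1 - y i * y j)) A"
    by (rule pair_prod_cong) (simp add: assms)
  then show ?thesis using assms by (simp add: bc_half_def twist_def littlewood_def cong: prod.cong)
qed

lemma twist_cong:
  assumes "\<And>i. i \<in> N \<Longrightarrow> w i = w' i" "\<And>A. \<not> A \<subseteq> N \<Longrightarrow> F A = 0"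
  shows "twist w F = twist w' F"
proof
  fix A show "twist w F A = twist w' F A"
  proof (cases "A \<subseteq> N")
    case True
    then have "prod w A = prod w' A" using assms(1) by (intro prod.cong) auto
    then show ?thesis by (simp add: twist_def)
  qed (simp add: twist_def assms(2))
qed

lemma grouplike_cong:
  assumes "\<And>i. i \<in> N \<Longrightarrow> w i = w' i"
  shows "grouplike N w = grouplike N w'"
  using twist_cong[of N w w' "grouplike N (\<lambda>_. 1)", OF assms] by (simp add: twist_grouplike) (simp add: grouplike_def)

lemma twist_one [simp]: "twist (\<lambda>_. 1) F = F"
  by (simp add: twist_def fun_eq_iff)

section \<open>Functional equations of the hyperoctahedral sum\<close>

context generic_point
begin

lemma E_linear: "E (\<lambda>i. w i * d) \<star> E (\<lambda>i. w i * (c * x i)) = E (\<lambda>i. w i * (d + c * x i))"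
  using arg_cong[OF star_grouplike_linear[OF finite_N inj_x x_nz], of "twist w" t d c]
  by (simp only: twist_star[OF finite_N] twist_grouplike)

text \<open>Three applications of \<open>E_linear\<close>, to \<open>1 - a x\<close>, to
  \<open>- b x (1 - a x)\<close> and to their sum. The two middle factors are those of an odd level,
  twisted by \<open>x\<close>.\<close>

lemma E_quadratic:
  "E (\<lambda>_. 1) \<star> E (\<lambda>i. - a * x i) \<star> (E (\<lambda>i. - b * x i) \<star> E (\<lambda>i. a * b * (x i)\<^sup>2))
     = E (\<lambda>i. (1 - a * x i) * (1 - b * x i))"
proof -
  have "E (\<lambda>_. 1) \<star> E (\<lambda>i. - a * x i) = E (\<lambda>i. (1 - a * x i) * 1)"
    using E_linear[of "\<lambda>_. 1" 1 "- a"] by simp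
  moreover have "E (\<lambda>i. - b * x i) \<star> E (\<lambda>i. a * b * (x i)\<^sup>2) = E (\<lambda>i. (1 - a * x i) * (- b * x i))"
    using E_linear[of "\<lambda>i. - b * x i" 1 "- a"] by (simp add: algebra_simps power2_eq_square)
  moreover have "E (\<lambda>i. (1 - a * x i) * 1) \<star> E (\<lambda>i. (1 - a * x i) * (- b * x i)) = E (\<lambda>i. (1 - a * x i) * (1 + - b * x i))"
    by (rule E_linear)
  ultimately show ?thesis by simp
qed

text \<open>Arranged so that the two middle factors agree with those of \<open>E_quadratic\<close>,
  on which \<open>qpoch_functional_equation\<close> relies.\<close>

lemma E_quadratic_monic:
  "E (\<lambda>_. a * b) \<star> E (\<lambda>i. - a * x i) \<star> (E (\<lambda>i. - b * x i) \<star> E (\<lambda>i. (x i)\<^sup>2))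
     = E (\<lambda>i. (x i - a) * (x i - b))"
proof -
  have "E (\<lambda>_. a * b) \<star> E (\<lambda>i. - a * x i) = E (\<lambda>i. (x i - b) * (- a))"
    using E_linear[of "\<lambda>_. 1" "a * b" "- a"] by (simp add: algebra_simps)
  moreover have "E (\<lambda>i. - b * x i) \<star> E (\<lambda>i. (x i)\<^sup>2) = E (\<lambda>i. (x i - b) * (1 * x i))"
    using E_linear[of "\<lambda>i. x i" "- b" 1] by (simp add: algebra_simps power2_eq_square)
  moreover have "E (\<lambda>i. (x i - b) * (- a)) \<star> E (\<lambda>i. (x i - b) * (1 * x i)) = E (\<lambda>i. (x i - b) * (- a + 1 * x i))"
    by (rule E_linear)
  ultimately show ?thesis by (simp add: mult.commute)
qed

lemma bc_half_recursion:
  "bc_half N x t a b = E (\<lambda>i. (1 - a * x i) * (1 - b * x i)) \<star> twist (\<lambda>i. (x i)\<^sup>2) (bc_half N x t a b)"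
proof -
  let ?al = "\<lambda>i. (1 - a * x i) * (1 - b * x i)"
  have "bc_half N x t a b = twist ?al (E (\<lambda>_. 1) \<star> twist (\<lambda>i. (x i)\<^sup>2) (littlewood N x t))"
    using littlewood_recursion[OF finite_N inj_x x_nz xx_ne_1, of t] by (simp only: bc_half_def)
  also have "\<dots> = E ?al \<star> twist (\<lambda>i. (x i)\<^sup>2) (bc_half N x t a b)"
    by (simp add: twist_star[OF finite_N] twist_grouplike bc_half_def twist_twist mult.commute)
  finally show ?thesis .
qed

text \<open>This is \<open>bc_half_recursion\<close> at the inverse variables, where star products
  are reversed. A twist by \<open>(x i)\<^sup>2\<close> cancels the twist of \<open>C\<close> and
  turns \<open>1 - a / x i\<close> into \<open>x i - a\<close>.\<close>

lemma bc_half_inverse_recursion: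
  fixes a b
  defines "C \<equiv> bc_half N (\<lambda>i. inverse (x i)) t a b"
  shows "twist (\<lambda>i. (x i)\<^sup>2) C = C \<star> E (\<lambda>i. (x i - a) * (x i - b))"
proof -
  let ?y = "\<lambda>i. inverse (x i)"
  interpret inv: generic_point N ?y t by (rule inverse_point)
  have "C = twist (\<lambda>i. (?y i)\<^sup>2) C \<star> E (\<lambda>i. (1 - a * ?y i) * (1 - b * ?y i))"
    using inv.bc_half_recursion[of a b] unfolding C_def star_inverse .
  then have "twist (\<lambda>i. (x i)\<^sup>2) C = twist (\<lambda>i. (x i)\<^sup>2) (twist (\<lambda>i. (?y i)\<^sup>2) C \<star> E (\<lambda>i. (1 - a * ?y i) * (1 - b * ?y i)))"
    by simp
  also have "\<dots> = twist (\<lambda>i. (x i)\<^sup>2 * (?y i)\<^sup>2) C \<star> E (\<lambda>i. (x i)\<^sup>2 * ((1 - a * ?y i) * (1 - b * ?y i)))"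
    unfolding twist_star[OF finite_N] twist_twist twist_grouplike ..
  also have "twist (\<lambda>i. (x i)\<^sup>2 * (?y i)\<^sup>2) C = twist (\<lambda>_. 1) C"
    by (rule twist_cong[where N = N]) (use x_nz in \<open>auto simp: power_mult_distrib[symmetric] C_def bc_half_def twist_def littlewood_def\<close>)
  also have "E (\<lambda>i. (x i)\<^sup>2 * ((1 - a * ?y i) * (1 - b * ?y i))) = E (\<lambda>i. (x i - a) * (x i - b))"
  proof (rule grouplike_cong)
    fix i assume "i \<in> N"
    then have "x i * (1 - a * ?y i) = x i - a" "x i * (1 - b * ?y i) = x i - b"
      using x_nz by (simp_all add: field_simps)
    then show "(x i)\<^sup>2 * ((1 - a * ?y i) * (1 - b * ?y i)) = (x i - a) * (x i - b)"
      by (metis (no_types, lifting) mult.assoc mult.left_commute power2_eq_square)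
  qed
  finally show ?thesis by simp
qed

text \<open>Only the left factor is expanded. Its new twist by \<open>(x i)\<^sup>2\<close> is
  pulled out of the whole product, which lowers the exponent in the right factor by 2.\<close>

lemma bc_sum_Suc:
  "bc_sum N x t a b (Suc m) = E (\<lambda>i. (1 - a * x i) * (1 - b * x i)) \<star> twist (\<lambda>i. (x i)\<^sup>2) (bc_sum N x t a b m)"
proof -
  let ?C' = "bc_half N (\<lambda>i. inverse (x i)) t a b"
  have "twist (\<lambda>i. x i ^ (2 * Suc m)) ?C' = twist (\<lambda>i. (x i)\<^sup>2) (twist (\<lambda>i. x i ^ (2 * m)) ?C')"
    unfolding twist_twist by (simp add: power2_eq_square mult.assoc)
  then show ?thesis
    unfolding bc_sum_def by (subst bc_half_recursion) (simp only: twist_star[OF finite_N] assoc)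
qed

lemma bc_sum_one_right: "bc_sum N x t a b 1 = bc_sum N x t a b 0 \<star> E (\<lambda>i. (x i - a) * (x i - b))"
  using bc_half_inverse_recursion[of a b] by (simp add: bc_sum_def assoc)

text \<open>The step from \<open>m = 0\<close> to \<open>m = 1\<close> can be made by expanding
  either the right or the left factor; the two results are equated.\<close>

lemma bc_sum_zero_functional_equation:
  "bc_sum N x t a b 0 \<star> E (\<lambda>i. (x i - a) * (x i - b))
    = E (\<lambda>i. (1 - a * x i) * (1 - b * x i)) \<star> twist (\<lambda>i. (x i)\<^sup>2) (bc_sum N x t a b 0)"
  using bc_sum_one_right bc_sum_Suc[of a b 0] by simp

text \<open>By \<open>gauss_star\<close>, the Pochhammer function absorbs \<open>E(a b)\<close> on
  the left, and its twist absorbs \<open>E(a b x\<^sup>2)\<close> on the right. The same fourfold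
  product remains.\<close>

lemma qpoch_functional_equation:
  "card_fun N (qpoch (a * b) t) \<star> E (\<lambda>i. (x i - a) * (x i - b))
    = E (\<lambda>i. (1 - a * x i) * (1 - b * x i)) \<star> twist (\<lambda>i. (x i)\<^sup>2) (card_fun N (qpoch (a * b) t))"
proof -
  let ?q = "card_fun N (qpoch (a * b) t)" and ?x2 = "\<lambda>i. (x i)\<^sup>2"
  let ?M = "E (\<lambda>_. 1) \<star> E (\<lambda>i. - a * x i) \<star> E (\<lambda>i. - b * x i)"
  have "?q \<star> E (\<lambda>_. a * b) = E (\<lambda>_. 1)"
    using gauss_star[of "a * b"] unfolding E_const by (simp add: star_card_fun_commute)
  then have L: "?q \<star> E (\<lambda>i. (x i - a) * (x i - b)) = ?M \<star> E ?x2"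
    by (simp only: E_quadratic_monic[symmetric] assoc[symmetric])
  have "E (\<lambda>i. a * b * (x i)\<^sup>2) \<star> twist ?x2 ?q = E ?x2"
    using arg_cong[OF gauss_star[of "a * b"], of "twist ?x2"]
    by (simp add: twist_star[OF finite_N] twist_grouplike mult.commute)
  then have "E (\<lambda>i. (1 - a * x i) * (1 - b * x i)) \<star> twist ?x2 ?q = ?M \<star> E ?x2"
    by (simp only: E_quadratic[symmetric] assoc)
  with L show ?thesis by simp
qed

text \<open>\<open>S\<close> is the set of inverted variables, which is the complement of the set
  \<open>K\<close> in \<open>star\<close>.\<close>

lemma bc_sum_signs:
  assumes "A \<subseteq> N"
  shows "bc_sum N x t a b m A = (\<Sum>S\<in>Pow A. (\<Prod>i\<in>S. x i ^ (2 * m)) *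
     bc_half N (\<lambda>i. if i \<in> S then inverse (x i) else x i) t a b A)"
proof -
  let ?C = "bc_half N x t a b" and ?C' = "bc_half N (\<lambda>i. inverse (x i)) t a b"
  have fA: "finite A" using assms finite_N finite_subset by blast
  have split: "bc_half N (\<lambda>i. if i \<in> S then inverse (x i) else x i) t a b A =
    ?C (A - S) * ?C' S * (\<Prod>i\<in>S. \<Prod>j\<in>A - S. phi x t i j)" if S: "S \<subseteq> A" for S
  proof -
    let ?y = "\<lambda>i. if i \<in> S then inverse (x i) else x i"
    let ?g = "\<lambda>y i j. (1 - t * y i * y j) / (1 - y i * y j)"
    let ?f = "\<lambda>y::'a. (1 - a * y) * (1 - b * y) * (1 / (1 - y\<^sup>2))"
    have fin: "finite S" "finite (A - S)" using S fA finite_subset by auto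
    have sub: "S \<subseteq> N" "A - S \<subseteq> N" using S assms by auto
    have A: "A - S \<union> S = A" using S by auto
    have half: "bc_half N y t a b B = (\<Prod>i\<in>B. ?f (y i)) * pair_prod (?g y) B" if "B \<subseteq> N" for y B
      using that by (simp only: bc_half_def twist_def littlewood_def if_True prod.distrib mult.assoc)
    have "pair_prod (?g ?y) (A - S \<union> S) = pair_prod (?g ?y) (A - S) * pair_prod (?g ?y) S * (\<Prod>i\<in>S. \<Prod>j\<in>A - S. ?g ?y i j)"
      using fin by (intro pair_prod_union) (auto simp: mult_ac)
    moreover have "pair_prod (?g ?y) (A - S) = pair_prod (?g x) (A - S)"
      by (rule pair_prod_cong) auto
    moreover have "pair_prod (?g ?y) S = pair_prod (?g (\<lambda>i. inverse (x i))) S"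
      by (rule pair_prod_cong) auto
    \<comment> \<open>If only \<open>i\<close> is inverted, the cross factor of the Littlewood
      product is the Hall-Littlewood kernel. This is why the sum over signs is a star
      product.\<close>
    moreover have "(\<Prod>i\<in>S. \<Prod>j\<in>A - S. ?g ?y i j) = (\<Prod>i\<in>S. \<Prod>j\<in>A - S. phi x t i j)"
    proof (intro prod.cong refl)
      fix i j assume ij: "i \<in> S" "j \<in> A - S"
      have "x i \<noteq> 0" using ij sub x_nz by auto
      then have "1 - t * inverse (x i) * x j = (x i - t * x j) / x i" "1 - inverse (x i) * x j = (x i - x j) / x i"
        by (simp_all add: field_simps)
      then show "?g ?y i j = phi x t i j" using ij \<open>x i \<noteq> 0\<close> by (simp add: phi_def)
    qed
    moreover have "(\<Prod>i\<in>A - S \<union> S. ?f (?y i)) = (\<Prod>i\<in>A - S. ?f (?y i)) * (\<Prod>i\<in>S. ?f (?y i))"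
      by (rule prod.union_disjoint) (use fin in auto)
    moreover have "(\<Prod>i\<in>A - S. ?f (?y i)) = (\<Prod>i\<in>A - S. ?f (x i))" by (intro prod.cong) auto
    moreover have "(\<Prod>i\<in>S. ?f (?y i)) = (\<Prod>i\<in>S. ?f (inverse (x i)))" by (intro prod.cong) auto
    ultimately show ?thesis
      unfolding half[OF assms] half[OF sub(1)] half[OF sub(2)] A by (simp only: mult_ac)
  qed
  have "bc_sum N x t a b m A = (\<Sum>K\<in>Pow A. ?C K * ((\<Prod>i\<in>A - K. x i ^ (2 * m)) * ?C' (A - K)) * (\<Prod>i\<in>A - K. \<Prod>j\<in>K. phi x t i j))"
    using assms by (simp add: bc_sum_def star_def twist_def)
  also have "\<dots> = (\<Sum>S\<in>Pow A. (\<Prod>i\<in>S. x i ^ (2 * m)) * bc_half N (\<lambda>i. if i \<in> S then inverse (x i) else x i) t a b A)"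
  proof (rule sum.reindex_bij_witness[where i = "\<lambda>K. A - K" and j = "\<lambda>K. A - K"], goal_cases)
    case (5 K)
    then have "A - (A - K) = K" by auto
    moreover have "A - K \<subseteq> A" by auto
    ultimately show ?case using split[of "A - K"] by (simp only: mult_ac)
  qed auto
  finally show ?thesis .
qed

text \<open>For \<open>m = 0\<close> all sign choices have weight 1, so inverting \<open>x k\<close>
  permutes the terms by toggling \<open>k\<close> in \<open>S\<close>.\<close>

lemma bc_sum_flip:
  assumes "A \<subseteq> N" "k \<in> A"
  shows "bc_sum N (x(k := inverse (x k))) t a b 0 A = bc_sum N x t a b 0 A"
proof -
  interpret fl: generic_point N "x(k := inverse (x k))" t by (rule flip_point)
  let ?T = "\<lambda>S. if k \<in> S then S - {k} else insert k S"
  show ?thesis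
    unfolding bc_sum_signs[OF assms(1)] fl.bc_sum_signs[OF assms(1)]
  proof (rule sum.reindex_bij_witness[where i = ?T and j = ?T], goal_cases)
    case (5 S)
    have "bc_half N (\<lambda>i. if i \<in> ?T S then inverse (x i) else x i) t a b A =
       bc_half N (\<lambda>i. if i \<in> S then inverse ((x(k := inverse (x k))) i) else (x(k := inverse (x k))) i) t a b A"
      by (rule bc_half_cong) auto
    then show ?case by simp
  qed (use assms in \<open>auto split: if_splits\<close>)
qed

end

text \<open>
  The functional equation determines the value at \<open>A\<close> only if the product of the \<open>x\<^sub>i\<^sup>2\<close> is not 1. If it is 1,
  inverting a variable with \<open>x\<^sub>k\<^sup>4 \<noteq> 1\<close>, under which \<open>R\<^sub>0\<close> is invariant, makes it differ from 1.
\<close>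

lemma bc_sum_zero:
  assumes "generic_point N x t" "A \<subseteq> N"
  shows "bc_sum N x t a b 0 A = qpoch (a * b) t (card A)"
proof -
  have "finite A" using assms generic_point.finite_N finite_subset by blast
  then show ?thesis using assms
  proof (induction A arbitrary: x rule: finite_psubset_induct)
    case (psubset A)
    have main: "bc_sum N y t a b 0 A = qpoch (a * b) t (card A)"
      if y: "generic_point N y t" "(\<Prod>i\<in>A. (y i)\<^sup>2) \<noteq> 1" for y
    proof -
      interpret generic_point N y t by fact
      let ?R = "bc_sum N y t a b 0" and ?Q = "card_fun N (qpoch (a * b) t)"
      let ?B = "grouplike N (\<lambda>i. (y i - a) * (y i - b))" and ?D = "grouplike N (\<lambda>i. (1 - a * y i) * (1 - b * y i))"
      let ?x2 = "\<lambda>i. (y i)\<^sup>2"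
      have ne: "A \<noteq> {}" using y(2) by auto
      have R0: "?R {} = 1" by (simp add: bc_sum_def star_empty bc_half_def twist_def littlewood_def pair_prod_def)
      have IH: "?R B = ?Q B" if "B \<subset> A" for B
        using psubset.IH[OF that y(1)] that psubset.prems(2) by (auto simp: card_fun_def)
      \<comment> \<open>Apart from the terms with \<open>F A\<close>, only values of
        \<open>F\<close> on proper subsets occur, and these are known by induction.\<close>
      have eq: "F A + ?B A + (\<Sum>K\<in>Pow A - {{}, A}. F K * ?B (A - K) * (\<Prod>i\<in>A - K. \<Prod>j\<in>K. phi y t i j))
          = ?D A + prod ?x2 A * F A + (\<Sum>K\<in>Pow A - {{}, A}. ?D K * twist ?x2 F (A - K) * (\<Prod>i\<in>A - K. \<Prod>j\<in>K. phi y t i j))"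
        if "star N (phi y t) F ?B = star N (phi y t) ?D (twist ?x2 F)" "F {} = 1" for F
        using fun_cong[OF that(1), of A] psubset.hyps psubset.prems(2) ne that(2)
        by (simp add: star_extremes twist_def grouplike_def)
      have 1: "(\<Sum>K\<in>Pow A - {{}, A}. ?R K * ?B (A - K) * (\<Prod>i\<in>A - K. \<Prod>j\<in>K. phi y t i j))
          = (\<Sum>K\<in>Pow A - {{}, A}. ?Q K * ?B (A - K) * (\<Prod>i\<in>A - K. \<Prod>j\<in>K. phi y t i j))"
      proof (rule sum.cong[OF refl])
        fix K assume "K \<in> Pow A - {{}, A}"
        then have "K \<subset> A" by auto
        then show "?R K * ?B (A - K) * (\<Prod>i\<in>A - K. \<Prod>j\<in>K. phi y t i j) = ?Q K * ?B (A - K) * (\<Prod>i\<in>A - K. \<Prod>j\<in>K. phi y t i j)"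
          by (simp only: IH)
      qed
      have 2: "(\<Sum>K\<in>Pow A - {{}, A}. ?D K * twist ?x2 ?R (A - K) * (\<Prod>i\<in>A - K. \<Prod>j\<in>K. phi y t i j))
          = (\<Sum>K\<in>Pow A - {{}, A}. ?D K * twist ?x2 ?Q (A - K) * (\<Prod>i\<in>A - K. \<Prod>j\<in>K. phi y t i j))"
      proof (rule sum.cong[OF refl])
        fix K assume "K \<in> Pow A - {{}, A}"
        then have "A - K \<subset> A" by auto
        then show "?D K * twist ?x2 ?R (A - K) * (\<Prod>i\<in>A - K. \<Prod>j\<in>K. phi y t i j) = ?D K * twist ?x2 ?Q (A - K) * (\<Prod>i\<in>A - K. \<Prod>j\<in>K. phi y t i j)"
          by (simp only: IH twist_def)
      qed
      \<comment> \<open>Here \<open>u\<close> and \<open>v\<close> are the two candidate values at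
        \<open>A\<close> and \<open>r\<close> is the product of the
        \<open>(y i)\<^sup>2\<close>.\<close>
      have cancel: "u = v" if "u + p + s = d + r * u + s'" "v + p + s = d + r * v + s'" "r \<noteq> 1" for u v p s d r s' :: 'a
      proof -
        have "(1 - r) * (u - v) = (u + p + s - (d + r * u + s')) - (v + p + s - (d + r * v + s'))"
          by (simp add: algebra_simps)
        then have "(1 - r) * (u - v) = 0" using that(1,2) by simp
        then show ?thesis using that(3) by simp
      qed
      have "?R A = ?Q A"
        using cancel[OF eq[OF bc_sum_zero_functional_equation R0, unfolded 1 2] eq[OF qpoch_functional_equation] y(2)]
        by (simp add: card_fun_def)
      then show ?thesis using psubset.prems(2) by (simp add: card_fun_def)
    qed
    interpret generic_point N x t by fact
    show ?case
    proof (cases "A = {}")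
      case True
      then show ?thesis by (simp add: bc_sum_def star_empty bc_half_def twist_def littlewood_def pair_prod_def)
    next
      case ne: False
      show ?thesis
      proof (cases "(\<Prod>i\<in>A. (x i)\<^sup>2) = 1")
        case False
        then show ?thesis using main psubset.prems by blast
      next
        case prod1: True
        have flipped: "(\<Prod>i\<in>A. ((x(k := inverse (x k))) i)\<^sup>2) * (x k) ^ 4 = 1" if "k \<in> A" for k
        proof -
          have "(\<Prod>i\<in>A. ((x(k := inverse (x k))) i)\<^sup>2) = (inverse (x k))\<^sup>2 * (\<Prod>i\<in>A - {k}. (x i)\<^sup>2)"
            using psubset.hyps that by (subst prod.remove[of A k]) (auto intro!: prod.cong)
          moreover have "(x k)\<^sup>2 * (\<Prod>i\<in>A - {k}. (x i)\<^sup>2) = 1"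
            using prod1 prod.remove[OF psubset.hyps that, of "\<lambda>i. (x i)\<^sup>2"] by simp
          moreover have "x k \<noteq> 0" using x_nz that psubset.prems by auto
          ultimately show ?thesis by (simp add: field_simps power2_eq_square power4_eq_xxxx)
        qed
        \<comment> \<open>Otherwise every \<open>(x k)\<^sup>2\<close> is -1, since it is not 1. A
          single variable would then give the product -1, and two of them would satisfy
          \<open>x l = - x k\<close>, hence \<open>x k * x l = 1\<close>.\<close>
        have "\<exists>k\<in>A. x k ^ 4 \<noteq> 1"
        proof (rule ccontr)
          assume "\<not> ?thesis"
          then have four: "x k ^ 4 = 1" if "k \<in> A" for k using that by auto
          have sq: "(x k)\<^sup>2 = - 1" if "k \<in> A" for k
          proof -
            have "((x k)\<^sup>2 - 1) * ((x k)\<^sup>2 + 1) = 0"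
              using four[OF that] by (simp add: algebra_simps power2_eq_square power4_eq_xxxx)
            moreover have "(x k)\<^sup>2 \<noteq> 1" using xx_ne_1[of k k] that psubset.prems by (auto simp: power2_eq_square)
            ultimately show ?thesis by (auto simp: add_eq_0_iff2)
          qed
          obtain k where k: "k \<in> A" using ne by auto
          show False
          proof (cases "A = {k}")
            case True
            then show False using prod1 sq[OF k] by simp
          next
            case False
            then obtain l where l: "l \<in> A" "l \<noteq> k" using k by auto
            have kN: "k \<in> N" "l \<in> N" using k l psubset.prems by auto
            have "(x k - x l) * (x k + x l) = 0" using sq[OF k] sq[OF l(1)] by (simp add: algebra_simps power2_eq_square)
            moreover have "x k \<noteq> x l" using inj_x kN l by (auto simp: inj_on_def)
            ultimately have "x l = - x k" by (simp add: eq_neg_iff_add_eq_0 add.commute)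
            then have "x k * x l = 1" using sq[OF k] by (simp add: power2_eq_square)
            then show False using xx_ne_1 kN by blast
          qed
        qed
        then obtain k where k: "k \<in> A" "x k ^ 4 \<noteq> 1" by blast
        then have "(\<Prod>i\<in>A. ((x(k := inverse (x k))) i)\<^sup>2) \<noteq> 1" using flipped[OF k(1)] by auto
        then show ?thesis
          using main[OF flip_point] bc_sum_flip[OF psubset.prems(2) k(1), of a b] k psubset.prems by auto
      qed
    qed
  qed
qed

section \<open>Hall-Littlewood polynomials as sums over level sets\<close>

fun list_weight :: "('i \<Rightarrow> 'i \<Rightarrow> 'a::comm_monoid_mult) \<Rightarrow> 'i list \<Rightarrow> 'a" where
  "list_weight g [] = 1"
| "list_weight g (a # xs) = (\<Prod>b\<in>set xs. g a b) * list_weight g xs"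

lemma list_weight_nth:
  "distinct xs \<Longrightarrow> (\<Prod>j<length xs. \<Prod>i<j. g (xs ! i) (xs ! j)) = list_weight g xs"
proof (induction xs)
  case (Cons a xs)
  have "(\<Prod>j<length xs. g a (xs ! j)) = (\<Prod>b\<in>set xs. g a b)"
    using Cons.prems by (simp add: prod.distinct_set_conv_list prod.list_conv_set_nth atLeast0LessThan)
  then show ?case using Cons
    by (simp add: prod.lessThan_Suc_shift prod.distrib del: prod.lessThan_Suc)
qed simp

lemma list_weight_symmetric:
  "distinct xs \<Longrightarrow> (\<And>i j. g i j = g j i) \<Longrightarrow> list_weight g xs = pair_prod g (set xs)"
proof (induction xs)
  case (Cons a xs)
  then show ?case by (simp add: pair_prod_insert)
qed (simp add: pair_prod_def)

lemma list_weight_mult: "list_weight (\<lambda>i j. g i j * h i j) xs = list_weight g xs * list_weight h xs"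
  by (induction xs) (auto simp: prod.distrib mult_ac)

lemma list_weight_cong:
  "distinct xs \<Longrightarrow> (\<And>i j. i \<in> set xs \<Longrightarrow> j \<in> set xs \<Longrightarrow> i \<noteq> j \<Longrightarrow> g i j = h i j) \<Longrightarrow> list_weight g xs = list_weight h xs"
  by (induction xs) (auto intro!: arg_cong2[of _ _ _ _ "(*)"] prod.cong)

lemma bij_betw_permutes_lists:
  "bij_betw (\<lambda>p. map p [0..<n]) {p. p permutes {..<n}} (permutations_of_set {..<n})"
proof -
  let ?h = "\<lambda>p::nat \<Rightarrow> nat. map p [0..<n]"
  have inj: "inj_on ?h {p. p permutes {..<n}}"
  proof (rule inj_onI)
    fix p q assume pq: "p \<in> {p. p permutes {..<n}}" "q \<in> {p. p permutes {..<n}}" "?h p = ?h q"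
    show "p = q"
    proof
      fix i
      show "p i = q i"
      proof (cases "i < n")
        case True
        then show ?thesis using pq(3) by (simp add: map_eq_conv)
      next
        case False
        then show ?thesis using pq by (simp add: permutes_def)
      qed
    qed
  qed
  have sub: "?h ` {p. p permutes {..<n}} \<subseteq> permutations_of_set {..<n}"
  proof
    fix xs assume "xs \<in> ?h ` {p. p permutes {..<n}}"
    then obtain p where p: "p permutes {..<n}" "xs = ?h p" by auto
    then have "set xs = {..<n}" using permutes_image[OF p(1)] by (simp add: atLeast0LessThan)
    moreover have "distinct xs" using p permutes_inj[OF p(1)] by (simp add: distinct_map inj_on_def)
    ultimately show "xs \<in> permutations_of_set {..<n}" by (simp add: permutations_of_set_def)
  qed
  have "card (?h ` {p. p permutes {..<n}}) = card (permutations_of_set {..<n})"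
    using card_image[OF inj] by (simp add: card_permutations)
  then have "?h ` {p. p permutes {..<n}} = permutations_of_set {..<n}"
    using sub by (intro card_subset_eq) auto
  then show ?thesis using inj by (simp add: bij_betw_def)
qed

text \<open>The t-factorial of \<open>r\<close>, the contribution of one multiplicity to
  \<open>v_\<lambda>(t)\<close>.\<close>

definition vfactor :: "'a::field \<Rightarrow> nat \<Rightarrow> 'a" where
  "vfactor t r = qpoch t t r / (1 - t) ^ r"

lemma vfactor_0 [simp]: "vfactor t 0 = 1"
  by (simp add: vfactor_def)

context generic_point
begin

lemma vfactor_Suc: "vfactor t (Suc r) = vfactor t r * ((1 - t ^ Suc r) / (1 - t))"
  by (simp add: vfactor_def qpoch_Suc)

lemma vfactor_nz:
  assumes "r \<le> card N"
  shows "vfactor t r \<noteq> 0"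
proof (cases r)
  case (Suc k)
  then have "t \<noteq> 1" using t_power_ne_1[of 1] assms by simp
  then show ?thesis using qpoch_nonzero[OF t_power_ne_1 assms] by (simp add: vfactor_def)
qed simp

text \<open>The list starts with any element of the highest level. Summing over that element gives
  one factor of the t-factorial of its level, while the kernels between different levels are the
  same for every choice.\<close>

lemma sum_decreasing_permutations:
  fixes f :: "nat \<Rightarrow> nat"
  assumes "A \<subseteq> N" "finite T" "f ` A \<subseteq> T"
  shows "(\<Sum>xs | xs \<in> permutations_of_set A \<and> sorted_wrt (\<ge>) (map f xs). list_weight (phi x t) xs)
    = (\<Prod>k\<in>T. vfactor t (card {i\<in>A. f i = k})) * (\<Prod>i\<in>A. \<Prod>j\<in>{j\<in>A. f j < f i}. phi x t i j)"
proof -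
  have "finite A" using assms finite_N finite_subset by blast
  then show ?thesis using assms(1,3)
  proof (induction A rule: finite_psubset_induct)
    case (psubset A)
    show ?case
    proof (cases "A = {}")
      case True
      have "{xs. xs \<in> permutations_of_set A \<and> sorted_wrt (\<ge>) (map f xs)} = {[]}" using True by auto
      then show ?thesis using True by simp
    next
      case False
      define \<mu> where "\<mu> = Max (f ` A)"
      define B where "B = {i\<in>A. f i = \<mu>}"
      have mu: "\<mu> \<in> f ` A" "\<And>i. i \<in> A \<Longrightarrow> f i \<le> \<mu>" using psubset.hyps False by (auto simp: \<mu>_def)
      have fB: "finite B" "B \<subseteq> A" "B \<subseteq> N" using psubset by (auto simp: B_def)
      have cB: "card B \<noteq> 0" using mu fB by (auto simp: B_def)
      have t1: "t \<noteq> 1"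
        using t_power_ne_1[of 1] cB card_mono[OF finite_N fB(3)] by simp
      let ?S = "\<lambda>A. {xs. xs \<in> permutations_of_set A \<and> sorted_wrt (\<ge>) (map f xs)}"
      let ?Q = "\<lambda>A. \<Prod>i\<in>A. \<Prod>j\<in>{j\<in>A. f j < f i}. phi x t i j"
      let ?V = "\<lambda>A K. \<Prod>k\<in>K. vfactor t (card {i\<in>A. f i = k})"
      have S: "?S A = (\<Union>a\<in>B. (#) a ` ?S (A - {a}))"
      proof (intro set_eqI iffI)
        fix xs assume xs: "xs \<in> ?S A"
        then obtain a ys where a: "a \<in> A" "ys \<in> permutations_of_set (A - {a})" "xs = a # ys"
          using permutations_of_set_nonempty[OF False] by auto
        have "set ys = A - {a}" using a by (simp add: permutations_of_set_def)
        then have "f i \<le> f a" if "i \<in> A" for i using xs a that by (cases "i = a") auto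
        then have "f a = \<mu>" using mu a(1) by (metis antisym imageE)
        then show "xs \<in> (\<Union>a\<in>B. (#) a ` ?S (A - {a}))" using a xs by (auto simp: B_def)
      next
        fix xs assume "xs \<in> (\<Union>a\<in>B. (#) a ` ?S (A - {a}))"
        then obtain a ys where a: "a \<in> A" "f a = \<mu>" "ys \<in> permutations_of_set (A - {a})"
          "sorted_wrt (\<ge>) (map f ys)" "xs = a # ys" by (auto simp: B_def)
        have "set ys = A - {a}" using a by (simp add: permutations_of_set_def)
        then have "sorted_wrt (\<ge>) (map f xs)" using a mu by auto
        moreover have "xs \<in> permutations_of_set A"
          using a permutations_of_set_nonempty[OF False] by auto
        ultimately show "xs \<in> ?S A" by simp
      qed
      have "sum (list_weight (phi x t)) (?S A) = (\<Sum>a\<in>B. sum (list_weight (phi x t)) ((#) a ` ?S (A - {a})))"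
        unfolding S using fB by (intro sum.UNION_disjoint) auto
      also have "\<dots> = (\<Sum>a\<in>B. ?V A (T - {\<mu>}) * vfactor t (card B - 1) * ?Q A * (\<Prod>b\<in>B - {a}. phi x t a b))"
      proof (rule sum.cong[OF refl])
        fix a assume aB: "a \<in> B"
        have a: "a \<in> A" "f a = \<mu>" using aB by (auto simp: B_def)
        let ?L = "{j\<in>A. f j < \<mu>}"
        have "sum (list_weight (phi x t)) ((#) a ` ?S (A - {a})) = (\<Sum>xs\<in>?S (A - {a}). list_weight (phi x t) (a # xs))"
          by (subst sum.reindex) auto
        also have "\<dots> = (\<Sum>xs\<in>?S (A - {a}). (\<Prod>b\<in>A - {a}. phi x t a b) * list_weight (phi x t) xs)"
          by (rule sum.cong) (auto simp: permutations_of_set_def)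
        also have "\<dots> = (\<Prod>b\<in>A - {a}. phi x t a b) * sum (list_weight (phi x t)) (?S (A - {a}))"
          by (simp only: sum_distrib_left)
        also have "sum (list_weight (phi x t)) (?S (A - {a})) = ?V (A - {a}) T * ?Q (A - {a})"
          using psubset.IH[of "A - {a}"] psubset.prems a by auto
        also have "?V (A - {a}) T = ?V A (T - {\<mu>}) * vfactor t (card B - 1)"
        proof -
          have "\<mu> \<in> T" using mu psubset.prems by auto
          then have "?V (A - {a}) T = vfactor t (card {i\<in>A - {a}. f i = \<mu>}) * ?V (A - {a}) (T - {\<mu>})"
            using assms(2) by (rule prod.remove[rotated])
          moreover have "{i\<in>A - {a}. f i = \<mu>} = B - {a}" by (auto simp: B_def)
          moreover have "card (B - {a}) = card B - 1" using aB fB by simp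
          moreover have "?V (A - {a}) (T - {\<mu>}) = ?V A (T - {\<mu>})"
          proof (rule prod.cong[OF refl])
            fix k assume "k \<in> T - {\<mu>}"
            then have "{i\<in>A - {a}. f i = k} = {i\<in>A. f i = k}" using a by auto
            then show "vfactor t (card {i\<in>A - {a}. f i = k}) = vfactor t (card {i\<in>A. f i = k})" by simp
          qed
          ultimately show ?thesis by simp
        qed
        finally have "sum (list_weight (phi x t)) ((#) a ` ?S (A - {a})) =
          (\<Prod>b\<in>A - {a}. phi x t a b) * (?V A (T - {\<mu>}) * vfactor t (card B - 1) * ?Q (A - {a}))" .
        moreover have "?Q A = (\<Prod>j\<in>?L. phi x t a j) * ?Q (A - {a})"
        proof -
          have "?Q A = (\<Prod>j\<in>?L. phi x t a j) * (\<Prod>i\<in>A - {a}. \<Prod>j\<in>{j\<in>A. f j < f i}. phi x t i j)"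
            using prod.remove[OF psubset.hyps a(1), of "\<lambda>i. \<Prod>j\<in>{j\<in>A. f j < f i}. phi x t i j"] a(2) by simp
          moreover have "{j\<in>A. f j < f i} = {j\<in>A - {a}. f j < f i}" if "i \<in> A" for i
            using mu(2)[OF that] a by auto
          ultimately show ?thesis by simp
        qed
        moreover have "(\<Prod>b\<in>A - {a}. phi x t a b) = (\<Prod>j\<in>?L. phi x t a j) * (\<Prod>b\<in>B - {a}. phi x t a b)"
        proof -
          have "A - {a} = ?L \<union> (B - {a})" using mu(2) a by (auto simp: B_def order_less_le)
          moreover have "(\<Prod>b\<in>?L \<union> (B - {a}). phi x t a b) = (\<Prod>j\<in>?L. phi x t a j) * (\<Prod>b\<in>B - {a}. phi x t a b)"
            using fB psubset.hyps by (intro prod.union_disjoint) (auto simp: B_def)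
          ultimately show ?thesis by simp
        qed
        ultimately show "sum (list_weight (phi x t)) ((#) a ` ?S (A - {a})) =
          ?V A (T - {\<mu>}) * vfactor t (card B - 1) * ?Q A * (\<Prod>b\<in>B - {a}. phi x t a b)"
          by (simp only: mult_ac)
      qed
      also have "\<dots> = ?V A (T - {\<mu>}) * vfactor t (card B - 1) * ?Q A * (\<Sum>a\<in>B. \<Prod>b\<in>B - {a}. phi x t a b)"
        by (simp only: sum_distrib_left)
      \<comment> \<open>The top factor of the t-factorial of \<open>card B\<close>.\<close>
      also have "(\<Sum>a\<in>B. \<Prod>b\<in>B - {a}. phi x t a b) = (1 - t ^ card B) / (1 - t)"
        using sum_prod_phi_plus[OF fB(1) inj_on_subset[OF inj_x fB(3)], of t] x_nz fB t1
        by (simp add: field_simps subset_iff)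
      also have "?V A (T - {\<mu>}) * vfactor t (card B - 1) * ?Q A * ((1 - t ^ card B) / (1 - t)) = ?V A T * ?Q A"
      proof -
        have "\<mu> \<in> T" using mu psubset.prems by auto
        then have "?V A T = vfactor t (card B) * ?V A (T - {\<mu>})"
          unfolding B_def using assms(2) by (rule prod.remove[rotated])
        moreover have "vfactor t (card B) = vfactor t (card B - 1) * ((1 - t ^ card B) / (1 - t))"
          using vfactor_Suc[of "card B - 1"] cB by simp
        ultimately show ?thesis by (simp only: mult_ac)
      qed
      finally show ?thesis .
    qed
  qed
qed

text \<open>\<open>f i\<close> is the part of a partition that becomes the exponent of
  \<open>x i\<close>. The functions \<open>f\<close> with the same multiplicities correspond to the
  cosets of the stabiliser of that partition in the symmetric group.\<close>

definition level_sum :: "(nat \<Rightarrow> nat \<Rightarrow> 'a) \<Rightarrow> nat \<Rightarrow> nat set \<Rightarrow> 'a" where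
  "level_sum \<gamma> M A = (if A \<subseteq> N then \<Sum>f\<in>A \<rightarrow>\<^sub>E {..M}. (\<Prod>k\<le>M. \<gamma> k (card {i\<in>A. f i = k})) *
     (\<Prod>i\<in>A. x i ^ f i) * (\<Prod>i\<in>A. \<Prod>j\<in>{j\<in>A. f j < f i}. phi x t i j) else 0)"

lemma level_sum_0: "level_sum \<gamma> 0 = card_fun N (\<gamma> 0)"
proof
  fix A :: "nat set"
  have "A \<rightarrow>\<^sub>E {..0::nat} = {\<lambda>i\<in>A. 0}"
    by (auto simp: PiE_iff extensional_def fun_eq_iff)
  moreover have "{i\<in>A. (\<lambda>i\<in>A. 0::nat) i = 0} = A" "(\<Prod>i\<in>A. x i ^ (\<lambda>i\<in>A. 0::nat) i) = 1"
    by auto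
  moreover have "{j\<in>A. (\<lambda>i\<in>A. 0::nat) j < (\<lambda>i\<in>A. 0::nat) i} = {}" if "i \<in> A" for i using that by auto
  ultimately show "level_sum \<gamma> 0 A = card_fun N (\<gamma> 0) A"
    by (simp add: level_sum_def card_fun_def)
qed

text \<open>The left factor takes the variables with exponent 0. The other exponents drop by 1,
  whence the twist by \<open>x\<close>, and the kernels between the two groups are those of the star
  product.\<close>

lemma level_sum_Suc:
  "level_sum \<gamma> (Suc M) = card_fun N (\<gamma> 0) \<star> twist x (level_sum (\<lambda>k. \<gamma> (Suc k)) M)"
proof
  fix A
  show "level_sum \<gamma> (Suc M) A = (card_fun N (\<gamma> 0) \<star> twist x (level_sum (\<lambda>k. \<gamma> (Suc k)) M)) A"
  proof (cases "A \<subseteq> N")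
    case True
    have fA: "finite A" using True finite_N finite_subset by blast
    let ?H = "\<lambda>\<gamma> M A f. (\<Prod>k\<le>M. \<gamma> k (card {i\<in>A. f i = k})) * (\<Prod>i\<in>A. x i ^ f i) * (\<Prod>i\<in>A. \<Prod>j\<in>{j\<in>A. f j < f i}. phi x t i j)"
    let ?g = "\<lambda>k. \<gamma> (Suc k)"
    let ?w = "\<lambda>K. \<Prod>i\<in>A - K. \<Prod>j\<in>K. phi x t i j"
    have "(card_fun N (\<gamma> 0) \<star> twist x (level_sum ?g M)) A =
      (\<Sum>K\<in>Pow A. \<Sum>f\<in>(A - K) \<rightarrow>\<^sub>E {..M}. \<gamma> 0 (card K) * ((\<Prod>i\<in>A - K. x i) * ?H ?g M (A - K) f) * ?w K)"
    proof -
      have "card_fun N (\<gamma> 0) K * twist x (level_sum ?g M) (A - K) * ?w K =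
         (\<Sum>f\<in>(A - K) \<rightarrow>\<^sub>E {..M}. \<gamma> 0 (card K) * ((\<Prod>i\<in>A - K. x i) * ?H ?g M (A - K) f) * ?w K)" if "K \<in> Pow A" for K
      proof -
        have "K \<subseteq> N" "A - K \<subseteq> N" using that True by auto
        then show ?thesis
          by (simp only: card_fun_def twist_def level_sum_def if_True sum_distrib_left sum_distrib_right)
      qed
      then show ?thesis unfolding star_def using True by (simp only: if_True cong: sum.cong)
    qed
    also have "\<dots> = (\<Sum>(K, f)\<in>Sigma (Pow A) (\<lambda>K. (A - K) \<rightarrow>\<^sub>E {..M}).
        \<gamma> 0 (card K) * ((\<Prod>i\<in>A - K. x i) * ?H ?g M (A - K) f) * ?w K)"
      using fA by (subst sum.Sigma) (auto intro: finite_PiE)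
    also have "\<dots> = (\<Sum>f\<in>A \<rightarrow>\<^sub>E {..Suc M}. ?H \<gamma> (Suc M) A f)"
    proof (rule sum.reindex_bij_witness[where j = "\<lambda>(K, f). \<lambda>i\<in>A. if i \<in> K then 0 else Suc (f i)"
          and i = "\<lambda>f. ({i\<in>A. f i = 0}, \<lambda>i\<in>A - {i\<in>A. f i = 0}. f i - 1)"], goal_cases)
      case (1 a)
      then obtain K f where a: "a = (K, f)" "K \<subseteq> A" "f \<in> (A - K) \<rightarrow>\<^sub>E {..M}" by auto
      have K: "{i\<in>A. (\<lambda>i\<in>A. if i \<in> K then 0 else Suc (f i)) i = 0} = K" using a by auto
      have "(\<lambda>i\<in>A - K. (\<lambda>i\<in>A. if i \<in> K then 0 else Suc (f i)) i - 1) = f"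
        using a(3) by (auto simp: fun_eq_iff PiE_iff extensional_def)
      then show ?case unfolding a prod.case K by simp
    next
      case (2 a)
      then obtain K f where a: "a = (K, f)" "K \<subseteq> A" "f \<in> (A - K) \<rightarrow>\<^sub>E {..M}" by auto
      then show ?case by (auto simp: PiE_iff)
    next
      case (3 f)
      then show ?case by (auto simp: fun_eq_iff PiE_iff extensional_def)
    next
      case (4 f)
      then show ?case by (auto simp: PiE_iff)
    next
      case (5 a)
      then obtain K f where a: "a = (K, f)" "K \<subseteq> A" "f \<in> (A - K) \<rightarrow>\<^sub>E {..M}" by auto
      let ?f = "\<lambda>i\<in>A. if i \<in> K then 0 else Suc (f i)"
      have fin: "finite K" using a fA finite_subset by auto
      have A: "K \<union> (A - K) = A" using a by auto
      have "(\<Prod>k\<le>Suc M. \<gamma> k (card {i\<in>A. ?f i = k})) = \<gamma> 0 (card {i\<in>A. ?f i = 0}) * (\<Prod>k\<le>M. \<gamma> (Suc k) (card {i\<in>A. ?f i = Suc k}))"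
        by (rule prod.atMost_Suc_shift)
      moreover have "{i\<in>A. ?f i = 0} = K" using a by auto
      moreover have "{i\<in>A. ?f i = Suc k} = {i\<in>A - K. f i = k}" for k by auto
      ultimately have 1: "(\<Prod>k\<le>Suc M. \<gamma> k (card {i\<in>A. ?f i = k})) = \<gamma> 0 (card K) * (\<Prod>k\<le>M. \<gamma> (Suc k) (card {i\<in>A - K. f i = k}))"
        by simp
      have "(\<Prod>i\<in>K \<union> (A - K). x i ^ ?f i) = (\<Prod>i\<in>K. x i ^ ?f i) * (\<Prod>i\<in>A - K. x i ^ ?f i)"
        using fin fA by (intro prod.union_disjoint) auto
      moreover have "(\<Prod>i\<in>K. x i ^ ?f i) = 1" using a by (intro prod.neutral) auto
      moreover have "(\<Prod>i\<in>A - K. x i ^ ?f i) = (\<Prod>i\<in>A - K. x i * x i ^ f i)" by (intro prod.cong) auto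
      ultimately have 2: "(\<Prod>i\<in>A. x i ^ ?f i) = (\<Prod>i\<in>A - K. x i) * (\<Prod>i\<in>A - K. x i ^ f i)"
        unfolding A by (simp add: prod.distrib)
      have "(\<Prod>i\<in>K \<union> (A - K). \<Prod>j\<in>{j\<in>A. ?f j < ?f i}. phi x t i j) =
          (\<Prod>i\<in>K. \<Prod>j\<in>{j\<in>A. ?f j < ?f i}. phi x t i j) * (\<Prod>i\<in>A - K. \<Prod>j\<in>{j\<in>A. ?f j < ?f i}. phi x t i j)"
        using fin fA by (intro prod.union_disjoint) auto
      moreover have "(\<Prod>i\<in>K. \<Prod>j\<in>{j\<in>A. ?f j < ?f i}. phi x t i j) = 1" using a by (intro prod.neutral) auto
      moreover have "(\<Prod>i\<in>A - K. \<Prod>j\<in>{j\<in>A. ?f j < ?f i}. phi x t i j) =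
         (\<Prod>i\<in>A - K. (\<Prod>j\<in>K. phi x t i j) * (\<Prod>j\<in>{j\<in>A - K. f j < f i}. phi x t i j))"
      proof (rule prod.cong[OF refl])
        fix i assume i: "i \<in> A - K"
        have "{j\<in>A. ?f j < ?f i} = K \<union> {j\<in>A - K. f j < f i}" using i a by auto
        moreover have "(\<Prod>j\<in>K \<union> {j\<in>A - K. f j < f i}. phi x t i j) = (\<Prod>j\<in>K. phi x t i j) * (\<Prod>j\<in>{j\<in>A - K. f j < f i}. phi x t i j)"
          using fin fA by (intro prod.union_disjoint) auto
        ultimately show "(\<Prod>j\<in>{j\<in>A. ?f j < ?f i}. phi x t i j) = (\<Prod>j\<in>K. phi x t i j) * (\<Prod>j\<in>{j\<in>A - K. f j < f i}. phi x t i j)"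
          by simp
      qed
      ultimately have 3: "(\<Prod>i\<in>A. \<Prod>j\<in>{j\<in>A. ?f j < ?f i}. phi x t i j) = ?w K * (\<Prod>i\<in>A - K. \<Prod>j\<in>{j\<in>A - K. f j < f i}. phi x t i j)"
        unfolding A by (simp add: prod.distrib)
      show ?case unfolding a prod.case 1 2 3 by (simp only: mult_ac)
    qed
    also have "\<dots> = level_sum \<gamma> (Suc M) A" using True by (simp only: level_sum_def if_True)
    finally show ?thesis by simp
  qed (simp add: level_sum_def star_def)
qed

end

section \<open>Partitions as level functions\<close>

lemma decreasing_list_split:
  fixes L :: "nat list"
  assumes "sorted_wrt (\<ge>) L"
  shows "filter (\<lambda>k. 0 < k) L @ replicate (length L - length (filter (\<lambda>k. 0 < k) L)) 0 = L"
  using assms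
proof (induction L)
  case (Cons a L)
  show ?case
  proof (cases "a = 0")
    case True
    then have "\<forall>k\<in>set L. k = 0" using Cons.prems by auto
    then have "filter (\<lambda>k. 0 < k) (a # L) = []" using True by simp
    moreover have "replicate (length (a # L)) 0 = a # L"
      using \<open>\<forall>k\<in>set L. k = 0\<close> True by (intro replicate_eqI[symmetric]) auto
    ultimately show ?thesis by simp
  next
    case False
    then show ?thesis using Cons by simp
  qed
qed simp

lemma part_filter_decreasing:
  assumes "sorted_wrt (\<ge>) L" "i < length L"
  shows "part (filter (\<lambda>k. 0 < k) L) i = L ! i"
proof -
  let ?la = "filter (\<lambda>k. 0 < k) L"
  have "L ! i = (?la @ replicate (length L - length ?la) 0) ! i"
    using decreasing_list_split[OF assms(1)] by simp
  then show ?thesis using assms(2) by (simp add: part_def nth_default_def nth_append)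
qed

lemma map_part:
  assumes "length la \<le> n"
  shows "map (part la) [0..<n] = la @ replicate (n - length la) 0"
  using assms by (intro nth_equalityI) (auto simp: part_def nth_default_def nth_append)

lemma partition_part_le:
  assumes "is_partition la" "part la 0 \<le> M"
  shows "part la i \<le> M"
proof (cases "i < length la")
  case True
  then have "la ! i \<le> la ! 0" using assms(1)
    by (cases i) (auto simp: is_partition_def sorted_wrt_iff_nth_less)
  then show ?thesis using assms(2) True by (auto simp: part_def nth_default_def split: if_splits)
qed (simp add: part_def nth_default_def)

text \<open>The added levels are empty and contribute \<open>vfactor t 0 = 1\<close>; all partitions
  in the sum thereby share one range of levels.\<close>

lemma vfac_upto:
  assumes "is_partition la" "part la 0 \<le> M"
  shows "vfac n la t = (\<Prod>k\<le>M. vfactor t (part_mult n la k))"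
proof -
  have "part_mult n la k = 0" if "k \<in> {..M} - {..part la 0}" for k
  proof -
    have "k \<notin> set la"
    proof
      assume "k \<in> set la"
      then obtain i where "i < length la" "la ! i = k" by (auto simp: in_set_conv_nth)
      then show False using partition_part_le[OF assms(1) order_refl, of i] that
        by (simp add: part_def nth_default_def)
    qed
    then show ?thesis using that by (simp add: part_mult_def count_list_0_iff)
  qed
  then show ?thesis unfolding vfac_def vfactor_def[symmetric]
    using assms(2) by (intro prod.mono_neutral_left) auto
qed

text \<open>The partition, padded with zeros, is carried along \<open>p\<close>, so that
  \<open>f (p i)\<close> is its part with index \<open>i\<close>. Deleting the zeros from the
  decreasing list of levels recovers it.\<close>

lemma sum_partitions_as_levels:
  fixes G :: "nat list \<Rightarrow> 'a::comm_monoid_add"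
  assumes p: "p permutes {..<n}"
  shows "(\<Sum>la | is_partition la \<and> part la 0 \<le> M \<and> length la \<le> n. G la) =
    (\<Sum>f | f \<in> {..<n} \<rightarrow>\<^sub>E {..M} \<and> sorted_wrt (\<ge>) (map f (map p [0..<n])).
       G (filter (\<lambda>k. 0 < k) (map f (map p [0..<n]))))"
proof (rule sum.reindex_bij_witness[where i = "\<lambda>f. filter (\<lambda>k. 0 < k) (map f (map p [0..<n]))"
      and j = "\<lambda>la. \<lambda>i\<in>{..<n}. part la (inv p i)"], goal_cases)
  case (1 la)
  have "map (\<lambda>i\<in>{..<n}. part la (inv p i)) (map p [0..<n]) = map (part la) [0..<n]"
    using permutes_in_image[OF p] permutes_inverses(2)[OF p] by auto
  also have "\<dots> = la @ replicate (n - length la) 0" using 1 by (intro map_part) auto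
  finally show ?case using 1 by (auto simp: is_partition_def filter_id_conv intro: gr0I)
next
  case (2 la)
  have "map (\<lambda>i\<in>{..<n}. part la (inv p i)) (map p [0..<n]) = map (part la) [0..<n]"
    using permutes_in_image[OF p] permutes_inverses(2)[OF p] by auto
  also have "\<dots> = la @ replicate (n - length la) 0" using 2 by (intro map_part) auto
  also have "sorted_wrt (\<ge>) \<dots>"
  proof -
    have "sorted_wrt (\<ge>) (replicate k (0::nat))" for k by (induction k) auto
    then show ?thesis using 2 by (simp add: is_partition_def sorted_wrt_append)
  qed
  finally have "sorted_wrt (\<ge>) (map (\<lambda>i\<in>{..<n}. part la (inv p i)) (map p [0..<n]))" .
  then show ?case using 2 partition_part_le[of la M] by auto
next
  case (3 f)
  show ?case
  proof
    fix i
    show "(\<lambda>i\<in>{..<n}. part (filter (\<lambda>k. 0 < k) (map f (map p [0..<n]))) (inv p i)) i = f i"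
    proof (cases "i < n")
      case True
      then have "inv p i < n" using permutes_in_image[OF permutes_inv[OF p], of i] by simp
      then show ?thesis using part_filter_decreasing[of "map f (map p [0..<n])" "inv p i"] 3 True
        by (simp add: permutes_inverses(1)[OF p])
    next
      case False
      then show ?thesis using 3 by (auto simp: PiE_iff extensional_def)
    qed
  qed
next
  case (4 f)
  let ?L = "map f (map p [0..<n])"
  have "sorted_wrt (\<ge>) (filter (\<lambda>k. 0 < k) ?L)" using 4 by (intro sorted_wrt_filter) auto
  then have "is_partition (filter (\<lambda>k. 0 < k) ?L)" by (simp add: is_partition_def)
  moreover have "length (filter (\<lambda>k. 0 < k) ?L) \<le> n"
    using length_filter_le[of "\<lambda>k. 0 < k" ?L] by simp
  moreover have "part (filter (\<lambda>k. 0 < k) ?L) 0 \<le> M"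
  proof (cases "n = 0")
    case False
    then have "part (filter (\<lambda>k. 0 < k) ?L) 0 = f (p 0)"
      using part_filter_decreasing[of ?L 0] 4 by simp
    moreover have "p 0 \<in> {..<n}" using False permutes_in_image[OF p, of 0] by simp
    ultimately show ?thesis using 4 by (auto simp: PiE_iff)
  qed (simp add: part_def)
  ultimately show ?case by simp
next
  case (5 la)
  have "map (\<lambda>i\<in>{..<n}. part la (inv p i)) (map p [0..<n]) = map (part la) [0..<n]"
    using permutes_in_image[OF p] permutes_inverses(2)[OF p] by auto
  also have "\<dots> = la @ replicate (n - length la) 0" using 5 by (intro map_part) auto
  finally have "filter (\<lambda>k. 0 < k) (map (\<lambda>i\<in>{..<n}. part la (inv p i)) (map p [0..<n])) = la"
    using 5 by (auto simp: is_partition_def filter_id_conv intro: gr0I)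
  then show ?case by simp
qed

lemma part_mult_levels:
  assumes p: "p permutes {..<n}"
  shows "part_mult n (filter (\<lambda>k. 0 < k) (map f (map p [0..<n]))) k = card {i\<in>{..<n}. f i = k}"
proof -
  let ?L = "map f (map p [0..<n])"
  have len: "length (filter (\<lambda>l. l = k) ?L) = card {i\<in>{..<n}. f i = k}"
  proof -
    have "length (filter (\<lambda>l. l = k) ?L) = card {i. i < n \<and> f (p i) = k}"
      by (simp add: length_filter_conv_card cong: conj_cong)
    also have "\<dots> = card (p ` {i. i < n \<and> f (p i) = k})"
      using permutes_inj_on[OF p] by (rule card_image[symmetric])
    also have "p ` {i. i < n \<and> f (p i) = k} = {i\<in>{..<n}. f i = k}"
    proof (intro set_eqI iffI)
      fix i assume "i \<in> {i\<in>{..<n}. f i = k}"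
      then have "inv p i < n" "p (inv p i) = i" "f i = k"
        using permutes_in_image[OF permutes_inv[OF p], of i] permutes_inverses(1)[OF p] by auto
      then show "i \<in> p ` {i. i < n \<and> f (p i) = k}" by (intro image_eqI[of _ _ "inv p i"]) auto
    qed (use permutes_in_image[OF p] in auto)
    finally show ?thesis .
  qed
  show ?thesis
  proof (cases "k = 0")
    case True
    have "length (filter (\<lambda>l. 0 < l) ?L) + length (filter (\<lambda>l. \<not> 0 < l) ?L) = n"
      using sum_length_filter_compl[of "\<lambda>l. 0 < l" ?L] by simp
    then show ?thesis using len True by (simp add: part_mult_def)
  next
    case False
    then have "filter (\<lambda>l. l = k) (filter (\<lambda>l. 0 < l) ?L) = filter (\<lambda>l. l = k) ?L"
      by (simp add: conj_commute cong: conj_cong)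
    moreover have "(=) k = (\<lambda>l. l = k)" by auto
    ultimately show ?thesis using False len by (simp only: part_mult_def count_list_eq_length_filter if_False)
  qed
qed

text \<open>For each permutation the partitions become level functions. After the sums are
  exchanged, each level function collects the permutations along which it decreases, and the
  t-factorials of their total weight cancel \<open>v_\<lambda>(t)\<close>.\<close>

lemma HL_P_sum_as_levels:
  assumes "generic_point {..<n} x t"
  shows "(\<Sum>la | is_partition la \<and> part la 0 \<le> M \<and> length la \<le> n. (\<Prod>k\<le>M. \<gamma> k (part_mult n la k)) * HL_P n la x t)
    = generic_point.level_sum {..<n} x t \<gamma> M {..<n}"
proof -
  interpret generic_point "{..<n}" x t by fact
  let ?P = "{p. p permutes {..<n}}" and ?Q = "{la. is_partition la \<and> part la 0 \<le> M \<and> length la \<le> n}"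
  let ?F = "{..<n} \<rightarrow>\<^sub>E {..M}" and ?A = "{..<n}"
  let ?s = "\<lambda>f p. sorted_wrt (\<ge>) (map f (map p [0..<n]))"
  define V where "V f = (\<Prod>k\<le>M. vfactor t (card {i\<in>?A. f i = k}))" for f :: "nat \<Rightarrow> nat"
  define Gf where "Gf f = (\<Prod>k\<le>M. \<gamma> k (card {i\<in>?A. f i = k})) * (\<Prod>i\<in>?A. x i ^ f i)" for f :: "nat \<Rightarrow> nat"
  have finP: "finite ?P" by (simp add: finite_permutations)
  have finF: "finite ?F" by (intro finite_PiE) auto
  have "(\<Sum>la\<in>?Q. (\<Prod>k\<le>M. \<gamma> k (part_mult n la k)) * HL_P n la x t) =
    (\<Sum>la\<in>?Q. \<Sum>p\<in>?P. (\<Prod>k\<le>M. \<gamma> k (part_mult n la k)) / vfac n la t * HL_summand n la t (x \<circ> p))"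
    by (rule sum.cong) (auto simp: HL_P_def sum_distrib_left)
  also have "\<dots> = (\<Sum>p\<in>?P. \<Sum>la\<in>?Q. (\<Prod>k\<le>M. \<gamma> k (part_mult n la k)) / vfac n la t * HL_summand n la t (x \<circ> p))"
    by (rule sum.swap)
  also have "\<dots> = (\<Sum>p\<in>?P. \<Sum>f\<in>?F. if ?s f p then Gf f / V f * list_weight (phi x t) (map p [0..<n]) else 0)"
  proof (rule sum.cong[OF refl])
    fix p assume "p \<in> ?P"
    then have p: "p permutes ?A" by simp
    have "(\<Sum>la\<in>?Q. (\<Prod>k\<le>M. \<gamma> k (part_mult n la k)) / vfac n la t * HL_summand n la t (x \<circ> p)) =
      (\<Sum>f | f \<in> ?F \<and> ?s f p. Gf f / V f * list_weight (phi x t) (map p [0..<n]))"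
      unfolding sum_partitions_as_levels[OF p]
    proof (rule sum.cong[OF refl])
      fix f assume f: "f \<in> {f. f \<in> ?F \<and> ?s f p}"
      let ?la = "filter (\<lambda>k. 0 < k) (map f (map p [0..<n]))"
      have pt: "part ?la i = f (p i)" if "i < n" for i
        using part_filter_decreasing[of "map f (map p [0..<n])" i] f that by simp
      have "is_partition ?la"
        using f by (auto simp: is_partition_def intro!: sorted_wrt_filter)
      moreover have "part ?la 0 \<le> M"
      proof (cases "n = 0")
        case False
        then show ?thesis using pt[of 0] f permutes_in_image[OF p, of 0] by (auto simp: PiE_iff)
      qed (simp add: part_def)
      ultimately have V: "vfac n ?la t = V f"
        by (simp only: vfac_upto part_mult_levels[OF p] V_def)
      have "(\<Prod>i<n. (x \<circ> p) i ^ part ?la i) = (\<Prod>i<n. x (p i) ^ f (p i))"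
        by (rule prod.cong[OF refl]) (simp only: pt o_apply lessThan_iff)
      also have "\<dots> = (\<Prod>i<n. x i ^ f i)"
        using prod.permute[OF p, of "\<lambda>i. x i ^ f i"] by (simp add: o_def)
      finally have "HL_summand n ?la t (x \<circ> p) = (\<Prod>i\<in>?A. x i ^ f i) * list_weight (phi x t) (map p [0..<n])"
        using list_weight_nth[of "map p [0..<n]" "phi x t"] permutes_inj_on[OF p]
        by (simp add: HL_summand_def phi_def distinct_map)
      then show "(\<Prod>k\<le>M. \<gamma> k (part_mult n ?la k)) / vfac n ?la t * HL_summand n ?la t (x \<circ> p) =
        Gf f / V f * list_weight (phi x t) (map p [0..<n])"
        unfolding V part_mult_levels[OF p] Gf_def by simp
    qed
    also have "\<dots> = (\<Sum>f\<in>?F. if ?s f p then Gf f / V f * list_weight (phi x t) (map p [0..<n]) else 0)"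
      by (rule sum.inter_filter[OF finF])
    finally show "(\<Sum>la\<in>?Q. (\<Prod>k\<le>M. \<gamma> k (part_mult n la k)) / vfac n la t * HL_summand n la t (x \<circ> p)) =
      (\<Sum>f\<in>?F. if ?s f p then Gf f / V f * list_weight (phi x t) (map p [0..<n]) else 0)" .
  qed
  also have "\<dots> = (\<Sum>f\<in>?F. \<Sum>p\<in>?P. if ?s f p then Gf f / V f * list_weight (phi x t) (map p [0..<n]) else 0)"
    by (rule sum.swap)
  also have "\<dots> = (\<Sum>f\<in>?F. Gf f * (\<Prod>i\<in>?A. \<Prod>j\<in>{j\<in>?A. f j < f i}. phi x t i j))"
  proof (rule sum.cong[OF refl])
    fix f assume f: "f \<in> ?F"
    let ?h = "\<lambda>xs. if sorted_wrt (\<ge>) (map f xs) then list_weight (phi x t) xs else 0"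
    have "(\<Sum>p\<in>?P. if ?s f p then Gf f / V f * list_weight (phi x t) (map p [0..<n]) else 0)
      = Gf f / V f * (\<Sum>p\<in>?P. ?h (map p [0..<n]))"
      unfolding sum_distrib_left by (intro sum.cong) auto
    also have "(\<Sum>p\<in>?P. ?h (map p [0..<n])) = (\<Sum>xs\<in>permutations_of_set ?A. ?h xs)"
      by (rule sum.reindex_bij_betw[OF bij_betw_permutes_lists])
    also have "\<dots> = (\<Sum>xs | xs \<in> permutations_of_set ?A \<and> sorted_wrt (\<ge>) (map f xs). list_weight (phi x t) xs)"
      by (rule sum.inter_filter[symmetric]) simp
    also have "\<dots> = V f * (\<Prod>i\<in>?A. \<Prod>j\<in>{j\<in>?A. f j < f i}. phi x t i j)"
      unfolding V_def using f by (intro sum_decreasing_permutations) (auto simp: PiE_iff)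
    finally have e: "(\<Sum>p\<in>?P. if ?s f p then Gf f / V f * list_weight (phi x t) (map p [0..<n]) else 0)
      = Gf f / V f * (V f * (\<Prod>i\<in>?A. \<Prod>j\<in>{j\<in>?A. f j < f i}. phi x t i j))" .
    have "vfactor t (card {i\<in>?A. f i = k}) \<noteq> 0" for k
      by (rule vfactor_nz, rule card_mono) auto
    then have "V f \<noteq> 0" by (simp add: V_def)
    then show "(\<Sum>p\<in>?P. if ?s f p then Gf f / V f * list_weight (phi x t) (map p [0..<n]) else 0)
      = Gf f * (\<Prod>i\<in>?A. \<Prod>j\<in>{j\<in>?A. f j < f i}. phi x t i j)"
      unfolding e by simp
  qed
  also have "\<dots> = level_sum \<gamma> M ?A"
    by (simp only: level_sum_def Gf_def order_refl if_True)
  finally show ?thesis .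
qed

section \<open>Comparison of the recursions\<close>

context generic_point
begin

definition h_weight :: "'a \<Rightarrow> 'a \<Rightarrow> nat \<Rightarrow> nat \<Rightarrow> 'a" where
  "h_weight a b k c = (if even k then rogers_szego c (a * b) t else (- a) ^ c * rogers_szego c (b / a) t)"

text \<open>Only the parity of the distance \<open>d - k\<close> to the top level matters, and \<open>d + k\<close> has the same parity.\<close>

definition chain :: "'a \<Rightarrow> 'a \<Rightarrow> nat \<Rightarrow> nat set \<Rightarrow> 'a" where
  "chain a b d = level_sum (\<lambda>k. if k = d then \<lambda>_. 1 else h_weight a b (d + k)) d"

lemma chain_0: "chain a b 0 = E (\<lambda>_. 1)"
  unfolding chain_def level_sum_0 by (simp add: fun_eq_iff grouplike_def card_fun_def)

lemma chain_Suc: "chain a b (Suc d) = card_fun N (h_weight a b (Suc d)) \<star> twist x (chain a b d)"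
proof -
  \<comment> \<open>The distance to the top and the level index both grow by 1, so the parity of
    their sum is kept.\<close>
  have "h_weight a b (Suc d + Suc k) = h_weight a b (d + k)" for k
    by (simp add: h_weight_def fun_eq_iff)
  then show ?thesis unfolding chain_def level_sum_Suc by (simp cong: if_cong)
qed

lemma h_weight_even:
  assumes "even k"
  shows "card_fun N (h_weight a b k) = E (\<lambda>_. 1) \<star> E (\<lambda>_. a * b)"
proof
  fix A show "card_fun N (h_weight a b k) A = (E (\<lambda>_. 1) \<star> E (\<lambda>_. a * b)) A"
    using assms rogers_szego_star[of A "a * b"]
    by (cases "A \<subseteq> N") (simp_all add: card_fun_def h_weight_def star_def[of N _ _ _ A])
qed

text \<open>The power of \<open>- a\<close> is a twist, which turns \<open>E(b / a)\<close> into
  \<open>E(- b)\<close> and thus clears the denominator.\<close>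

lemma h_weight_odd:
  assumes "odd k" "a \<noteq> 0"
  shows "card_fun N (h_weight a b k) = E (\<lambda>_. - a) \<star> E (\<lambda>_. - b)"
proof -
  have "card_fun N (h_weight a b k) = twist (\<lambda>_. - a) (E (\<lambda>_. 1) \<star> E (\<lambda>_. b / a))"
  proof
    fix A show "card_fun N (h_weight a b k) A = twist (\<lambda>_. - a) (E (\<lambda>_. 1) \<star> E (\<lambda>_. b / a)) A"
      using assms rogers_szego_star[of A "b / a"]
      by (cases "A \<subseteq> N") (simp_all add: twist_def card_fun_def h_weight_def star_def[of N _ _ _ A])
  qed
  then show ?thesis using assms by (simp add: twist_star[OF finite_N] twist_grouplike)
qed

text \<open>\<open>E_quadratic\<close> uses factors from three consecutive levels:
  \<open>E(1)\<close> from an even one, both factors of the odd one after it, and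
  \<open>E(a * b)\<close> from the next even one. Hence a chain starting at an even level has an
  \<open>E(a * b)\<close> left over in front.\<close>

lemma chain_even_odd:
  assumes "a \<noteq> 0"
  shows "chain a b (2 * m) = E (\<lambda>_. a * b) \<star> bc_sum N x t a b m"
    and "E (\<lambda>_. 1) \<star> twist x (chain a b (Suc (2 * m))) = bc_sum N x t a b (Suc m)"
proof -
  have step: "E (\<lambda>_. 1) \<star> twist x (chain a b (Suc (2 * m))) = bc_sum N x t a b (Suc m)"
    if "chain a b (2 * m) = E (\<lambda>_. a * b) \<star> bc_sum N x t a b m" for m
  proof -
    have "chain a b (Suc (2 * m)) = E (\<lambda>_. - a) \<star> E (\<lambda>_. - b) \<star> twist x (E (\<lambda>_. a * b) \<star> bc_sum N x t a b m)"
      unfolding chain_Suc that using h_weight_odd[of "Suc (2 * m)", OF _ assms] by simp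
    then have "twist x (chain a b (Suc (2 * m))) = E (\<lambda>i. - a * x i) \<star> E (\<lambda>i. - b * x i) \<star>
        (E (\<lambda>i. a * b * (x i)\<^sup>2) \<star> twist (\<lambda>i. (x i)\<^sup>2) (bc_sum N x t a b m))"
      by (simp add: twist_star[OF finite_N] twist_grouplike twist_twist power2_eq_square mult_ac)
    then show ?thesis
      unfolding bc_sum_Suc E_quadratic[symmetric] by (simp only: assoc)
  qed
  show even: "chain a b (2 * m) = E (\<lambda>_. a * b) \<star> bc_sum N x t a b m" for m
  proof (induction m)
    case 0
    have "bc_sum N x t a b 0 = card_fun N (qpoch (a * b) t)"
    proof
      fix A show "bc_sum N x t a b 0 A = card_fun N (qpoch (a * b) t) A"
        using bc_sum_zero[OF generic_point_axioms, of A a b]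
        by (cases "A \<subseteq> N") (simp_all add: card_fun_def bc_sum_def star_def[of N _ _ _ A])
    qed
    \<comment> \<open>The chain of length 0 is \<open>E(1)\<close>, which \<open>gauss_star\<close>
      writes as \<open>E(a * b)\<close> times the Pochhammer function.\<close>
    then show ?case by (simp add: chain_0 gauss_star)
  next
    case (Suc m)
    have "chain a b (2 * Suc m) = E (\<lambda>_. 1) \<star> E (\<lambda>_. a * b) \<star> twist x (chain a b (Suc (2 * m)))"
      using chain_Suc[of a b "Suc (2 * m)"] h_weight_even[of "Suc (Suc (2 * m))" a b] by simp
    \<comment> \<open>Commuting the constants puts \<open>E(a * b)\<close> in front and leaves
      \<open>E(1)\<close> next to the odd level.\<close>
    then show ?case using step[OF Suc] by (simp only: E_const_commute[of 1 "a * b"] assoc)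
  qed
  show "E (\<lambda>_. 1) \<star> twist x (chain a b (Suc (2 * m))) = bc_sum N x t a b (Suc m)"
    by (rule step[OF even])
qed

end

section \<open>Evaluation of the hyperoctahedral sum for a rectangle\<close>

lemma vfac_rect: "vfac n (rect_partition m n) t = vfactor t n"
proof (cases "m = 0 \<or> n = 0")
  case True
  then show ?thesis
    by (auto simp: vfac_def rect_partition_def part_def part_mult_def vfactor_def)
next
  case False
  then have r: "rect_partition m n = replicate n m" by (simp add: rect_partition_def)
  have "is_partition (replicate n m)"
    using False by (auto simp: is_partition_def sorted_wrt_iff_nth_less)
  moreover have "part (replicate n m) 0 = m" using False by (simp add: part_def nth_default_def)
  ultimately have "vfac n (replicate n m) t = (\<Prod>k\<le>m. vfactor t (part_mult n (replicate n m) k))"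
    by (intro vfac_upto) auto
  also have "\<dots> = (\<Prod>k\<in>{m}. vfactor t (part_mult n (replicate n m) k))"
  proof (rule prod.mono_neutral_right)
    show "\<forall>k\<in>{..m} - {m}. vfactor t (part_mult n (replicate n m) k) = 1"
      by (auto simp: part_mult_def count_list_0_iff)
  qed auto
  also have "\<dots> = vfactor t n"
  proof -
    have "count_list (replicate n m) m = n" by (induction n) auto
    then show ?thesis using False by (simp add: part_mult_def)
  qed
  finally show ?thesis using r by simp
qed

lemma part_rect: "i < n \<Longrightarrow> part (rect_partition m n) i = m"
  by (simp add: part_def rect_partition_def nth_default_def)

text \<open>For fixed signs, only the factors \<open>(t * y i - y j) / (y i - y j)\<close> of the
  summand are changed by permutations. They are the kernel at the inverse variables, and their
  products sum to the t-factorial.\<close>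

lemma sum_hyperoct_BC_summand:
  assumes "generic_point {..<n} x t"
  shows "(\<Prod>i<n. x i) ^ m * (\<Sum>w\<in>hyperoct n. BC_summand n (rect_partition m n) t a b (hyperoct_act w x))
    = vfactor t n * bc_sum {..<n} x t a b m {..<n}"
proof -
  interpret generic_point "{..<n}" x t by fact
  let ?A = "{..<n}" and ?P = "{p. p permutes {..<n}}"
  let ?y = "\<lambda>S i. if i \<in> S then inverse (x i) else x i"
  let ?g = "\<lambda>y i j. (1 - t * y i * y j) / (1 - y i * y j)"
  have perm: "(\<Sum>p\<in>?P. BC_summand n (rect_partition m n) t a b (y \<circ> p)) =
    vfactor t n * ((\<Prod>i\<in>?A. inverse (y i) ^ m) * bc_half ?A y t a b ?A)" if y: "generic_point ?A y t" for y
  proof -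
    interpret y: generic_point ?A y t by fact
    let ?z = "\<lambda>i. inverse (y i)"
    interpret z: generic_point ?A ?z t by (rule y.inverse_point)
    have "BC_summand n (rect_partition m n) t a b (y \<circ> p) =
      (\<Prod>i\<in>?A. inverse (y i) ^ m) * bc_half ?A y t a b ?A * list_weight (phi ?z t) (map p [0..<n])" if "p \<in> ?P" for p
    proof -
      have p: "p permutes ?A" using that by simp
      have d: "distinct (map p [0..<n])" "set (map p [0..<n]) = ?A"
        using permutes_inj_on[OF p] permutes_image[OF p] by (simp_all add: distinct_map atLeast0LessThan)
      have "(\<Prod>i<n. inverse ((y \<circ> p) i) ^ part (rect_partition m n) i) = (\<Prod>i<n. inverse (y i) ^ m)"
        using prod.permute[OF p, of "\<lambda>i. inverse (y i) ^ m"] by (simp add: part_rect o_def)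
      moreover have "(\<Prod>i<n. (1 - a * (y \<circ> p) i) * (1 - b * (y \<circ> p) i) / (1 - ((y \<circ> p) i)\<^sup>2)) =
         (\<Prod>i<n. (1 - a * y i) * (1 - b * y i) / (1 - (y i)\<^sup>2))"
        using prod.permute[OF p, of "\<lambda>i. (1 - a * y i) * (1 - b * y i) / (1 - (y i)\<^sup>2)"] by (simp add: o_def)
      moreover have "(\<Prod>j<n. \<Prod>i<j. (t * (y \<circ> p) i - (y \<circ> p) j) * (1 - t * (y \<circ> p) i * (y \<circ> p) j) /
          (((y \<circ> p) i - (y \<circ> p) j) * (1 - (y \<circ> p) i * (y \<circ> p) j))) =
        list_weight (phi ?z t) (map p [0..<n]) * pair_prod (?g y) ?A"
      proof -
        let ?k = "\<lambda>i j. (t * y i - y j) * (1 - t * y i * y j) / ((y i - y j) * (1 - y i * y j))"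
        have "(\<Prod>j<n. \<Prod>i<j. (t * (y \<circ> p) i - (y \<circ> p) j) * (1 - t * (y \<circ> p) i * (y \<circ> p) j) /
          (((y \<circ> p) i - (y \<circ> p) j) * (1 - (y \<circ> p) i * (y \<circ> p) j))) = list_weight ?k (map p [0..<n])"
          using list_weight_nth[OF d(1), of ?k] by simp
        also have "\<dots> = list_weight (\<lambda>i j. phi ?z t i j * ?g y i j) (map p [0..<n])"
        proof (rule list_weight_cong[OF d(1)])
          fix i j assume "i \<in> set (map p [0..<n])" "j \<in> set (map p [0..<n])"
          then have "y i \<noteq> 0" "y j \<noteq> 0" using y.x_nz d(2) by auto
          then have "phi ?z t i j = (y j - t * y i) / (y j - y i)" by (simp add: phi_inverse) (simp add: phi_def)
          also have "\<dots> = (t * y i - y j) / (y i - y j)"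
            using minus_divide_divide[of "y j - t * y i" "y j - y i"] by simp
          finally show "?k i j = phi ?z t i j * ?g y i j" by simp
        qed
        also have "\<dots> = list_weight (phi ?z t) (map p [0..<n]) * list_weight (?g y) (map p [0..<n])"
          by (rule list_weight_mult)
        also have "list_weight (?g y) (map p [0..<n]) = pair_prod (?g y) (set (map p [0..<n]))"
          by (rule list_weight_symmetric[OF d(1)]) (simp add: mult_ac)
        finally show ?thesis unfolding d(2) .
      qed
      moreover have "bc_half ?A y t a b ?A = (\<Prod>i<n. (1 - a * y i) * (1 - b * y i) / (1 - (y i)\<^sup>2)) * pair_prod (?g y) ?A"
        by (simp add: bc_half_def twist_def littlewood_def prod_dividef prod.distrib)
      ultimately show ?thesis unfolding BC_summand_def by (simp only: mult_ac)
    qed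
    then have "(\<Sum>p\<in>?P. BC_summand n (rect_partition m n) t a b (y \<circ> p)) =
      (\<Prod>i\<in>?A. inverse (y i) ^ m) * bc_half ?A y t a b ?A * (\<Sum>p\<in>?P. list_weight (phi ?z t) (map p [0..<n]))"
      unfolding sum_distrib_left by (intro sum.cong) auto
    also have "(\<Sum>p\<in>?P. list_weight (phi ?z t) (map p [0..<n])) = (\<Sum>xs\<in>permutations_of_set ?A. list_weight (phi ?z t) xs)"
      by (rule sum.reindex_bij_betw[OF bij_betw_permutes_lists])
    \<comment> \<open>For a constant level function every list is decreasing, so
      \<open>sum_decreasing_permutations\<close> gives the sum over all permutations.\<close>
    also have "\<dots> = vfactor t n"
    proof -
      have "sorted_wrt (\<ge>) (map (\<lambda>_. 0::nat) xs)" for xs :: "nat list" by (induction xs) auto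
      then show ?thesis
        using z.sum_decreasing_permutations[of ?A "{0}" "\<lambda>_. 0"] by (simp add: image_subset_iff)
    qed
    finally show ?thesis by (simp only: mult_ac)
  qed
  have act: "hyperoct_act (p, S) x = ?y S \<circ> p" for p S
    by (simp add: fun_eq_iff hyperoct_act_def)
  have "(\<Prod>i<n. x i) ^ m * (\<Sum>w\<in>hyperoct n. BC_summand n (rect_partition m n) t a b (hyperoct_act w x))
    = (\<Prod>i<n. x i) ^ m * (\<Sum>S\<in>Pow ?A. \<Sum>p\<in>?P. BC_summand n (rect_partition m n) t a b (?y S \<circ> p))"
  proof -
    have "(\<Sum>w\<in>hyperoct n. BC_summand n (rect_partition m n) t a b (hyperoct_act w x)) =
      (\<Sum>(p, S)\<in>?P \<times> Pow ?A. BC_summand n (rect_partition m n) t a b (?y S \<circ> p))"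
      by (rule sum.cong) (auto simp: hyperoct_def act)
    then show ?thesis unfolding sum.cartesian_product[symmetric] by (subst sum.swap) simp
  qed
  also have "\<dots> = (\<Prod>i<n. x i) ^ m * (\<Sum>S\<in>Pow ?A. vfactor t n * ((\<Prod>i\<in>?A. inverse (?y S i) ^ m) * bc_half ?A (?y S) t a b ?A))"
    by (simp only: perm[OF sign_point])
  also have "\<dots> = vfactor t n * (\<Sum>S\<in>Pow ?A. (\<Prod>i\<in>S. x i ^ (2 * m)) * bc_half ?A (?y S) t a b ?A)"
    unfolding sum_distrib_left
  proof (rule sum.cong[OF refl])
    fix S assume S: "S \<in> Pow ?A"
    have "(\<Prod>i\<in>?A. x i) ^ m * (\<Prod>i\<in>?A. inverse (?y S i) ^ m) = (\<Prod>i\<in>?A. if i \<in> S then x i ^ (2 * m) else 1)"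
      unfolding prod_power_distrib prod.distrib[symmetric]
    proof (rule prod.cong[OF refl])
      fix i assume "i \<in> ?A"
      then have "x i \<noteq> 0" by (rule x_nz)
      then show "x i ^ m * inverse (?y S i) ^ m = (if i \<in> S then x i ^ (2 * m) else 1)"
        by (simp add: power_mult_distrib[symmetric] power_mult power2_eq_square)
    qed
    also have "\<dots> = (\<Prod>i\<in>S. x i ^ (2 * m))"
      using S by (simp add: prod.If_cases Int_absorb1)
    finally have e: "(\<Prod>i\<in>?A. x i) ^ m * (\<Prod>i\<in>?A. inverse (?y S i) ^ m) = (\<Prod>i\<in>S. x i ^ (2 * m))" .
    have "p * (v * (q * c)) = v * ((p * q) * c)" for p v q c :: 'a
      by (simp only: mult_ac)
    then show "(\<Prod>i<n. x i) ^ m * (vfactor t n * ((\<Prod>i\<in>?A. inverse (?y S i) ^ m) * bc_half ?A (?y S) t a b ?A))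
      = vfactor t n * ((\<Prod>i\<in>S. x i ^ (2 * m)) * bc_half ?A (?y S) t a b ?A)"
      by (simp only: e)
  qed
  also have "\<dots> = vfactor t n * bc_sum ?A x t a b m ?A"
    by (simp only: bc_sum_signs[OF order_refl])
  finally show ?thesis .
qed

text \<open>Levels 0 and \<open>M\<close> get weight 1 because \<open>h_fun\<close> has factors only
  strictly between them, where \<open>part_mult\<close> is a plain count.\<close>

lemma h_fun_levels:
  assumes "generic_point N x t"
  shows "h_fun M la a b t = (\<Prod>k\<le>M. (if k = 0 \<or> k = M then \<lambda>_. 1 else generic_point.h_weight t a b k) (part_mult n la k))"
proof -
  interpret generic_point N x t by fact
  have "(\<Prod>k\<le>M. (if k = 0 \<or> k = M then \<lambda>_. 1 else h_weight a b k) (part_mult n la k))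
    = (\<Prod>k\<in>{1..<M}. (if k = 0 \<or> k = M then \<lambda>_. 1 else h_weight a b k) (part_mult n la k))"
    by (rule prod.mono_neutral_right) auto
  also have "\<dots> = (\<Prod>k\<in>{1..<M}. if odd k then (- a) ^ count_list la k * rogers_szego (count_list la k) (b / a) t
      else rogers_szego (count_list la k) (a * b) t)"
    by (rule prod.cong) (auto simp: h_weight_def part_mult_def)
  also have "\<dots> = h_fun M la a b t"
    unfolding h_fun_def by (subst prod.If_cases) (auto simp: Int_def Collect_neg_eq[symmetric] conj_commute)
  finally show ?thesis by simp
qed

text \<open>The hypotheses keep denominators away from 0: \<open>t_generic\<close> those with
  \<open>v_\<lambda>(t)\<close> and the Gaussian binomials, \<open>x_inverse\<close> with
  \<open>i = j\<close> the factors \<open>1 - (x i)\<^sup>2\<close>, and \<open>t2_nonzero\<close>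
  the argument \<open>t3 / t2\<close>.\<close>

theorem theorem4p7:
  fixes n m :: nat and x :: "nat \<Rightarrow> 'a::field_char_0" and t t2 t3 :: 'a
  assumes x_nonzero: "\<And>i. i < n \<Longrightarrow> x i \<noteq> 0"
    and x_distinct: "\<And>i j. i < n \<Longrightarrow> j < n \<Longrightarrow> i \<noteq> j \<Longrightarrow> x i \<noteq> x j"
    and x_inverse: "\<And>i j. i < n \<Longrightarrow> j < n \<Longrightarrow> x i * x j \<noteq> 1"
    and t_generic: "\<And>k. 1 \<le> k \<Longrightarrow> k \<le> n \<Longrightarrow> t ^ k \<noteq> 1"
    and t2_nonzero: "t2 \<noteq> 0"
    and t2_t3_generic: "qpoch (t2 * t3) t (n - length (rect_partition m n)) \<noteq> 0"
  shows "Sum_any (\<lambda>la. if is_partition la \<and> part la 0 \<le> 2 * m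
                      then h_fun (2 * m) la t2 t3 t * HL_P n la x t else 0)
         = (\<Prod>i<n. x i) ^ m * BC_P n (rect_partition m n) x t t2 t3"
proof -
  have gp: "generic_point {..<n} x t"
    by standard (use assms in \<open>auto simp: inj_on_def\<close>)
  interpret generic_point "{..<n}" x t by (rule gp)
  let ?A = "{..<n}"
  let ?\<gamma> = "\<lambda>k. if k = 0 \<or> k = 2 * m then \<lambda>_. 1 else h_weight t2 t3 k"
  have "Sum_any (\<lambda>la. if is_partition la \<and> part la 0 \<le> 2 * m then h_fun (2 * m) la t2 t3 t * HL_P n la x t else 0)
    = level_sum ?\<gamma> (2 * m) ?A"
    unfolding Sum_any_HL_P h_fun_levels[OF gp, where n = n] by (rule HL_P_sum_as_levels[OF gp])
  moreover have "(\<Prod>i<n. x i) ^ m * BC_P n (rect_partition m n) x t t2 t3 =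
    bc_sum ?A x t t2 t3 m ?A / qpoch (t2 * t3) t (n - length (rect_partition m n))"
  proof -
    have "vfactor t n \<noteq> 0" by (rule vfactor_nz) simp
    then show ?thesis
      using sum_hyperoct_BC_summand[OF gp, of m t2 t3] t2_t3_generic
      by (simp add: BC_P_def vfac_rect field_simps)
  qed
  moreover have "level_sum ?\<gamma> (2 * m) ?A = bc_sum ?A x t t2 t3 m ?A / qpoch (t2 * t3) t (n - length (rect_partition m n))"
  proof (cases m)
    \<comment> \<open>The rectangle is now the empty partition, so the normalisation contains the
      full \<open>(t2 t3; t)_n\<close>, which cancels the value of the sum.\<close>
    case 0
    then have "rect_partition m n = []" by (simp add: rect_partition_def)
    moreover have "bc_sum ?A x t t2 t3 0 ?A = qpoch (t2 * t3) t n"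
      using bc_sum_zero[OF gp order_refl] by simp
    ultimately show ?thesis using 0 t2_t3_generic by (simp add: level_sum_0 card_fun_def)
  next
    case (Suc l)
    \<comment> \<open>Counted from level 1, the top level is \<open>Suc (2 * l)\<close>; moreover
      \<open>Suc k\<close> and \<open>Suc (2 * l) + k\<close> have the same parity, which matches
      \<open>chain\<close>.\<close>
    have "(\<lambda>k. ?\<gamma> (Suc k)) = (\<lambda>k. if k = Suc (2 * l) then \<lambda>_. 1 else h_weight t2 t3 (Suc (2 * l) + k))"
      by (auto simp: Suc h_weight_def fun_eq_iff)
    then have "level_sum ?\<gamma> (2 * m) = star ?A (phi x t) (card_fun ?A (\<lambda>_. 1)) (twist x (chain t2 t3 (Suc (2 * l))))"
      using level_sum_Suc[of ?\<gamma> "Suc (2 * l)"] by (simp add: Suc chain_def)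
    also have "card_fun ?A (\<lambda>_. 1) = grouplike ?A (\<lambda>_. 1)" by (simp add: fun_eq_iff grouplike_def card_fun_def)
    also have "star ?A (phi x t) (grouplike ?A (\<lambda>_. 1)) (twist x (chain t2 t3 (Suc (2 * l)))) = bc_sum ?A x t t2 t3 m"
      unfolding Suc by (rule chain_even_odd(2)[OF t2_nonzero])
    \<comment> \<open>The rectangle now has \<open>n\<close> parts, so the Pochhammer factor is an
      empty product.\<close>
    finally show ?thesis using Suc by (simp add: rect_partition_def)
  qed
  ultimately show ?thesis by simp
qed

end
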